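(* Let $1<p<\infty$, let $a\in L^\infty(\mathbb T)$ be invertible in $L^\infty(\mathbb T)$, and let $A:H^p\to H^p$ be any one of the operators $$T(a)-H_\alpha(a\chi^{-1}),\quad T(a)+H_\alpha(a\chi),\quad T(a)+H_\alpha(a),\quad T(a)-H_\alpha(a).$$ Then $\ker A=\{0\}$ or $\operatorname{coker}A=\{0\}$.
   Context: $\mathbb T$ is the unit circle; $H^p=\{f\in L^p(\mathbb T):\widehat f_n=0,\ n<0\}$; $P:\sum_{n\in\mathbb Z}\widehat f_nt^n\mapsto\sum_{n\ge0}\widehat f_nt^n$ on $L^p(\mathbb T)$, $1<p<\infty$, and $Q=I-P$. Fix $\beta\in\mathbb C$ with $|\beta|>1$, put $\lambda:=i\sqrt{|\beta|^2-1}$, $\alpha(t)=\dfrac{t-\beta}{\overline\beta t-1}$ (a map of $\mathbb T$ onto itself with $\alpha\circ\alpha=\mathrm{id}$), $\chi(t):=(\overline\beta t-1)/\lambda$, and $J_\alpha\varphi(t):=\chi(t)^{-1}\varphi(\alpha(t))$ on $L^p(\mathbb T)$. For $b\in L^\infty(\mathbb T)$, on $H^p$: $T(b)\varphi=P(b\varphi)$ and $H_\alpha(b)\varphi=P(bQJ_\alpha\varphi)$. $\operatorname{coker}A:=\ker A^*$, where $A^*$ is the adjoint operator (no Fredholmness or closed range of $A$ is assumed). *)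

theory Defs
  imports "HOL-Analysis.Analysis"
begin

text \<open>
  Elements of \<open>L\<^sup>p\<close> are represented by functions \<open>complex \<Rightarrow> complex\<close>, of which only the values
  on the unit circle matter; two functions represent the same element iff they agree
  almost everywhere with respect to \<open>circle\<close>.
\<close>

definition circle :: "complex measure" where
  "circle = distr (uniform_measure lborel {0..2 * pi}) (restrict_space borel (sphere 0 1)) cis"

definition Lp :: "real \<Rightarrow> (complex \<Rightarrow> complex) set" where
  "Lp p = {f \<in> borel_measurable circle. integrable circle (\<lambda>t. norm (f t) powr p)}"

definition Lp_norm :: "real \<Rightarrow> (complex \<Rightarrow> complex) \<Rightarrow> real" where
  "Lp_norm p f = (LINT t|circle. norm (f t) powr p) powr (1 / p)"

definition Linf :: "(complex \<Rightarrow> complex) set" where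
  "Linf = {f \<in> borel_measurable circle. \<exists>C. AE t in circle. norm (f t) \<le> C}"

definition invertible_Linf :: "(complex \<Rightarrow> complex) \<Rightarrow> bool" where
  "invertible_Linf a \<longleftrightarrow> a \<in> Linf \<and> (\<exists>b \<in> Linf. AE t in circle. a t * b t = 1)"

text \<open>The representatives of the zero element, the same for every \<open>p\<close>.\<close>

definition null_funs :: "(complex \<Rightarrow> complex) set" where
  "null_funs = {f \<in> borel_measurable circle. AE t in circle. f t = 0}"

definition fourier_coeff :: "(complex \<Rightarrow> complex) \<Rightarrow> int \<Rightarrow> complex" where
  "fourier_coeff f n = (LINT t|circle. f t * t powi (- n))"

definition Hp :: "real \<Rightarrow> (complex \<Rightarrow> complex) set" where
  "Hp p = {f \<in> Lp p. \<forall>n<0. fourier_coeff f n = 0}"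

text \<open>
  \<open>P f\<close> is the element of \<open>L\<^sup>p\<close> with Fourier series \<open>\<Sum>n\<ge>0. f\<^sub>n t\<^sup>n\<close>. It exists for \<open>1 < p < \<infinity>\<close> by
  the M. Riesz theorem, and is determined up to null functions because an integrable function
  is determined by its Fourier coefficients; the choice operator only picks a representative.
\<close>

definition riesz_P :: "real \<Rightarrow> (complex \<Rightarrow> complex) \<Rightarrow> complex \<Rightarrow> complex" where
  "riesz_P p f = (SOME g. g \<in> Lp p \<and>
     (\<forall>n. fourier_coeff g n = (if n \<ge> 0 then fourier_coeff f n else 0)))"

definition riesz_Q :: "real \<Rightarrow> (complex \<Rightarrow> complex) \<Rightarrow> complex \<Rightarrow> complex" where
  "riesz_Q p f = (\<lambda>t. f t - riesz_P p f t)"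

definition lam :: "complex \<Rightarrow> complex" where
  "lam \<beta> = \<i> * complex_of_real (sqrt ((norm \<beta>)\<^sup>2 - 1))"

definition shift :: "complex \<Rightarrow> complex \<Rightarrow> complex" where
  "shift \<beta> t = (t - \<beta>) / (cnj \<beta> * t - 1)"

definition chi :: "complex \<Rightarrow> complex \<Rightarrow> complex" where
  "chi \<beta> t = (cnj \<beta> * t - 1) / lam \<beta>"

definition J_shift :: "complex \<Rightarrow> (complex \<Rightarrow> complex) \<Rightarrow> complex \<Rightarrow> complex" where
  "J_shift \<beta> \<phi> = (\<lambda>t. inverse (chi \<beta> t) * \<phi> (shift \<beta> t))"

definition toeplitz :: "real \<Rightarrow> (complex \<Rightarrow> complex) \<Rightarrow> (complex \<Rightarrow> complex) \<Rightarrow> complex \<Rightarrow> complex" where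
  "toeplitz p b \<phi> = riesz_P p (\<lambda>t. b t * \<phi> t)"

definition hankel ::
  "real \<Rightarrow> complex \<Rightarrow> (complex \<Rightarrow> complex) \<Rightarrow> (complex \<Rightarrow> complex) \<Rightarrow> complex \<Rightarrow> complex" where
  "hankel p \<beta> b \<phi> = riesz_P p (\<lambda>t. b t * riesz_Q p (J_shift \<beta> \<phi>) t)"

text \<open>
  The dual space of \<open>H\<^sup>p\<close>. Functionals are set to \<open>0\<close> outside \<open>H\<^sup>p\<close>, so that equality of
  functionals on \<open>H\<^sup>p\<close> is equality of functions; the norm bound and linearity force them to
  respect equality almost everywhere.
\<close>

definition Hp_dual :: "real \<Rightarrow> ((complex \<Rightarrow> complex) \<Rightarrow> complex) set" where
  "Hp_dual p = {l.
     (\<forall>f \<in> Hp p. \<forall>g \<in> Hp p. l (\<lambda>t. f t + g t) = l f + l g) \<and>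
     (\<forall>f \<in> Hp p. \<forall>c. l (\<lambda>t. c * f t) = c * l f) \<and>
     (\<exists>C. \<forall>f \<in> Hp p. norm (l f) \<le> C * Lp_norm p f) \<and>
     (\<forall>f. f \<notin> Hp p \<longrightarrow> l f = 0)}"

definition adjoint_op ::
  "real \<Rightarrow> ((complex \<Rightarrow> complex) \<Rightarrow> complex \<Rightarrow> complex) \<Rightarrow>
    ((complex \<Rightarrow> complex) \<Rightarrow> complex) \<Rightarrow> (complex \<Rightarrow> complex) \<Rightarrow> complex" where
  "adjoint_op p A l = (\<lambda>f. if f \<in> Hp p then l (A f) else 0)"

definition ker_op :: "real \<Rightarrow> ((complex \<Rightarrow> complex) \<Rightarrow> complex \<Rightarrow> complex) \<Rightarrow> (complex \<Rightarrow> complex) set" where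
  "ker_op p A = {\<phi> \<in> Hp p. A \<phi> \<in> null_funs}"

definition coker_op ::
  "real \<Rightarrow> ((complex \<Rightarrow> complex) \<Rightarrow> complex \<Rightarrow> complex) \<Rightarrow> ((complex \<Rightarrow> complex) \<Rightarrow> complex) set" where
  "coker_op p A = {l \<in> Hp_dual p. adjoint_op p A l = (\<lambda>_. 0)}"

end

theory Submission
  imports Defs "HOL-Complex_Analysis.Complex_Analysis"
begin

text \<open>
  All four operators have the form \<open>A \<phi> = P (a (\<phi> + s K \<phi>))\<close> on \<open>Hp\<close>, where \<open>s = \<plusminus>1\<close> and
  \<open>K \<phi> = chi\<^sup>-\<^sup>e (\<phi> \<circ> \<alpha>)\<close> with \<open>e \<in> {0, 1, 2}\<close> is an involution.

  Let \<open>l\<close> be in the cokernel, extended to \<open>Lp\<close> as \<open>l \<circ> P\<close>. The functional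
  \<open>\<Omega> f = l (P (a (f + s K f)))\<close> vanishes on \<open>Hp\<close> and is invariant under \<open>s K\<close>, which forces \<open>\<Omega> = 0\<close>
  on \<open>Lp\<close>. Let \<open>\<phi>\<close> be in the kernel. Then \<open>\<psi> = \<phi> + s K \<phi>\<close> is fixed by \<open>s K\<close>, and
  \<open>\<eta> = a \<psi>\<close> has no coefficients of index \<open>\<ge> 0\<close>. Evaluating \<open>\<Omega>\<close> at \<open>t\<^sup>k \<psi>\<close> gives
  \<open>l (P (\<eta> t\<^sup>k)) + l (P (\<eta> \<alpha>\<^sup>k)) = 0\<close>, where the second term vanishes because multiplication
  by \<open>\<alpha>\<^sup>k\<close> preserves the coanalytic functions. So \<open>\<Sum>i<k. l (t\<^sup>i) \<eta>\<^sub>i\<^sub>-\<^sub>k = 0\<close> for all \<open>k\<close>: the product of two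
  formal power series is zero, hence one of the factors is. This needs no representation of
  the dual space and no boundary uniqueness theorem for Hardy functions.

  That \<open>P\<close> exists on \<open>Lp\<close> is the theorem of M. Riesz. For \<open>1 < p \<le> 2\<close> and a polynomial \<open>q\<close> with positive real
  part it follows from the mean value property of \<open>q\<^sup>p\<close>; a general \<open>q\<close> is a difference of two such
  polynomials, and the bound for \<open>p\<close> implies that for \<open>2 p\<close> by squaring.
\<close>

section \<open>Integration over the circle\<close>

text \<open>For \<open>\<phi>\<close> in \<open>Hp\<close> the function
  \<open>J_shift \<beta> \<phi>\<close> has no coefficients of index \<ge> 0, so
  \<open>riesz_Q\<close> does not change it; this is why a Toeplitz plus a Hankel operator becomes
  one projected product. The pairs (e, s) are not arbitrary. For e = 0, s = -1 the constants are
  annihilated by 1 + s K; for e = 2, s = 1 the function 1 / chi is fixed by s K, and invariance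
  would say nothing about \<Omega> on it. The four operators avoid exactly these two pairs. Without
  closed range, all that is known of a cokernel element l is that it vanishes on the range of A. The
  product of t^k and \<psi> is in general outside \<open>Hp\<close>, so this information becomes
  usable only after the vanishing of \<Omega> has been extended from \<open>Hp\<close> to
  \<open>Lp\<close>. The resulting equations are finite sums: l composed with P sees only indices
  \<ge> 0, and the product of t^k and \<eta> has only indices below k. Hence no question of
  convergence arises, and formal power series over a field, which have no zero divisors, are
  enough.\<close>

lemma space_circle: "space circle = sphere 0 1"
  by (simp add: circle_def space_restrict_space)

lemma sets_circle: "sets circle = sets (restrict_space borel (sphere 0 1))"
  by (simp add: circle_def)

lemma in_space_circle_iff: "t \<in> space circle \<longleftrightarrow> norm t = 1"
  by (simp add: space_circle)

lemma measurable_circle_cong_sets: "measurable circle N = measurable (restrict_space borel (sphere 0 1)) N"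
  by (rule measurable_cong_sets) (simp_all add: sets_circle)

lemma borel_measurable_circle_continuous:
  assumes "continuous_on (sphere 0 1) f"
  shows "f \<in> borel_measurable circle"
  unfolding measurable_circle_cong_sets using assms
  by (rule borel_measurable_continuous_on_restrict)

lemma continuous_on_sphere_bounded:
  fixes f :: "complex \<Rightarrow> 'b::real_normed_vector"
  assumes "continuous_on (sphere 0 1) f"
  shows "\<exists>C. \<forall>t\<in>sphere 0 1. norm (f t) \<le> C"
  using compact_imp_bounded[OF compact_continuous_image[OF assms compact_sphere]]
  unfolding bounded_iff by blast

lemma borel_measurable_circle_id [measurable]: "(\<lambda>t. t) \<in> borel_measurable circle"
  by (rule borel_measurable_circle_continuous) (rule continuous_on_id)

lemma borel_measurable_powi [measurable (raw)]:
  fixes f :: "'a \<Rightarrow> complex"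
  assumes [measurable]: "f \<in> borel_measurable M"
  shows "(\<lambda>t. f t powi n) \<in> borel_measurable M"
  unfolding power_int_def by measurable

lemma borel_measurable_poly [measurable (raw)]:
  fixes f :: "'a \<Rightarrow> complex"
  assumes [measurable]: "f \<in> borel_measurable M"
  shows "(\<lambda>t. poly q (f t)) \<in> borel_measurable M"
  unfolding poly_altdef by measurable

lemma cis_measurable_circle [measurable]: "cis \<in> measurable borel (restrict_space borel (sphere 0 1))"
  by (rule measurable_restrict_space2)
     (auto intro!: borel_measurable_continuous_onI continuous_intros)

lemma emeasure_space_circle: "emeasure circle (space circle) = 1"
proof -
  have "emeasure circle (space circle) = emeasure (uniform_measure lborel {0..2*pi}) UNIV"
    unfolding circle_def
    by (subst emeasure_distr)
       (auto simp: space_restrict_space sets_restrict_space vimage_def intro!: arg_cong2[where f = emeasure])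
  also have "\<dots> = 1"
    by (subst emeasure_uniform_measure) (auto simp: ennreal_divide_self)
  finally show ?thesis .
qed

interpretation circle: finite_measure circle
  by standard (simp add: emeasure_space_circle)

lemma measure_space_circle [simp]: "measure circle (space circle) = 1"
  by (simp add: measure_def emeasure_space_circle)

lemma integral_circle:
  fixes f :: "complex \<Rightarrow> complex"
  assumes f[measurable]: "f \<in> borel_measurable circle"
  shows "(LINT t|circle. f t) = (LINT x:{0..2*pi}|lborel. f (cis x)) / (2*pi)"
proof -
  have m[measurable]: "(\<lambda>x. f (cis x)) \<in> borel_measurable borel"
    using f unfolding measurable_circle_cong_sets
    by (rule measurable_compose[OF cis_measurable_circle])
  have "(LINT t|circle. f t) = (LINT x|uniform_measure lborel {0..2*pi}. f (cis x))"
    unfolding circle_def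
    by (rule integral_distr) (use f in \<open>auto simp: measurable_circle_cong_sets\<close>)
  also have "uniform_measure lborel {0..2*pi} = density lborel (\<lambda>x. ennreal (indicator {0..2*pi} x / (2*pi)))"
    unfolding uniform_measure_def
    by (rule density_cong) (auto simp: indicator_def divide_ennreal[symmetric])
  also have "(LINT x|\<dots>. f (cis x)) = (LINT x|lborel. (indicator {0..2*pi} x / (2*pi)) *\<^sub>R f (cis x))"
    by (rule integral_density) (auto simp: indicator_def)
  also have "\<dots> = (LINT x|lborel. (indicator {0..2*pi} x *\<^sub>R f (cis x)) / (2*pi))"
    by (rule Bochner_Integration.integral_cong) (auto simp: indicator_def scaleR_conv_of_real)
  also have "\<dots> = (LINT x:{0..2*pi}|lborel. f (cis x)) / (2*pi)"
    by (simp add: set_lebesgue_integral_def)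
  finally show ?thesis .
qed

text \<open>Mean value property: in Cauchy's formula at the centre, the factor 1 / u cancels against
  du = \<i> u dx.\<close>

lemma integral_circle_holomorphic:
  assumes c: "continuous_on (cball 0 1) f" and h: "f holomorphic_on ball 0 1"
  shows "(LINT t|circle. f t) = f 0"
proof -
  have cs: "continuous_on (sphere 0 1) f"
    using c by (rule continuous_on_subset) auto
  have "((\<lambda>u. f u / (u - 0)) has_contour_integral (2 * of_real pi * \<i> * f 0)) (circlepath 0 1)"
    by (rule Cauchy_integral_circlepath) (use c h in auto)
  then have "((\<lambda>x. f (cis x) * \<i>) has_integral (2 * of_real pi * \<i> * f 0)) {0..2*pi}"
    unfolding circlepath_def by (subst (asm) has_contour_integral_part_circlepath_iff) auto
  then have "((\<lambda>x. f (cis x) * \<i> * (-\<i>)) has_integral (2 * of_real pi * \<i> * f 0) * (-\<i>)) {0..2*pi}"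
    by (rule has_integral_mult_left)
  then have hi: "((\<lambda>x. f (cis x)) has_integral (2 * of_real pi * f 0)) {0..2*pi}"
    by (simp add: mult.assoc) (simp add: mult.left_commute[of \<i>])
  have "continuous_on {0..2*pi} (\<lambda>x. f (cis x))"
    by (rule continuous_on_compose2[OF cs]) (auto intro!: continuous_intros)
  then have "set_integrable lborel {0..2*pi} (\<lambda>x. f (cis x))"
    by (rule borel_integrable_atLeastAtMost')
  then have "(LINT x:{0..2*pi}|lborel. f (cis x)) = 2 * of_real pi * f 0"
    using hi by (metis set_borel_integral_eq_integral(2) integral_unique)
  then show ?thesis
    by (simp add: integral_circle borel_measurable_circle_continuous[OF cs])
qed

section \<open>Real trigonometric polynomials as real parts of polynomials\<close>

lemma cnj_eq_inverse: "norm (z::complex) = 1 \<Longrightarrow> cnj z = inverse z"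
  using complex_norm_square[of z] by (intro inverse_unique[symmetric]) simp

text \<open>On the circle z times its conjugate is 1, so one power of z can be stripped from both
  factors at once; therefore \<open>q\<close> varies in the induction on \<open>r\<close>. The
  remaining antianalytic term is replaced by its conjugate, which has the same real part.\<close>

lemma Re_mult_cnj_poly:
  fixes q r :: "complex poly"
  shows "\<exists>s. \<forall>z. norm z = 1 \<longrightarrow> Re (poly q z * cnj (poly r z)) = Re (poly s z)"
proof (induction r arbitrary: q)
  case 0
  show ?case by (rule exI[of _ 0]) simp
next
  case (pCons a r)
  obtain b q' where q: "q = pCons b q'" by (cases q)
  obtain s where s: "\<And>z. norm z = 1 \<Longrightarrow> Re (poly q' z * cnj (poly r z)) = Re (poly s z)"
    using pCons.IH[of q'] by blast
  show ?case
  proof (rule exI[of _ "smult (cnj a) q + s + smult (cnj b) (pCons 0 r)"], intro allI impI)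
    fix z :: complex assume z: "norm z = 1"
    have zz: "z * cnj z = 1" using z complex_norm_square[of z] by simp
    have "poly q z * cnj (poly (pCons a r) z) =
        cnj a * poly q z + b * cnj (z * poly r z) + (z * cnj z) * (poly q' z * cnj (poly r z))"
      by (simp add: q algebra_simps)
    moreover have "Re (b * cnj (z * poly r z)) = Re (cnj b * (z * poly r z))"
      by (simp add: algebra_simps)
    ultimately show "Re (poly q z * cnj (poly (pCons a r) z)) =
        Re (poly (smult (cnj a) q + s + smult (cnj b) (pCons 0 r)) z)"
      using s[OF z] zz by (simp add: algebra_simps)
  qed
qed

text \<open>Twice the product of Re u and Re v is the real part of u v + u cnj v.\<close>

lemma Re_mult_Re_poly:
  fixes q r :: "complex poly"
  shows "\<exists>s. \<forall>z. norm z = 1 \<longrightarrow> Re (poly q z) * Re (poly r z) = Re (poly s z)"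
proof -
  obtain s where s: "\<And>z. norm z = 1 \<Longrightarrow> Re (poly q z * cnj (poly r z)) = Re (poly s z)"
    using Re_mult_cnj_poly by blast
  show ?thesis
  proof (rule exI[of _ "smult (1/2) (q * r + s)"], intro allI impI)
    fix z :: complex assume z: "norm z = 1"
    show "Re (poly q z) * Re (poly r z) = Re (poly (smult (1/2) (q * r + s)) z)"
      using s[OF z] by (simp add: field_simps)
  qed
qed

text \<open>Connects Stone-Weierstrass, which supplies polynomials in Re z and Im z, with analytic
  polynomials. A real linear map f is Re (c z) with c = f 1 - \<i> f \<i>; products are covered by
  \<open>Re_mult_Re_poly\<close>.\<close>

lemma real_polynomial_function_eq_Re_poly:
  fixes g :: "complex \<Rightarrow> real"
  assumes "real_polynomial_function g"
  shows "\<exists>q. \<forall>z. norm z = 1 \<longrightarrow> g z = Re (poly q z)"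
  using assms
proof induction
  case (linear f)
  interpret bounded_linear f by (rule linear)
  have "f z = Re (poly [:0, Complex (f 1) (- f \<i>):] z)" for z
  proof -
    have "f z = f (Re z *\<^sub>R 1 + Im z *\<^sub>R \<i>)"
      by (metis complex_eq mult.commute mult.right_neutral scaleR_conv_of_real)
    also have "\<dots> = Re z * f 1 + Im z * f \<i>" by (simp only: add scaleR) simp
    finally show ?thesis by (simp add: algebra_simps)
  qed
  then show ?case by blast
next
  case (const c)
  show ?case by (rule exI[of _ "[:of_real c:]"]) simp
next
  case (add f g)
  then obtain q r where "\<forall>z. norm z = 1 \<longrightarrow> f z = Re (poly q z)" "\<forall>z. norm z = 1 \<longrightarrow> g z = Re (poly r z)"
    by blast
  then show ?case by (intro exI[of _ "q + r"]) simp
next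
  case (mult f g)
  then obtain q r where "\<forall>z. norm z = 1 \<longrightarrow> f z = Re (poly q z)" "\<forall>z. norm z = 1 \<longrightarrow> g z = Re (poly r z)"
    by blast
  then show ?case using Re_mult_Re_poly[of q r] by auto
qed

text \<open>An imaginary constant has real part 0, so a polynomial can be estimated by its real part
  only after its value at 0 has been made real.\<close>

lemma poly_normalize_Im:
  fixes q :: "complex poly"
  obtains r where "Im (poly r 0) = 0" "\<And>z. Re (poly r z) = Re (poly q z)"
  by (rule that[of "q - [:\<i> * of_real (Im (poly q 0)):]"]) auto

lemma Re_poly_dense:
  fixes g :: "complex \<Rightarrow> real"
  assumes "continuous_on (sphere 0 1) g" "0 < e"
  obtains q where "Im (poly q 0) = 0" "\<And>z. norm z = 1 \<Longrightarrow> \<bar>g z - Re (poly q z)\<bar> < e"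
proof -
  obtain h where h: "real_polynomial_function h" "\<And>z. z \<in> sphere 0 1 \<Longrightarrow> \<bar>g z - h z\<bar> < e"
    using Stone_Weierstrass_real_polynomial_function[OF _ assms] by (metis compact_sphere)
  obtain q where "\<forall>z. norm z = 1 \<longrightarrow> h z = Re (poly q z)"
    using real_polynomial_function_eq_Re_poly[OF h(1)] by blast
  moreover obtain r where "Im (poly r 0) = 0" "\<And>z. Re (poly r z) = Re (poly q z)"
    using poly_normalize_Im[of q] by metis
  ultimately show ?thesis using h(2) by (intro that[of r]) auto
qed

section \<open>The spaces \<open>Lp\<close>\<close>

text \<open>The p-th power of the \<open>Lp\<close> norm, with values in \<open>ennreal\<close>:
  membership in \<open>Lp\<close> is finiteness, convergence is \<open>pmass\<close> tending to 0,
  and the triangle inequality is replaced by the cruder \<open>pmass_add\<close>. The range type is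
  general because real-valued functions are measured as well.\<close>

definition pmass :: "real \<Rightarrow> (complex \<Rightarrow> 'a::real_normed_vector) \<Rightarrow> ennreal" where
  "pmass p f = (\<integral>\<^sup>+t. ennreal (norm (f t) powr p) \<partial>circle)"

lemma pmass_cong:
  assumes "\<And>t. norm t = 1 \<Longrightarrow> f t = g t"
  shows "pmass p f = pmass p g"
  unfolding pmass_def by (rule nn_integral_cong) (simp add: assms in_space_circle_iff)

lemma pmass_cong_AE:
  assumes "AE t in circle. f t = g t"
  shows "pmass p f = pmass p g"
  unfolding pmass_def by (rule nn_integral_cong_AE) (use assms in auto)

lemma pmass_mono:
  assumes "0 \<le> p" "AE t in circle. norm (f t) \<le> norm (g t)"
  shows "pmass p f \<le> pmass p g"
  unfolding pmass_def
  by (rule nn_integral_mono_AE) (use assms in \<open>auto intro!: ennreal_leI powr_mono2\<close>)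

lemma pmass_const: "pmass p (\<lambda>_. c) = ennreal (norm c powr p)"
  by (simp add: pmass_def emeasure_space_circle)

lemma pmass_bounded:
  assumes "0 \<le> p" "AE t in circle. norm (f t) \<le> C" "0 \<le> C"
  shows "pmass p f \<le> ennreal (C powr p)"
  using pmass_mono[of p f "\<lambda>_. C"] assms by (simp add: pmass_const)

lemma pmass_minus_commute: "pmass p (\<lambda>t. f t - g t) = pmass p (\<lambda>t. g t - f t)"
  by (simp add: pmass_def norm_minus_commute)

lemma powr_add_le:
  fixes x y p :: real
  assumes "0 \<le> x" "0 \<le> y" "0 \<le> p"
  shows "(x + y) powr p \<le> 2 powr p * (x powr p + y powr p)"
proof -
  have "(x + y) powr p \<le> (2 * max x y) powr p"
    using assms by (intro powr_mono2) auto
  also have "\<dots> = 2 powr p * max x y powr p"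
    using assms by (simp add: powr_mult)
  also have "\<dots> \<le> 2 powr p * (x powr p + y powr p)"
    by (intro mult_left_mono) (auto simp: max_def)
  finally show ?thesis .
qed

lemma pmass_add:
  fixes f g :: "complex \<Rightarrow> 'a::{real_normed_vector, second_countable_topology}"
  assumes [measurable]: "f \<in> borel_measurable circle" "g \<in> borel_measurable circle" and p: "0 \<le> p"
  shows "pmass p (\<lambda>t. f t + g t) \<le> ennreal (2 powr p) * (pmass p f + pmass p g)"
proof -
  have "norm (f t + g t) powr p \<le> 2 powr p * (norm (f t) powr p + norm (g t) powr p)" for t
    using powr_add_le[of "norm (f t)" "norm (g t)" p] p norm_triangle_ineq[of "f t" "g t"]
    by (smt (verit) norm_ge_zero powr_mono2)
  then have "pmass p (\<lambda>t. f t + g t) \<le>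
      (\<integral>\<^sup>+t. ennreal (2 powr p) * (ennreal (norm (f t) powr p) + ennreal (norm (g t) powr p)) \<partial>circle)"
    unfolding pmass_def
    by (intro nn_integral_mono) (simp flip: ennreal_plus ennreal_mult'')
  also have "\<dots> = ennreal (2 powr p) * (pmass p f + pmass p g)"
    unfolding pmass_def by (subst nn_integral_cmult) (simp_all add: nn_integral_add)
  finally show ?thesis .
qed

lemma pmass_diff_triangle:
  fixes f g h :: "complex \<Rightarrow> 'a::{real_normed_vector, second_countable_topology}"
  assumes [measurable]: "f \<in> borel_measurable circle" "g \<in> borel_measurable circle"
    "h \<in> borel_measurable circle" and p: "0 \<le> p"
  shows "pmass p (\<lambda>t. f t - h t) \<le>
    ennreal (2 powr p) * (pmass p (\<lambda>t. f t - g t) + pmass p (\<lambda>t. g t - h t))"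
  using pmass_add[of "\<lambda>t. f t - g t" "\<lambda>t. g t - h t" p] p by simp

lemma pmass_cmult:
  fixes f :: "complex \<Rightarrow> 'a::real_normed_field"
  assumes "(\<lambda>t. norm (f t)) \<in> borel_measurable circle"
  shows "pmass p (\<lambda>t. c * f t) = ennreal (norm c powr p) * pmass p f"
  unfolding pmass_def using assms
  by (subst nn_integral_cmult[symmetric]) (auto simp: norm_mult powr_mult ennreal_mult')

lemma Lp_iff_pmass: "f \<in> Lp p \<longleftrightarrow> f \<in> borel_measurable circle \<and> pmass p f < \<infinity>"
proof (cases "f \<in> borel_measurable circle")
  case True
  then show ?thesis
    by (auto simp: Lp_def pmass_def integrable_iff_bounded)
qed (simp add: Lp_def)

lemma pmass_eq_integral:
  assumes "f \<in> Lp p"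
  shows "pmass p f = ennreal (LINT t|circle. norm (f t) powr p)"
  unfolding pmass_def by (rule nn_integral_eq_integral) (use assms in \<open>auto simp: Lp_def\<close>)

lemma Lp_measurable [measurable_dest]: "f \<in> Lp p \<Longrightarrow> f \<in> borel_measurable circle"
  by (simp add: Lp_def)

lemma Lp_dominated:
  assumes "g \<in> Lp p" "0 \<le> p" and [measurable]: "f \<in> borel_measurable circle"
    and le: "AE t in circle. norm (f t) \<le> C * norm (g t)"
  shows "f \<in> Lp p"
proof -
  have "AE t in circle. norm (f t) \<le> norm (of_real C * g t)"
    using le by eventually_elim (smt (verit) mult_right_mono norm_ge_zero norm_mult norm_of_real)
  then have "pmass p f \<le> pmass p (\<lambda>t. of_real C * g t)"
    by (rule pmass_mono[OF assms(2)])
  also have "\<dots> = ennreal (norm C powr p) * pmass p g"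
    using Lp_measurable[OF assms(1)] by (subst pmass_cmult) auto
  also have "\<dots> < \<infinity>"
    using assms(1) by (simp add: Lp_iff_pmass ennreal_mult_less_top)
  finally show ?thesis by (simp add: Lp_iff_pmass)
qed

lemma Lp_add:
  assumes "f \<in> Lp p" "g \<in> Lp p" "0 \<le> p"
  shows "(\<lambda>t. f t + g t) \<in> Lp p"
  using assms pmass_add[of f g p]
  by (auto simp: Lp_iff_pmass ennreal_mult_less_top elim!: order.strict_trans1)

lemma Lp_cmult: "f \<in> Lp p \<Longrightarrow> 0 \<le> p \<Longrightarrow> (\<lambda>t. c * f t) \<in> Lp p"
  using Lp_measurable[of f p] by (rule_tac Lp_dominated[of f p _ "norm c"]) (auto simp: norm_mult)

lemma Lp_diff:
  assumes "f \<in> Lp p" "g \<in> Lp p" "0 \<le> p"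
  shows "(\<lambda>t. f t - g t) \<in> Lp p"
  using Lp_add[OF assms(1) Lp_cmult[OF assms(2,3), of "-1"]] assms(3) by simp

lemma Lp_bounded:
  assumes [measurable]: "f \<in> borel_measurable circle" and "AE t in circle. norm (f t) \<le> C" "0 \<le> p"
  shows "f \<in> Lp p"
proof -
  have "AE t in circle. norm (f t) \<le> max C 0" using assms(2) by eventually_elim auto
  then have "pmass p f \<le> ennreal (max C 0 powr p)"
    by (intro pmass_bounded) (use assms in auto)
  also have "\<dots> < \<infinity>" by simp
  finally show ?thesis by (simp add: Lp_iff_pmass)
qed

lemma Lp_continuous:
  assumes "continuous_on (sphere 0 1) f" "0 \<le> p"
  shows "f \<in> Lp p"
proof -
  obtain C where "\<forall>t\<in>sphere 0 1. norm (f t) \<le> C"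
    using continuous_on_sphere_bounded[OF assms(1)] by blast
  then show ?thesis
    using borel_measurable_circle_continuous[OF assms(1)] assms(2)
    by (intro Lp_bounded[of _ C]) (auto simp: in_space_circle_iff)
qed

lemma Lp_poly: "0 \<le> p \<Longrightarrow> (\<lambda>t. poly q t) \<in> Lp p"
  by (rule Lp_continuous) (auto intro!: continuous_intros)

lemma Lp_imp_integrable:
  assumes "f \<in> Lp p" "1 \<le> p"
  shows "integrable circle f"
proof -
  have "norm (f t) \<le> 1 + norm (f t) powr p" for t
  proof (cases "norm (f t) \<le> 1")
    case True
    then show ?thesis by (rule order_trans) simp
  next
    case False
    then have "norm (f t) powr 1 \<le> norm (f t) powr p"
      using assms by (intro powr_mono) auto
    then show ?thesis by auto
  qed
  then have le: "norm (f t) \<le> norm (1 + norm (f t) powr p)" for t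
    unfolding real_norm_def by (rule order_trans[OF _ abs_ge_self])
  have i: "integrable circle (\<lambda>t. norm (f t) powr p)" and m: "f \<in> borel_measurable circle"
    using assms(1) unfolding Lp_def by blast+
  have "integrable circle (\<lambda>t. 1 + norm (f t) powr p)"
    by (intro Bochner_Integration.integrable_add i) simp
  then show ?thesis
    by (rule Bochner_Integration.integrable_bound[OF _ m AE_I2[OF le]])
qed

lemma Linf_mult_Lp:
  assumes "f \<in> Lp p" "b \<in> Linf" "0 \<le> p"
  shows "(\<lambda>t. b t * f t) \<in> Lp p"
proof -
  obtain C where "AE t in circle. norm (b t) \<le> C" using assms by (auto simp: Linf_def)
  then have "AE t in circle. norm (b t * f t) \<le> C * norm (f t)"
    by eventually_elim (simp add: norm_mult mult_right_mono)
  then show ?thesis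
    using assms Lp_measurable[OF assms(1)]
    by (intro Lp_dominated[OF assms(1)]) (auto simp: Linf_def)
qed

lemma Linf_continuous:
  assumes "continuous_on (sphere 0 1) f"
  shows "f \<in> Linf"
proof -
  obtain C where "\<forall>t\<in>sphere 0 1. norm (f t) \<le> C"
    using continuous_on_sphere_bounded[OF assms] by blast
  then show ?thesis
    using borel_measurable_circle_continuous[OF assms(1)]
    by (auto simp: Linf_def in_space_circle_iff intro!: exI[of _ C])
qed

lemma Linf_mult:
  assumes "f \<in> Linf" "g \<in> Linf"
  shows "(\<lambda>t. f t * g t) \<in> Linf"
proof -
  obtain C D where "AE t in circle. norm (f t) \<le> C" "AE t in circle. norm (g t) \<le> D"
    using assms by (auto simp: Linf_def)
  then have "AE t in circle. norm (f t * g t) \<le> max C 0 * max D 0"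
    by eventually_elim (auto simp: norm_mult intro!: mult_mono)
  then show ?thesis using assms by (auto simp: Linf_def)
qed

text \<open>A substitute for Hoelder's inequality. Pointwise x \<le> e + e powr (1 - p) * x powr p:
  this is clear for x \<le> e, and for x > e it holds because x powr (1 - p) \<le> e powr (1 - p).
  The free parameter e is chosen at each use.\<close>

lemma integral_norm_le_pmass:
  assumes f: "f \<in> Lp p" and p: "1 \<le> p" and e: "0 < e"
  shows "norm (LINT t|circle. f t) \<le> e + e powr (1 - p) * enn2real (pmass p f)"
proof -
  have "norm (f t) \<le> e + e powr (1 - p) * norm (f t) powr p" for t
  proof (cases "norm (f t) \<le> e")
    case False
    then have "norm (f t) powr (1 - p) \<le> e powr (1 - p)"
      using e p by (intro powr_mono2') auto
    then have "norm (f t) powr (1 - p) * norm (f t) powr p \<le> e powr (1 - p) * norm (f t) powr p"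
      by (rule mult_right_mono) auto
    moreover have "norm (f t) powr (1 - p) * norm (f t) powr p = norm (f t)"
      using False e by (simp flip: powr_add)
    ultimately show ?thesis using e by linarith
  qed (simp add: add_increasing2)
  moreover have i: "integrable circle (\<lambda>t. norm (f t) powr p)" using f by (simp add: Lp_def)
  ultimately have "(LINT t|circle. norm (f t)) \<le> (LINT t|circle. e + e powr (1 - p) * norm (f t) powr p)"
    using Lp_imp_integrable[OF f p] by (intro integral_mono) auto
  also have "\<dots> = e + e powr (1 - p) * enn2real (pmass p f)"
    using i by (simp add: pmass_eq_integral[OF f])
  finally show ?thesis
    using integral_norm_bound[of circle f] by linarith
qed

text \<open>The bounded factor \<open>h\<close> is there for the powers \<open>t powi n\<close>:
  with them, convergence in \<open>Lp\<close> yields convergence of every Fourier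
  coefficient.\<close>

lemma integral_tendsto_pmass:
  assumes f: "\<And>n. f n \<in> Lp p" "g \<in> Lp p" and p: "1 \<le> p"
    and lim: "(\<lambda>n. pmass p (\<lambda>t. f n t - g t)) \<longlonglongrightarrow> 0" and h: "h \<in> Linf"
  shows "(\<lambda>n. LINT t|circle. h t * f n t) \<longlonglongrightarrow> (LINT t|circle. h t * g t)"
proof -
  have p0: "0 \<le> p" using p by simp
  obtain C where C: "AE t in circle. norm (h t) \<le> C" using h by (auto simp: Linf_def)
  define D where "D = max C 0"
  have D: "AE t in circle. norm (h t) \<le> D" "0 \<le> D" using C by (auto simp: D_def)
  define d where "d n t = h t * (f n t - g t)" for n t
  have dLp: "d n \<in> Lp p" for n
    unfolding d_def by (intro Linf_mult_Lp h p0 Lp_diff f)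
  have "pmass p (d n) \<le> pmass p (\<lambda>t. of_real D * (f n t - g t))" for n
    by (rule pmass_mono[OF p0])
       (use D in \<open>auto simp: d_def norm_mult intro!: mult_right_mono elim!: eventually_mono\<close>)
  moreover have "pmass p (\<lambda>t. of_real D * (f n t - g t)) = ennreal (D powr p) * pmass p (\<lambda>t. f n t - g t)" for n
    using D(2) by (subst pmass_cmult) (use f in \<open>auto dest!: Lp_measurable\<close>)
  moreover have "(\<lambda>n. ennreal (D powr p) * pmass p (\<lambda>t. f n t - g t)) \<longlonglongrightarrow> ennreal (D powr p) * 0"
    by (intro ennreal_tendsto_cmult lim) simp
  ultimately have "(\<lambda>n. pmass p (d n)) \<longlonglongrightarrow> 0"
    by (intro tendsto_sandwich[where f = "\<lambda>_. 0" and g = "\<lambda>n. pmass p (d n)"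
          and h = "\<lambda>n. ennreal (D powr p) * pmass p (\<lambda>t. f n t - g t)"]) auto
  then have l2: "(\<lambda>n. enn2real (pmass p (d n))) \<longlonglongrightarrow> 0"
    using tendsto_enn2real[where l = 0] by simp
  have "(\<lambda>n. LINT t|circle. d n t) \<longlonglongrightarrow> 0"
  proof (rule tendstoI, simp add: dist_norm)
    fix e :: real assume e: "0 < e"
    \<comment> \<open>The threshold makes the second term of \<open>integral_norm_le_pmass\<close>,
      taken at e/2, smaller than e/2.\<close>
    have "\<forall>\<^sub>F n in sequentially. enn2real (pmass p (d n)) < (e/2) / ((e/2) powr (1 - p))"
      using l2 e by (intro order_tendstoD) auto
    then show "\<forall>\<^sub>F n in sequentially. norm (LINT t|circle. d n t) < e"
    proof eventually_elim
      case (elim n)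
      then show ?case
        using integral_norm_le_pmass[OF dLp p, of "e/2" n] e by (auto simp: field_simps)
    qed
  qed
  moreover have "(LINT t|circle. d n t) = (LINT t|circle. h t * f n t) - (LINT t|circle. h t * g t)" for n
    using Lp_imp_integrable[OF Linf_mult_Lp[OF f(1)[of n] h p0] p]
      Lp_imp_integrable[OF Linf_mult_Lp[OF f(2) h p0] p]
    by (simp add: d_def right_diff_distrib)
  ultimately show ?thesis by (simp add: LIM_zero_iff)
qed

text \<open>The weights \<open>2\<^sup>k\<close> make the almost everywhere convergence of a fast subsequence a matter of monotone
  convergence, so that Minkowski's inequality is not needed.\<close>

lemma Lp_complete:
  fixes f :: "nat \<Rightarrow> complex \<Rightarrow> complex"
  assumes f: "\<And>n. f n \<in> Lp p" and p: "0 < p"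
    and cauchy: "\<And>e. 0 < e \<Longrightarrow> \<exists>N. \<forall>m\<ge>N. \<forall>n\<ge>N. pmass p (\<lambda>t. f m t - f n t) \<le> ennreal e"
  obtains g where "g \<in> Lp p" "(\<lambda>n. pmass p (\<lambda>t. f n t - g t)) \<longlonglongrightarrow> 0"
proof -
  note [measurable] = Lp_measurable[OF f]
  \<comment> \<open>The rate is 4 to the power - p k: the weights consume 2 to the power p k, and a
    summable geometric series of ratio \<open>1 / 2 powr p\<close> remains.\<close>
  have "\<exists>N. \<forall>m\<ge>N. \<forall>n\<ge>N. pmass p (\<lambda>t. f m t - f n t) \<le> ennreal ((1/4 powr p) ^ k)" for k :: nat
    by (rule cauchy) simp
  then obtain N where N: "\<And>k m n. N k \<le> m \<Longrightarrow> N k \<le> n \<Longrightarrow>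
      pmass p (\<lambda>t. f m t - f n t) \<le> ennreal ((1/4 powr p) ^ k)"
    by metis
  \<comment> \<open>Summing the thresholds makes \<open>r\<close> monotone and at least
    \<open>N k\<close>; the summand k makes it unbounded.\<close>
  define r where "r k = (\<Sum>i\<le>k. N i) + k" for k
  have rN: "N k \<le> r k" for k
    unfolding r_def by (intro trans_le_add1 member_le_sum) auto
  have rS: "r k \<le> r (Suc k)" "k \<le> r k" for k unfolding r_def by auto
  define d where "d k t = f (r (Suc k)) t - f (r k) t" for k t
  have [measurable]: "d k \<in> borel_measurable circle" for k unfolding d_def by measurable
  have dm: "pmass p (d k) \<le> ennreal ((1/4 powr p) ^ k)" for k
    unfolding d_def by (rule N) (use rN rS[of k] in \<open>auto intro: order_trans\<close>)
  have "(\<integral>\<^sup>+t. (\<Sum>k. ennreal ((2 ^ k * norm (d k t)) powr p)) \<partial>circle) =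
      (\<Sum>k. \<integral>\<^sup>+t. ennreal ((2 ^ k * norm (d k t)) powr p) \<partial>circle)"
    by (rule nn_integral_suminf) measurable
  also have "\<dots> = (\<Sum>k. ennreal ((2 powr p) ^ k) * pmass p (d k))"
  proof (rule suminf_cong)
    fix k
    have "(2 ^ k * norm (d k t)) powr p = (2 powr p) ^ k * norm (d k t) powr p" for t
      by (simp add: powr_mult powr_power flip: powr_realpow) (simp add: powr_powr mult.commute)
    then show "(\<integral>\<^sup>+t. ennreal ((2 ^ k * norm (d k t)) powr p) \<partial>circle) = ennreal ((2 powr p) ^ k) * pmass p (d k)"
      unfolding pmass_def by (subst nn_integral_cmult[symmetric]) (auto simp: ennreal_mult')
  qed
  also have "\<dots> \<le> (\<Sum>k. ennreal ((1 / 2 powr p) ^ k))"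
  proof (intro suminf_le allI)
    fix k
    have "ennreal ((2 powr p) ^ k) * pmass p (d k) \<le> ennreal ((2 powr p) ^ k) * ennreal ((1/4 powr p) ^ k)"
      by (intro mult_left_mono dm) auto
    also have "\<dots> = ennreal ((1 / 2 powr p) ^ k)"
    proof -
      have "(4::real) powr p = 2 powr p * 2 powr p" by (simp flip: powr_mult)
      then have "2 powr p * (1/4 powr p) = 1 / 2 powr p" by simp
      then show ?thesis by (simp flip: ennreal_mult power_mult_distrib)
    qed
    finally show "ennreal ((2 powr p) ^ k) * pmass p (d k) \<le> ennreal ((1 / 2 powr p) ^ k)" .
  qed auto
  also have "\<dots> < \<infinity>"
  proof -
    have "1 < (2::real) powr p" using p by simp
    then have "summable (\<lambda>k. (1 / 2 powr p) ^ k)"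
      by (intro summable_geometric) simp
    then show ?thesis by (subst suminf_ennreal2) auto
  qed
  finally have fin: "(\<integral>\<^sup>+t. (\<Sum>k. ennreal ((2 ^ k * norm (d k t)) powr p)) \<partial>circle) \<noteq> \<infinity>"
    by simp
  have "AE t in circle. (\<Sum>k. ennreal ((2 ^ k * norm (d k t)) powr p)) \<noteq> \<infinity>"
    by (rule nn_integral_PInf_AE[OF _ fin]) measurable
  then have AEconv: "AE t in circle. convergent (\<lambda>k. f (r k) t)"
  proof eventually_elim
    case (elim t)
    have "summable (\<lambda>k. (2 ^ k * norm (d k t)) powr p)"
      using elim by (intro summable_suminf_not_top) auto
    then have "(\<lambda>k. (2 ^ k * norm (d k t)) powr p) \<longlonglongrightarrow> 0"
      by (rule summable_LIMSEQ_zero)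
    then have "\<forall>\<^sub>F k in sequentially. (2 ^ k * norm (d k t)) powr p < 1"
      by (rule order_tendstoD) simp
    then have ev: "\<forall>\<^sub>F k in sequentially. norm (d k t) \<le> (1/2) ^ k"
    proof eventually_elim
      case (elim k)
      have "2 ^ k * norm (d k t) \<le> 1"
        using elim p ge_one_powr_ge_zero[of "2 ^ k * norm (d k t)" p] by fastforce
      then show ?case by (simp add: field_simps power_divide)
    qed
    have "summable (\<lambda>k. d k t)"
      by (rule summable_comparison_test_ev[OF ev]) (simp add: summable_geometric)
    then have "convergent (\<lambda>n. \<Sum>k<n. d k t)" by (simp add: summable_iff_convergent)
    moreover have "(\<Sum>k<n. d k t) = f (r n) t - f (r 0) t" for n
      unfolding d_def by (rule sum_lessThan_telescope)
    ultimately show ?case by (simp add: convergent_diff_const_right_iff)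
  qed
  define g where "g t = lim (\<lambda>k. f (r k) t)" for t
  have [measurable]: "g \<in> borel_measurable circle"
    unfolding g_def by measurable
  have AElim: "AE t in circle. (\<lambda>k. f (r k) t) \<longlonglongrightarrow> g t"
    using AEconv by eventually_elim (simp add: g_def convergent_LIMSEQ_iff)
  \<comment> \<open>Fatou's lemma along the subsequence transfers a Cauchy bound to the limit, and
    thereby gives convergence of the whole sequence.\<close>
  have fatou: "pmass p (\<lambda>t. f n t - g t) \<le> ennreal e"
    if ne: "\<And>m. m \<ge> n \<Longrightarrow> pmass p (\<lambda>t. f n t - f m t) \<le> ennreal e" for n e
  proof -
    have "pmass p (\<lambda>t. f n t - g t) \<le>
        (\<integral>\<^sup>+t. liminf (\<lambda>k. ennreal (norm (f n t - f (r k) t) powr p)) \<partial>circle)"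
      unfolding pmass_def
    proof (rule nn_integral_mono_AE)
      show "AE t in circle. ennreal (norm (f n t - g t) powr p) \<le> liminf (\<lambda>k. ennreal (norm (f n t - f (r k) t) powr p))"
        using AElim
      proof eventually_elim
        case (elim t)
        have "(\<lambda>k. norm (f n t - f (r k) t) powr p) \<longlonglongrightarrow> norm (f n t - g t) powr p"
          by (intro tendsto_powr2 tendsto_norm tendsto_diff tendsto_const elim) (use p in auto)
        then have "(\<lambda>k. ennreal (norm (f n t - f (r k) t) powr p)) \<longlonglongrightarrow> ennreal (norm (f n t - g t) powr p)"
          by (rule tendsto_ennrealI)
        then have "liminf (\<lambda>k. ennreal (norm (f n t - f (r k) t) powr p)) = ennreal (norm (f n t - g t) powr p)"
          by (rule lim_imp_Liminf[OF trivial_limit_sequentially])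
        then show ?case by simp
      qed
    qed
    also have "\<dots> \<le> liminf (\<lambda>k. pmass p (\<lambda>t. f n t - f (r k) t))"
      unfolding pmass_def by (rule nn_integral_liminf) measurable
    also have "\<dots> \<le> limsup (\<lambda>k. pmass p (\<lambda>t. f n t - f (r k) t))"
      by (rule Liminf_le_Limsup) simp
    also have "\<dots> \<le> ennreal e"
    proof (rule Limsup_bounded)
      show "\<forall>\<^sub>F k in sequentially. pmass p (\<lambda>t. f n t - f (r k) t) \<le> ennreal e"
        using eventually_ge_at_top[of n]
        by eventually_elim (use rS(2) in \<open>auto intro!: ne intro: order_trans\<close>)
    qed
    finally show ?thesis .
  qed
  have ex: "\<exists>N. \<forall>n\<ge>N. pmass p (\<lambda>t. f n t - g t) \<le> ennreal e" if e: "0 < e" for e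
  proof -
    obtain N where "\<forall>m\<ge>N. \<forall>n\<ge>N. pmass p (\<lambda>t. f m t - f n t) \<le> ennreal e" using cauchy[OF e] by blast
    then show ?thesis by (intro exI[of _ N] allI impI fatou) auto
  qed
  have lim: "(\<lambda>n. pmass p (\<lambda>t. f n t - g t)) \<longlonglongrightarrow> 0"
  proof (rule order_tendstoI)
    fix a :: ennreal assume "0 < a"
    then obtain b where b: "0 < b" "b < a" using dense by blast
    then have "b < \<infinity>" using less_top order.strict_trans2 by fastforce
    with b have e: "0 < enn2real b" by (simp add: enn2real_positive_iff)
    obtain N where "\<forall>n\<ge>N. pmass p (\<lambda>t. f n t - g t) \<le> ennreal (enn2real b)" using ex[OF e] by blast
    then show "\<forall>\<^sub>F n in sequentially. pmass p (\<lambda>t. f n t - g t) < a"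
      using b \<open>b < \<infinity>\<close> by (auto simp: eventually_sequentially intro!: exI[of _ N] elim: order.strict_trans1)
  qed auto
  obtain n where "pmass p (\<lambda>t. f n t - g t) \<le> ennreal 1" using ex[of 1] by auto
  then have "pmass p (\<lambda>t. f n t - g t) < \<infinity>" by (rule order.strict_trans1) simp
  then have "(\<lambda>t. f n t - g t) \<in> Lp p" by (simp add: Lp_iff_pmass)
  with Lp_diff[OF f[of n] this] p have "g \<in> Lp p" by simp
  then show ?thesis using lim by (rule that)
qed

section \<open>Uniqueness and density\<close>

lemma sets_circle_borel: "B \<in> sets circle \<Longrightarrow> B \<in> sets borel"
  by (auto simp: sets_circle sets_restrict_space)

text \<open>A Dynkin argument on the intersection-stable system of closed sets. The indicator of a
  nonempty closed set C is the pointwise limit of continuous functions that are 1 on C and 0 at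
  distance at least 1/n from C. Both the uniqueness of Fourier coefficients and the density of
  trigonometric polynomials in \<open>Lp\<close> are derived from it.\<close>

lemma borel_indicator_induct:
  fixes P :: "(complex \<Rightarrow> real) \<Rightarrow> bool"
  assumes B: "B \<in> sets borel"
    and cont: "\<And>h. continuous_on (sphere 0 1) h \<Longrightarrow> P h"
    and lin: "\<And>c h k. P h \<Longrightarrow> P k \<Longrightarrow> P (\<lambda>t. h t + c * k t)"
    and lim: "\<And>h k. (\<And>n::nat. P (h n)) \<Longrightarrow> (\<And>n t. \<bar>h n t\<bar> \<le> 1) \<Longrightarrow> (\<And>t. (\<lambda>n. h n t) \<longlonglongrightarrow> k t) \<Longrightarrow> P k"
  shows "P (indicator B)"
proof -
  have const: "P (\<lambda>t. c)" for c by (rule cont) simp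
  have Bs: "B \<in> sigma_sets UNIV (Collect closed)"
    using B by (metis borel_eq_closed sets_measure_of Pow_UNIV top_greatest)
  have "Int_stable (Collect closed :: complex set set)" "Collect closed \<subseteq> Pow (UNIV :: complex set)"
    by (auto simp: Int_stable_def)
  from this Bs show ?thesis
  proof (induction rule: sigma_sets_induct_disjoint)
    case (basic C)
    show ?case
    \<comment> \<open>\<open>infdist\<close> to the empty set is 0 by convention, so the functions
      \<open>h n\<close> below would be constantly 1 there.\<close>
    proof (cases "C = {}")
      case True
      then show ?thesis using const[of 0] by simp
    next
      case False
      define h where "h n t = max 0 (1 - real n * infdist t C)" for n t
      show ?thesis
      proof (rule lim)
        show "P (h n)" for n
          unfolding h_def by (rule cont) (intro continuous_intros)
        show "\<bar>h n t\<bar> \<le> 1" for n t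
          unfolding h_def using infdist_nonneg[of t C] by auto
        show "(\<lambda>n. h n t) \<longlonglongrightarrow> indicator C t" for t
        proof (cases "t \<in> C")
          case True
          then show ?thesis by (simp add: h_def)
        next
          case nt: False
          then have pos: "0 < infdist t C"
            using basic False by (metis infdist_pos_not_in_closed mem_Collect_eq)
          obtain N where N: "1 / infdist t C \<le> real N" using real_arch_simple by blast
          have "\<forall>\<^sub>F n in sequentially. h n t = indicator C t"
            using eventually_ge_at_top[of N]
          proof eventually_elim
            case (elim n)
            then have "1 / infdist t C \<le> real n" using N by linarith
            then have "1 \<le> real n * infdist t C" using pos by (simp add: field_simps)
            then show ?case using nt by (simp add: h_def)
          qed
          then show ?thesis by (rule tendsto_eventually)
        qed
      qed
    qed
  next
    case empty
    then show ?case using const[of 0] by simp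
  next
    case (compl A)
    have "P (\<lambda>t. 1 + (-1) * indicator A t)" by (rule lin[OF const compl(2)])
    moreover have "(\<lambda>t. 1 + (-1) * indicator A t) = (indicator (UNIV - A) :: complex \<Rightarrow> real)"
      by (auto simp: indicator_def)
    ultimately show ?case by simp
  next
    case (union A)
    have fin: "P (indicator (\<Union>i<n. A i))" for n :: nat
    proof (induction n)
      case 0
      then show ?case using const[of 0] by simp
    next
      case (Suc n)
      have "P (\<lambda>t. indicator (\<Union>i<n. A i) t + 1 * indicator (A n) t)"
        by (rule lin[OF Suc union(3)])
      moreover have "A n \<inter> A i = {}" if "i < n" for i
        using disjoint_family_onD[OF union(1), of n i] that by simp
      then have "A n \<inter> (\<Union>i<n. A i) = {}" by blast
      then have "(\<lambda>t. indicator (\<Union>i<n. A i) t + 1 * indicator (A n) t) = (indicator (\<Union>i<Suc n. A i) :: complex \<Rightarrow> real)"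
        by (auto simp: indicator_def lessThan_Suc fun_eq_iff)
      ultimately show ?case by simp
    qed
    show ?case
      by (rule lim[OF fin _ LIMSEQ_indicator_UN]) (simp add: indicator_def)
  qed
qed

text \<open>Two measures and two densities, so that one proof serves two purposes: with M = N =
  \<open>circle\<close> and g = 0 it is uniqueness of Fourier coefficients, with f = g = 1 it
  identifies measures by their moments. Equality passes from monomials to real trigonometric
  polynomials, then to continuous functions, then to indicators.\<close>

lemma moments_determine_set_integrals:
  fixes f g :: "complex \<Rightarrow> complex"
  assumes M: "sets M = sets circle" "integrable M f" and N: "sets N = sets circle" "integrable N g"
    and eq: "\<And>n. (LINT t|M. f t * t powi n) = (LINT t|N. g t * t powi n)"
    and B: "B \<in> sets circle"
  shows "(LINT t:B|M. f t) = (LINT t:B|N. g t)"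
proof -
  have sp: "space M = sphere 0 1" "space N = sphere 0 1"
    using sets_eq_imp_space_eq[OF M(1)] sets_eq_imp_space_eq[OF N(1)] by (simp_all add: space_circle)
  have int: "integrable L (\<lambda>t. k t * complex_of_real (h t))"
    if L: "sets L = sets circle" "integrable L k" and h: "h \<in> borel_measurable circle"
      and b: "\<And>t. norm t = 1 \<Longrightarrow> \<bar>h t\<bar> \<le> C" for L k h C
  proof (rule Bochner_Integration.integrable_bound)
    show "integrable L (\<lambda>t. of_real C * k t)" using L by simp
    have "h \<in> borel_measurable L" using h L(1) by (simp cong: measurable_cong_sets)
    then show "(\<lambda>t. k t * complex_of_real (h t)) \<in> borel_measurable L"
      using L(2) by measurable
    have "norm t = 1" if "t \<in> space L" for t
      using that sets_eq_imp_space_eq[OF L(1)] by (simp add: space_circle)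
    then show "AE t in L. norm (k t * complex_of_real (h t)) \<le> norm (of_real C * k t)"
      using b by (intro AE_I2) (force simp: norm_mult intro: mult_right_mono simp: mult.commute)
  qed
  have lim: "(\<lambda>n. LINT t|L. k t * complex_of_real (h n t)) \<longlonglongrightarrow> (LINT t|L. k t * complex_of_real (h' t))"
    if L: "sets L = sets circle" "integrable L k" and h: "\<And>n::nat. h n \<in> borel_measurable circle"
      and b: "\<And>n t. norm t = 1 \<Longrightarrow> \<bar>h n t\<bar> \<le> C"
      and l: "\<And>t. norm t = 1 \<Longrightarrow> (\<lambda>n. h n t) \<longlonglongrightarrow> h' t" for L k h h' C
  proof (rule integral_dominated_convergence[where w = "\<lambda>t. C * norm (k t)"])
    have sL: "space L = sphere 0 1"
      using sets_eq_imp_space_eq[OF L(1)] by (simp add: space_circle)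
    have [measurable]: "h n \<in> borel_measurable L" for n using h L(1) by (simp cong: measurable_cong_sets)
    have [measurable]: "h' \<in> borel_measurable L"
      by (rule borel_measurable_LIMSEQ_real[of _ h]) (use l sL in auto)
    have [measurable]: "k \<in> borel_measurable L" using L by simp
    show "(\<lambda>t. k t * complex_of_real (h' t)) \<in> borel_measurable L"
      "(\<lambda>t. k t * complex_of_real (h n t)) \<in> borel_measurable L" for n by measurable
    show "integrable L (\<lambda>t. C * norm (k t))" using L by simp
    show "AE t in L. (\<lambda>n. k t * complex_of_real (h n t)) \<longlonglongrightarrow> k t * complex_of_real (h' t)"
      using l sL by (intro AE_I2 tendsto_intros) auto
    show "AE t in L. norm (k t * complex_of_real (h n t)) \<le> C * norm (k t)" for n
      using b sL by (intro AE_I2) (auto simp: norm_mult mult.commute[of C] intro!: mult_left_mono)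
  qed
  \<comment> \<open>The bound on \<open>h\<close> is carried along for the linear step, where
    integrability is needed to split the integrals; the limit step has its own uniform bound
    1.\<close>
  define P where "P h \<longleftrightarrow> h \<in> borel_measurable circle \<and> (\<exists>C. \<forall>t. norm t = 1 \<longrightarrow> \<bar>h t\<bar> \<le> C) \<and>
    (LINT t|M. f t * complex_of_real (h t)) = (LINT t|N. g t * complex_of_real (h t))" for h
  have mono: "integrable L (\<lambda>t. k t * t powi n)" if L: "sets L = sets circle" "integrable L k" for L k n
  proof (rule Bochner_Integration.integrable_bound[OF L(2)])
    have [measurable]: "(\<lambda>t. t) \<in> borel_measurable L" "k \<in> borel_measurable L"
      using L borel_measurable_circle_id by (simp_all cong: measurable_cong_sets)
    show "(\<lambda>t. k t * t powi n) \<in> borel_measurable L" by measurable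
    show "AE t in L. norm (k t * t powi n) \<le> norm (k t)"
      using sets_eq_imp_space_eq[OF L(1)]
      by (intro AE_I2) (simp add: space_circle norm_mult norm_power_int)
  qed
  have Re_poly_expand: "complex_of_real (Re (poly q t)) =
      (\<Sum>i\<le>degree q. coeff q i / 2 * t powi (int i) + cnj (coeff q i) / 2 * t powi (- int i))"
    if "norm t = 1" for q t
  proof -
    have "complex_of_real (Re (poly q t)) = (poly q t + cnj (poly q t)) / 2"
      by (simp add: complex_add_cnj)
    also have "cnj (poly q t) = (\<Sum>i\<le>degree q. cnj (coeff q i) * t powi (- int i))"
      using that by (simp add: poly_altdef cnj_eq_inverse power_int_minus power_inverse)
    finally show ?thesis
      by (simp add: poly_altdef sum.distrib add_divide_distrib sum_divide_distrib)
  qed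
  have expand: "(LINT t|L. k t * complex_of_real (Re (poly q t))) =
     (\<Sum>i\<le>degree q. coeff q i / 2 * (LINT t|L. k t * t powi (int i)) + cnj (coeff q i) / 2 * (LINT t|L. k t * t powi (- int i)))"
    if L: "sets L = sets circle" "integrable L k" for L k q
  proof -
    have "(LINT t|L. k t * complex_of_real (Re (poly q t))) =
       (LINT t|L. (\<Sum>i\<le>degree q. coeff q i / 2 * (k t * t powi (int i)) + cnj (coeff q i) / 2 * (k t * t powi (- int i))))"
      using sets_eq_imp_space_eq[OF L(1)]
      by (intro Bochner_Integration.integral_cong)
         (simp_all add: Re_poly_expand space_circle sum_distrib_left algebra_simps)
    also have "\<dots> = (\<Sum>i\<le>degree q. coeff q i / 2 * (LINT t|L. k t * t powi (int i)) + cnj (coeff q i) / 2 * (LINT t|L. k t * t powi (- int i)))"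
      using mono[OF L] mono[OF L, of "int i" for i] by (subst Bochner_Integration.integral_sum) auto
    finally show ?thesis .
  qed
  have "P (indicator B)"
  proof (rule borel_indicator_induct[OF sets_circle_borel[OF B]])
    fix h :: "complex \<Rightarrow> real" assume h: "continuous_on (sphere 0 1) h"
    obtain C where C: "\<forall>t\<in>sphere 0 1. norm (h t) \<le> C"
      using continuous_on_sphere_bounded[OF h] by blast
    have "\<exists>q. \<forall>t. norm t = 1 \<longrightarrow> \<bar>h t - Re (poly q t)\<bar> < 1 / Suc n" for n :: nat
      using Re_poly_dense[OF h, of "1 / Suc n"] by (metis of_nat_0_less_iff zero_less_Suc zero_less_divide_1_iff)
    then obtain q where q: "\<And>n t. norm t = 1 \<Longrightarrow> \<bar>h t - Re (poly (q n) t)\<bar> < 1 / Suc n" by metis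
    have b: "\<bar>Re (poly (q n) t)\<bar> \<le> C + 1" if "norm t = 1" for n t
    proof -
      have "1 / real (Suc n) \<le> 1" by simp
      moreover have "\<bar>h t\<bar> \<le> C" using C that by auto
      ultimately show ?thesis using q[OF that, of n] by linarith
    qed
    have l: "(\<lambda>n. Re (poly (q n) t)) \<longlonglongrightarrow> h t" if "norm t = 1" for t
    proof (rule LIM_zero_cancel, rule Lim_null_comparison)
      show "\<forall>\<^sub>F n in sequentially. norm (Re (poly (q n) t) - h t) \<le> 1 / Suc n"
        using q[OF that] by (auto simp: abs_minus_commute intro!: always_eventually less_imp_le)
      show "(\<lambda>n. 1 / real (Suc n)) \<longlonglongrightarrow> 0" by (rule LIMSEQ_Suc[OF lim_1_over_n])
    qed
    have m: "(\<lambda>t. Re (poly (q n) t)) \<in> borel_measurable circle" for n by measurable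
    have "(LINT t|M. f t * complex_of_real (h t)) = (LINT t|N. g t * complex_of_real (h t))"
    proof (rule LIMSEQ_unique[OF lim[OF M m b l]])
      have "(LINT t|M. f t * complex_of_real (Re (poly (q n) t))) = (LINT t|N. g t * complex_of_real (Re (poly (q n) t)))" for n
        unfolding expand[OF M] expand[OF N] eq ..
      then show "(\<lambda>n. LINT t|M. f t * complex_of_real (Re (poly (q n) t))) \<longlonglongrightarrow> (LINT t|N. g t * complex_of_real (h t))"
        using lim[OF N m b l] by simp
    qed
    moreover have "\<exists>C. \<forall>t. norm t = 1 \<longrightarrow> \<bar>h t\<bar> \<le> C" using C by (intro exI[of _ C]) simp
    ultimately show "P h" using borel_measurable_circle_continuous[OF h] by (simp add: P_def)
  next
    fix c h k assume hk: "P h" "P k"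
    then obtain C D where b: "\<And>t. norm t = 1 \<Longrightarrow> \<bar>h t\<bar> \<le> C" "\<And>t. norm t = 1 \<Longrightarrow> \<bar>k t\<bar> \<le> D"
      by (auto simp: P_def)
    have m: "h \<in> borel_measurable circle" "k \<in> borel_measurable circle" using hk by (auto simp: P_def)
    have "\<bar>h t + c * k t\<bar> \<le> C + \<bar>c\<bar> * D" if "norm t = 1" for t
      using b[OF that] abs_triangle_ineq[of "h t" "c * k t"] mult_left_mono[of "\<bar>k t\<bar>" D "\<bar>c\<bar>"]
      by (simp add: abs_mult)
    moreover have "(LINT t|L. j t * complex_of_real (h t + c * k t)) =
        (LINT t|L. j t * complex_of_real (h t)) + c * (LINT t|L. j t * complex_of_real (k t))"
      if L: "sets L = sets circle" "integrable L j" for L j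
    proof -
      have "(LINT t|L. j t * complex_of_real (h t + c * k t)) =
         (LINT t|L. j t * complex_of_real (h t) + c * (j t * complex_of_real (k t)))"
        by (intro Bochner_Integration.integral_cong) (auto simp: algebra_simps)
      then show ?thesis using int[OF L m(1) b(1)] int[OF L m(2) b(2)] by simp
    qed
    ultimately show "P (\<lambda>t. h t + c * k t)"
      using hk M N by (auto simp: P_def)
  next
    fix h k assume h: "\<And>n::nat. P (h n)" and b: "\<And>n t. \<bar>h n t\<bar> \<le> 1" and l: "\<And>t. (\<lambda>n. h n t) \<longlonglongrightarrow> k t"
    have m: "h n \<in> borel_measurable circle" for n using h by (simp add: P_def)
    have "k \<in> borel_measurable circle"
      by (rule borel_measurable_LIMSEQ_real[OF l m])
    moreover have "\<bar>k t\<bar> \<le> 1" for t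
      by (rule LIMSEQ_le_const2[OF tendsto_rabs[OF l]]) (use b in auto)
    moreover have "(LINT t|M. f t * complex_of_real (k t)) = (LINT t|N. g t * complex_of_real (k t))"
      using lim[OF M m b l] lim[OF N m b l] h by (simp add: P_def LIMSEQ_unique)
    ultimately show "P k" by (auto simp: P_def)
  qed
  then show ?thesis
    by (simp add: P_def set_lebesgue_integral_def scaleR_conv_of_real mult.commute)
qed

lemma fourier_coeff_eq_0_imp_AE:
  assumes f: "integrable circle f" and c: "\<And>n. fourier_coeff f n = 0"
  shows "AE t in circle. f t = 0"
proof (rule circle.density_zero[OF f])
  fix B assume B: "B \<in> sets circle"
  have "(LINT t:B|circle. f t) = (LINT t:B|circle. 0)"
  proof (rule moments_determine_set_integrals[OF refl f refl _ _ B])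
    show "(LINT t|circle. f t * t powi n) = (LINT t|circle. 0 * t powi n)" for n
      using c[of "- n"] by (simp add: fourier_coeff_def)
  qed simp
  then show "(LINT t:B|circle. f t) = 0" by (simp add: set_lebesgue_integral_def)
qed

lemma measure_eq_of_moments:
  assumes M: "sets M = sets circle" "finite_measure M" and N: "sets N = sets circle" "finite_measure N"
    and eq: "\<And>n. (LINT t|M. t powi n) = (LINT t|N. t powi n)"
  shows "M = N"
proof (rule measure_eqI)
  show "sets M = sets N" using M N by simp
  fix B assume B: "B \<in> sets M"
  interpret M: finite_measure M by (rule M)
  interpret N: finite_measure N by (rule N)
  have BN: "B \<in> sets N" using B M N by simp
  have "(LINT t:B|M. (1::complex)) = (LINT t:B|N. 1)"
    by (rule moments_determine_set_integrals) (use M N B eq in auto)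
  then have "complex_of_real (measure M B) = complex_of_real (measure N B)"
    using B BN by (simp add: set_lebesgue_integral_def scaleR_conv_of_real)
  then show "emeasure M B = emeasure N B"
    by (simp add: M.emeasure_eq_measure N.emeasure_eq_measure)
qed

section \<open>Density of real trigonometric polynomials in the real \<open>Lp\<close> space\<close>

lemma poly_measurable_circle [measurable, simp]: "poly q \<in> borel_measurable circle"
  by (rule borel_measurable_poly) measurable

text \<open>The normalization at 0 is built in because the approximating polynomials are later
  subjected to the inequality of M. Riesz.\<close>

definition Re_approx :: "real \<Rightarrow> (complex \<Rightarrow> real) \<Rightarrow> bool" where
  "Re_approx p u \<longleftrightarrow> u \<in> borel_measurable circle \<and>
    (\<forall>e>0. \<exists>q. Im (poly q 0) = 0 \<and> pmass p (\<lambda>t. u t - Re (poly q t)) < ennreal e)"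

lemma Re_approx_continuous:
  assumes h: "continuous_on (sphere 0 1) h" and p: "0 < p"
  shows "Re_approx p h"
  unfolding Re_approx_def
proof (intro conjI allI impI)
  show "h \<in> borel_measurable circle" by (rule borel_measurable_circle_continuous[OF h])
  fix e :: real assume e: "0 < e"
  \<comment> \<open>A uniform error d has mass at most \<open>d powr p\<close>, which is
    e/2.\<close>
  define d where "d = (e/2) powr (1/p)"
  have d: "0 < d" using e by (simp add: d_def)
  obtain q where q: "Im (poly q 0) = 0" "\<And>z. norm z = 1 \<Longrightarrow> \<bar>h z - Re (poly q z)\<bar> < d"
    using Re_poly_dense[OF h d] by blast
  have "pmass p (\<lambda>t. h t - Re (poly q t)) \<le> ennreal (d powr p)"
    using q(2) d p by (intro pmass_bounded AE_I2) (auto simp: in_space_circle_iff intro: less_imp_le)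
  also have "d powr p = e/2" using e p by (simp add: d_def powr_powr)
  also have "ennreal (e/2) < ennreal e" using e by (simp add: ennreal_less_iff)
  finally show "\<exists>q. Im (poly q 0) = 0 \<and> pmass p (\<lambda>t. h t - Re (poly q t)) < ennreal e"
    using q(1) by blast
qed

lemma Re_approx_limit:
  assumes p: "0 < p" and h: "\<And>n::nat. Re_approx p (h n)" and k [measurable]: "k \<in> borel_measurable circle"
    and lim: "(\<lambda>n. pmass p (\<lambda>t. k t - h n t)) \<longlonglongrightarrow> 0"
  shows "Re_approx p k"
  unfolding Re_approx_def
proof (intro conjI allI impI k)
  fix e :: real assume e: "0 < e"
  \<comment> \<open>Two errors of mass d, enlarged by the factor \<open>2 powr p\<close> of
    \<open>pmass_diff_triangle\<close>, add up to e.\<close>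
  define d where "d = e / 2 / 2 powr p"
  have d: "0 < d" using e by (simp add: d_def)
  have [measurable]: "h n \<in> borel_measurable circle" for n using h by (simp add: Re_approx_def)
  obtain n where n: "pmass p (\<lambda>t. k t - h n t) < ennreal d"
    using order_tendstoD(2)[OF lim, of "ennreal d"] d eventually_happens'[OF sequentially_bot] by fastforce
  obtain q where q: "Im (poly q 0) = 0" "pmass p (\<lambda>t. h n t - Re (poly q t)) < ennreal d"
    using h[of n] d unfolding Re_approx_def by blast
  have "pmass p (\<lambda>t. k t - Re (poly q t)) \<le> ennreal (2 powr p) *
      (pmass p (\<lambda>t. k t - h n t) + pmass p (\<lambda>t. h n t - Re (poly q t)))"
    using p by (intro pmass_diff_triangle) auto
  also have "\<dots> < ennreal (2 powr p) * (ennreal d + ennreal d)"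
    by (intro ennreal_mult_strict_left_mono add_strict_mono n q) auto
  also have "\<dots> = ennreal e"
    using d by (simp add: d_def flip: ennreal_mult ennreal_plus)
  finally show "\<exists>q. Im (poly q 0) = 0 \<and> pmass p (\<lambda>t. k t - Re (poly q t)) < ennreal e"
    using q(1) by blast
qed

lemma Re_approx_lincomb:
  assumes p: "0 < p" and h: "Re_approx p h" and k: "Re_approx p k"
  shows "Re_approx p (\<lambda>t. h t + c * k t)"
  unfolding Re_approx_def
proof (intro conjI allI impI)
  have [measurable]: "h \<in> borel_measurable circle" "k \<in> borel_measurable circle"
    using h k by (auto simp: Re_approx_def)
  show "(\<lambda>t. h t + c * k t) \<in> borel_measurable circle" by measurable
  fix e :: real assume e: "0 < e"
  define d where "d = e / 2 / 2 powr p"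
  \<comment> \<open>Scaling by c multiplies the mass by \<open>\<bar>c\<bar> powr p\<close>; the
    added 1 keeps the denominator positive when c = 0.\<close>
  define d' where "d' = d / (\<bar>c\<bar> powr p + 1)"
  have pos: "0 < \<bar>c\<bar> powr p + 1" by (simp add: add_nonneg_pos)
  have d: "0 < d" "0 < d'" using e pos by (simp_all add: d_def d'_def)
  obtain q where q: "Im (poly q 0) = 0" "pmass p (\<lambda>t. h t - Re (poly q t)) < ennreal d"
    using h d(1) unfolding Re_approx_def by blast
  obtain r where r: "Im (poly r 0) = 0" "pmass p (\<lambda>t. k t - Re (poly r t)) < ennreal d'"
    using k d(2) unfolding Re_approx_def by blast
  define s where "s = q + smult (of_real c) r"
  have "pmass p (\<lambda>t. (h t + c * k t) - Re (poly s t)) =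
      pmass p (\<lambda>t. (h t - Re (poly q t)) + c * (k t - Re (poly r t)))"
    by (simp add: s_def algebra_simps)
  also have "\<dots> \<le> ennreal (2 powr p) *
      (pmass p (\<lambda>t. h t - Re (poly q t)) + pmass p (\<lambda>t. c * (k t - Re (poly r t))))"
    using p by (intro pmass_add) auto
  also have "pmass p (\<lambda>t. c * (k t - Re (poly r t))) = ennreal (\<bar>c\<bar> powr p) * pmass p (\<lambda>t. k t - Re (poly r t))"
    by (subst pmass_cmult) auto
  also have "\<dots> \<le> ennreal (\<bar>c\<bar> powr p) * ennreal d'"
    using r(2) by (intro mult_left_mono) auto
  also have "\<dots> \<le> ennreal d"
  proof -
    have "\<bar>c\<bar> powr p * d' \<le> (\<bar>c\<bar> powr p + 1) * d'" using d by (intro mult_right_mono) auto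
    also have "\<dots> = d" using pos by (simp add: d'_def)
    finally show ?thesis using d by (simp flip: ennreal_mult)
  qed
  also have "ennreal (2 powr p) * (pmass p (\<lambda>t. h t - Re (poly q t)) + ennreal d) <
      ennreal (2 powr p) * (ennreal d + ennreal d)"
  proof (intro ennreal_mult_strict_left_mono)
    show "pmass p (\<lambda>t. h t - Re (poly q t)) + ennreal d < ennreal d + ennreal d"
      using q(2) ennreal_add_left_cancel_less[of "ennreal d" "pmass p (\<lambda>t. h t - Re (poly q t))" "ennreal d"]
      by (simp add: add.commute)
  qed auto
  also have "\<dots> = ennreal e"
    using d by (simp add: d_def flip: ennreal_mult ennreal_plus)
  finally have "pmass p (\<lambda>t. (h t + c * k t) - Re (poly s t)) < ennreal e"
    by (simp add: add_left_mono mult_left_mono)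
  moreover have "Im (poly s 0) = 0" using q r by (simp add: s_def)
  ultimately show "\<exists>q. Im (poly q 0) = 0 \<and> pmass p (\<lambda>t. h t + c * k t - Re (poly q t)) < ennreal e"
    by blast
qed

lemma pmass_tendsto_0_dominated:
  fixes h :: "nat \<Rightarrow> complex \<Rightarrow> real"
  assumes p: "0 < p" and [measurable]: "\<And>n. h n \<in> borel_measurable circle" "k \<in> borel_measurable circle" "w \<in> borel_measurable circle"
    and w: "pmass p w < \<infinity>" and b: "\<And>n t. norm t = 1 \<Longrightarrow> \<bar>k t - h n t\<bar> \<le> \<bar>w t\<bar>"
    and lim: "\<And>t. norm t = 1 \<Longrightarrow> (\<lambda>n. h n t) \<longlonglongrightarrow> k t"
  shows "(\<lambda>n. pmass p (\<lambda>t. k t - h n t)) \<longlonglongrightarrow> 0"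
proof -
  have "(\<lambda>n. \<integral>\<^sup>+t. ennreal (norm (k t - h n t) powr p) \<partial>circle) \<longlonglongrightarrow> (\<integral>\<^sup>+t. 0 \<partial>circle)"
  proof (rule nn_integral_dominated_convergence)
    show "AE t in circle. ennreal (norm (k t - h n t) powr p) \<le> ennreal (norm (w t) powr p)" for n
      using b p by (intro AE_I2 ennreal_leI powr_mono2) (auto simp: in_space_circle_iff)
    show "(\<integral>\<^sup>+t. ennreal (norm (w t) powr p) \<partial>circle) < \<infinity>" using w by (simp add: pmass_def)
    show "AE t in circle. (\<lambda>n. ennreal (norm (k t - h n t) powr p)) \<longlonglongrightarrow> 0"
    proof (rule AE_I2)
      fix t assume "t \<in> space circle"
      then have "(\<lambda>n. h n t) \<longlonglongrightarrow> k t" by (simp add: lim in_space_circle_iff)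
      then have "(\<lambda>n. norm (k t - h n t)) \<longlonglongrightarrow> norm (k t - k t)" by (intro tendsto_intros)
      then have "(\<lambda>n. norm (k t - h n t) powr p) \<longlonglongrightarrow> 0 powr p"
        using p by (intro tendsto_powr2) auto
      then show "(\<lambda>n. ennreal (norm (k t - h n t) powr p)) \<longlonglongrightarrow> 0"
        using tendsto_ennrealI by fastforce
    qed
  qed auto
  then show ?thesis by (simp add: pmass_def)
qed

lemma Re_approx_indicator:
  assumes p: "0 < p" and B: "B \<in> sets circle"
  shows "Re_approx p (indicator B)"
proof (rule borel_indicator_induct[OF sets_circle_borel[OF B]])
  fix h k assume h: "\<And>n::nat. Re_approx p (h n)" and b: "\<And>n t. \<bar>h n t\<bar> \<le> 1" and l: "\<And>t. (\<lambda>n. h n t) \<longlonglongrightarrow> k t"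
  have m: "h n \<in> borel_measurable circle" for n using h by (simp add: Re_approx_def)
  have mk: "k \<in> borel_measurable circle"
    by (rule borel_measurable_LIMSEQ_real[OF l m])
  have bk: "\<bar>k t\<bar> \<le> 1" for t
    by (rule LIMSEQ_le_const2[OF tendsto_rabs[OF l]]) (use b in auto)
  show "Re_approx p k"
  proof (rule Re_approx_limit[OF p h mk])
    show "(\<lambda>n. pmass p (\<lambda>t. k t - h n t)) \<longlonglongrightarrow> 0"
    proof (rule pmass_tendsto_0_dominated[OF p m mk _ _ _ l])
      show "\<bar>k t - h n t\<bar> \<le> \<bar>2\<bar>" for n t
        using b[of n t] bk[of t] by linarith
      show "pmass p (\<lambda>_. 2::real) < \<infinity>" by (simp add: pmass_const)
    qed simp
  qed
qed (use p in \<open>auto intro: Re_approx_continuous Re_approx_lincomb\<close>)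

lemma Re_approx_if_pmass_finite:
  fixes u :: "complex \<Rightarrow> real"
  assumes p: "0 < p" and u [measurable]: "u \<in> borel_measurable circle" and fin: "pmass p u < \<infinity>"
  shows "Re_approx p u"
proof -
  obtain F where F: "\<And>i. simple_function circle (F i)" "\<And>x. x \<in> space circle \<Longrightarrow> (\<lambda>i. F i x) \<longlonglongrightarrow> u x"
    "\<And>i x. x \<in> space circle \<Longrightarrow> dist (F i x) 0 \<le> 2 * dist (u x) 0"
    using borel_measurable_implies_sequence_metric[OF u, of 0] by blast
  have mF [measurable]: "F i \<in> borel_measurable circle" for i
    by (rule borel_measurable_simple_function[OF F(1)])
  have "Re_approx p (F i)" for i
  proof -
    define B where "B y = F i -` {y} \<inter> space circle" for y
    have B: "B y \<in> sets circle" for y unfolding B_def by (rule simple_functionD[OF F(1)])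
    have fin: "finite (F i ` space circle)" by (rule simple_functionD[OF F(1)])
    have "Re_approx p (\<lambda>t. \<Sum>y\<in>Y. y * indicator (B y) t)" if "finite Y" for Y
      using that
    proof induction
      case empty
      then show ?case using Re_approx_continuous[of "\<lambda>_. 0" p] p by simp
    next
      case (insert y Y)
      have "Re_approx p (\<lambda>t. (\<Sum>y\<in>Y. y * indicator (B y) t) + y * indicator (B y) t)"
        by (rule Re_approx_lincomb[OF p insert.IH Re_approx_indicator[OF p B]])
      then show ?case by (simp only: sum.insert[OF insert(1,2)] add.commute)
    qed
    then have R: "Re_approx p (\<lambda>t. \<Sum>y\<in>F i ` space circle. y * indicator (B y) t)" using fin by blast
    have eq: "F i t = (\<Sum>y\<in>F i ` space circle. y * indicator (B y) t)" if "norm t = 1" for t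
    proof -
      have "t \<in> space circle" using that by (simp add: in_space_circle_iff)
      then have "(\<Sum>y\<in>F i ` space circle. y * indicator (B y) t) = (\<Sum>y\<in>F i ` space circle. if y = F i t then F i t else 0)"
        by (intro sum.cong) (auto simp: B_def indicator_def)
      also have "\<dots> = F i t" using fin \<open>t \<in> space circle\<close> by simp
      finally show ?thesis by simp
    qed
    have "pmass p (\<lambda>t. F i t - Re (poly q t)) = pmass p (\<lambda>t. (\<Sum>y\<in>F i ` space circle. y * indicator (B y) t) - Re (poly q t))" for q
      by (rule pmass_cong) (simp only: eq)
    then show ?thesis using R mF unfolding Re_approx_def by simp
  qed
  then show ?thesis
  proof (rule Re_approx_limit[OF p _ u])
    show "(\<lambda>n. pmass p (\<lambda>t. u t - F n t)) \<longlonglongrightarrow> 0"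
    proof (rule pmass_tendsto_0_dominated[OF p mF u])
      \<comment> \<open>The simple functions satisfy |F| \<le> 2 |u|, so 3 |u| dominates the
        differences.\<close>
      show "(\<lambda>t. 3 * u t) \<in> borel_measurable circle" by measurable
      have "pmass p (\<lambda>t. 3 * u t) = ennreal (3 powr p) * pmass p u" by (subst pmass_cmult) auto
      also have "\<dots> < \<infinity>" using fin by (simp add: ennreal_mult_less_top)
      finally show "pmass p (\<lambda>t. 3 * u t) < \<infinity>" .
      show "\<bar>u t - F n t\<bar> \<le> \<bar>3 * u t\<bar>" if "norm t = 1" for n t
        using F(3)[of t n] that by (auto simp: in_space_circle_iff)
      show "(\<lambda>n. F n t) \<longlonglongrightarrow> u t" if "norm t = 1" for t
        using F(2) that by (simp add: in_space_circle_iff)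
    qed
  qed
qed

section \<open>The inequality of M. Riesz for polynomials\<close>

lemma integrable_circle_continuous:
  fixes f :: "complex \<Rightarrow> 'b::{banach, second_countable_topology}"
  assumes f: "continuous_on (sphere 0 1) f"
  shows "integrable circle f"
proof -
  obtain C where "\<forall>t\<in>sphere 0 1. norm (f t) \<le> C"
    using continuous_on_sphere_bounded[OF f] by blast
  then show ?thesis
    using borel_measurable_circle_continuous[OF f]
    by (intro circle.integrable_const_bound[of f C] AE_I2) (auto simp: in_space_circle_iff)
qed

text \<open>\<open>integral_norm_le_pmass\<close> with e equal to half the modulus of the integral:
  the first term is absorbed, at the price of the factor \<open>2 powr p\<close>.\<close>

lemma norm_integral_powr_le:
  assumes f: "f \<in> Lp p" and p: "1 \<le> p"
  shows "norm (LINT t|circle. f t) powr p \<le> 2 powr p * enn2real (pmass p f)"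
proof (cases "(LINT t|circle. f t) = 0")
  case False
  define c where "c = norm (LINT t|circle. f t)"
  have c: "0 < c" using False by (simp add: c_def)
  have "c \<le> c/2 + (c/2) powr (1 - p) * enn2real (pmass p f)"
    unfolding c_def by (rule integral_norm_le_pmass[OF f p]) (use c c_def in auto)
  then have "c/2 \<le> (c/2) powr (1 - p) * enn2real (pmass p f)" by simp
  then have "(c/2) powr (p - 1) * (c/2) \<le> (c/2) powr (p - 1) * ((c/2) powr (1 - p) * enn2real (pmass p f))"
    by (rule mult_left_mono) simp
  also have "\<dots> = enn2real (pmass p f)"
    using c by (simp flip: mult.assoc powr_add)
  also have "(c/2) powr (p - 1) * (c/2) = (c/2) powr p"
    using c powr_add[of "c/2" "p - 1" 1] by simp
  finally show ?thesis using c unfolding c_def[symmetric] by (simp add: powr_divide field_simps)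
qed simp

text \<open>For small angles cos x stays away from 0 and the term with A dominates. For angles near
  pi/2 the condition p > 1 pushes p x beyond pi/2, while p \<le> 2 keeps it below pi, so cos (p x)
  is negative and the term with B takes over.\<close>

lemma cos_powr_bound:
  fixes p :: real
  assumes p: "1 < p" "p \<le> 2"
  obtains A B where "0 \<le> A" "0 \<le> B"
    "\<And>x. \<bar>x\<bar> < pi/2 \<Longrightarrow> 1 \<le> A * cos x powr p - B * cos (p * x)"
proof -
  \<comment> \<open>The midpoint between pi/(2p), where cos (p x) changes sign, and pi/2. Then B is
    chosen such that - B * cos (p * x0) = 1, and A such that A * cos x0 powr p = 1 + B.\<close>
  define x0 where "x0 = (pi/2 + pi/(2*p)) / 2"
  have x0: "0 < x0" "x0 < pi/2" "pi/2 < p * x0" "p * x0 \<le> pi"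
    using p pi_gt_zero by (auto simp: x0_def field_simps intro: add_pos_pos)
  have c1: "cos (p * x0) < 0"
    using cos_monotone_0_pi[of "pi/2" "p*x0"] x0 by simp
  have c2: "0 < cos x0" using x0 by (intro cos_gt_zero) auto
  define B where "B = - 1 / cos (p * x0)"
  define A where "A = (1 + B) / cos x0 powr p"
  have B: "0 < B" using c1 by (simp add: B_def divide_neg_neg)
  have A: "0 < A" using B c2 by (simp add: A_def)
  show ?thesis
  proof
    fix x :: real assume x: "\<bar>x\<bar> < pi/2"
    have e: "cos x = cos \<bar>x\<bar>" "cos (p * x) = cos (p * \<bar>x\<bar>)" by (auto simp: abs_if)
    show "1 \<le> A * cos x powr p - B * cos (p * x)"
    proof (cases "\<bar>x\<bar> < x0")
      case True
      have "cos x0 \<le> cos x" unfolding e using True x0 by (intro cos_monotone_0_pi_le) auto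
      then have "A * cos x0 powr p \<le> A * cos x powr p"
        using A c2 p by (intro mult_left_mono powr_mono2) auto
      moreover have "A * cos x0 powr p = 1 + B" using c2 by (simp add: A_def)
      moreover have "B * cos (p * x) \<le> B * 1" using B by (intro mult_left_mono) auto
      ultimately show ?thesis by linarith
    next
      case False
      have "p * \<bar>x\<bar> \<le> 2 * (pi/2)" using p x by (intro mult_mono) auto
      then have "cos (p * x) \<le> cos (p * x0)"
        unfolding e using False x0 p by (intro cos_monotone_0_pi_le) auto
      then have "B * cos (p * x) \<le> B * cos (p * x0)" using B by (intro mult_left_mono) auto
      also have "\<dots> = -1" using c1 by (simp add: B_def)
      finally have "B * cos (p * x) \<le> -1" .
      moreover have "0 \<le> A * cos x powr p" using A by simp
      ultimately show ?thesis by linarith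
    qed
  qed (use A B in auto)
qed

text \<open>The homogeneous form of \<open>cos_powr_bound\<close>: if w has argument x, then Re w
  and Re of the p-th power are cos x and cos (p x) times powers of the modulus.\<close>

lemma norm_powr_bound_halfplane:
  fixes p :: real
  assumes p: "1 < p" "p \<le> 2"
  obtains A B where "0 \<le> A" "0 \<le> B"
    "\<And>w. 0 < Re w \<Longrightarrow> norm w powr p \<le> A * Re w powr p - B * Re (w powr of_real p)"
proof -
  obtain A B where AB: "0 \<le> A" "0 \<le> B" "\<And>x. \<bar>x\<bar> < pi/2 \<Longrightarrow> 1 \<le> A * cos x powr p - B * cos (p * x)"
    using cos_powr_bound[OF p] by blast
  show ?thesis
  proof (rule that[OF AB(1,2)])
    fix w :: complex assume w: "0 < Re w"
    define x where "x = Im (Ln w)"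
    have w0: "w \<noteq> 0" using w by auto
    have x: "\<bar>x\<bar> < pi/2" unfolding x_def using Re_Ln_pos_lt[OF w0] w by simp
    have "w = exp (Ln w)" using w0 by simp
    then have Re_w: "Re w = norm w * cos x"
      using w0 by (metis Re_exp Re_Ln exp_ln norm_exp_eq_Re x_def)
    have cx: "0 < cos x" using x by (intro cos_gt_zero_pi) auto
    have "Re (w powr of_real p) = norm w powr p * cos (p * x)"
      using w0 by (simp add: powr_def Re_exp x_def)
    then have "A * Re w powr p - B * Re (w powr of_real p) = norm w powr p * (A * cos x powr p - B * cos (p * x))"
      using cx by (simp add: Re_w powr_mult algebra_simps)
    also have "\<dots> \<ge> norm w powr p * 1" using AB(3)[OF x] by (intro mult_left_mono) auto
    finally show "norm w powr p \<le> A * Re w powr p - B * Re (w powr of_real p)" by simp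
  qed
qed

text \<open>The minimum principle for the harmonic function Re q, read off from the maximum modulus
  principle for exp (- q); compactness of the circle makes the minimum m strictly positive.\<close>

lemma Re_poly_pos_disc:
  fixes q :: "complex poly"
  assumes pos: "\<And>z. norm z = 1 \<Longrightarrow> 0 < Re (poly q z)" and z: "norm z \<le> 1"
  shows "0 < Re (poly q z)"
proof -
  have "compact ((\<lambda>z. Re (poly q z)) ` sphere 0 1)"
    by (intro compact_continuous_image continuous_intros compact_sphere)
  moreover have "(\<lambda>z. Re (poly q z)) ` sphere (0::complex) 1 \<noteq> {}" by simp
  ultimately obtain m where m: "m \<in> (\<lambda>z. Re (poly q z)) ` sphere 0 1"
    "\<And>y. y \<in> (\<lambda>z. Re (poly q z)) ` sphere 0 1 \<Longrightarrow> m \<le> y"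
    using compact_attains_inf by metis
  have "0 < m" using m(1) pos by auto
  have "norm (exp (- poly q z)) \<le> exp (- m)"
  proof (rule maximum_modulus_frontier[where S = "cball 0 1" and f = "\<lambda>z. exp (- poly q z)"])
    show "(\<lambda>z. exp (- poly q z)) holomorphic_on interior (cball 0 1)"
      by (intro holomorphic_intros)
    show "continuous_on (closure (cball 0 1)) (\<lambda>z. exp (- poly q z))"
      by (intro continuous_intros)
    fix y :: complex assume "y \<in> frontier (cball 0 1)"
    show "norm (exp (- poly q y)) \<le> exp (- m)"
    proof -
      have "y \<in> sphere 0 1" using \<open>y \<in> frontier (cball 0 1)\<close> by (simp add: frontier_cball)
      then have "m \<le> Re (poly q y)" by (intro m(2)) auto
      then show ?thesis by (simp add: norm_exp_eq_Re)
    qed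
  qed (use z in auto)
  then have "m \<le> Re (poly q z)" by (simp add: norm_exp_eq_Re)
  then show ?thesis using \<open>0 < m\<close> by linarith
qed

lemma riesz_poly_positive:
  fixes p :: real
  assumes p: "1 < p" "p \<le> 2"
  obtains A where "0 \<le> A" "\<And>q. Im (poly q 0) = 0 \<Longrightarrow> (\<And>z. norm z = 1 \<Longrightarrow> 0 < Re (poly q z)) \<Longrightarrow>
    (LINT t|circle. norm (poly q t) powr p) \<le> A * (LINT t|circle. Re (poly q t) powr p)"
proof -
  obtain A B where AB: "0 \<le> A" "0 \<le> B"
    "\<And>w. 0 < Re w \<Longrightarrow> norm w powr p \<le> A * Re w powr p - B * Re (w powr of_real p)"
    using norm_powr_bound_halfplane[OF p] by blast
  show ?thesis
  proof (rule that[OF AB(1)])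
    fix q :: "complex poly" assume im: "Im (poly q 0) = 0" and pos: "\<And>z. norm z = 1 \<Longrightarrow> 0 < Re (poly q z)"
    have posd: "0 < Re (poly q z)" if "norm z \<le> 1" for z
      using Re_poly_pos_disc[of q z] pos that by blast
    define g where "g z = poly q z powr complex_of_real p" for z
    have nn: "poly q z \<notin> \<real>\<^sub>\<le>\<^sub>0" if "norm z \<le> 1" for z
      using posd[OF that] by (auto simp: complex_nonpos_Reals_iff)
    have hc: "g holomorphic_on cball 0 1"
      unfolding g_def by (intro holomorphic_intros) (use nn in auto)
    then have cg: "continuous_on (cball 0 1) g" and hg: "g holomorphic_on ball 0 1"
      by (auto intro: holomorphic_on_imp_continuous_on holomorphic_on_subset)
    have cgs: "continuous_on (sphere 0 1) g" by (rule continuous_on_subset[OF cg]) auto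
    have "poly q 0 = of_real (Re (poly q 0))" using im by (simp add: complex_eq_iff)
    then have "g 0 = of_real (Re (poly q 0) powr p)"
      unfolding g_def using posd[of 0] by (metis less_imp_le norm_zero powr_of_real zero_le_one)
    then have "0 \<le> Re (LINT t|circle. g t)"
      using integral_circle_holomorphic[OF cg hg] by simp
    also have "Re (LINT t|circle. g t) = (LINT t|circle. Re (g t))"
      using integrable_circle_continuous[OF cgs] by simp
    finally have m: "0 \<le> (LINT t|circle. Re (g t))" .
    have c1: "continuous_on (sphere 0 1) (\<lambda>t. Re (poly q t) powr p)"
      by (intro continuous_intros) (use pos in force)
    have c2: "continuous_on (sphere 0 1) (\<lambda>t. norm (poly q t) powr p)"
      by (intro continuous_intros) (use pos in force)
    have c3: "continuous_on (sphere 0 1) (\<lambda>t. Re (g t))" by (intro continuous_intros cgs)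
    note i = c1[THEN integrable_circle_continuous] c2[THEN integrable_circle_continuous] c3[THEN integrable_circle_continuous]
    have "(LINT t|circle. norm (poly q t) powr p) \<le> (LINT t|circle. A * Re (poly q t) powr p - B * Re (g t))"
      using i by (intro integral_mono) (auto simp: g_def in_space_circle_iff intro!: AB(3) pos)
    also have "\<dots> = A * (LINT t|circle. Re (poly q t) powr p) - B * (LINT t|circle. Re (g t))"
      using i by simp
    also have "\<dots> \<le> A * (LINT t|circle. Re (poly q t) powr p)"
      using m AB(2) by simp
    finally show "(LINT t|circle. norm (poly q t) powr p) \<le> A * (LINT t|circle. Re (poly q t) powr p)" .
  qed
qed

text \<open>The theorem of M. Riesz on conjugate functions, restricted to polynomials and stated
  with p-th powers. The sign of C is left open; the users pass to a maximum.\<close>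

definition riesz_poly_bound :: "real \<Rightarrow> real \<Rightarrow> bool" where
  "riesz_poly_bound p C \<longleftrightarrow> (\<forall>q. Im (poly q 0) = 0 \<longrightarrow>
    (LINT t|circle. norm (poly q t) powr p) \<le> C * (LINT t|circle. \<bar>Re (poly q t)\<bar> powr p))"

lemma continuous_on_powr_const:
  fixes f :: "'a::topological_space \<Rightarrow> real"
  assumes "continuous_on S f" "\<And>x. x \<in> S \<Longrightarrow> 0 \<le> f x" "0 < p"
  shows "continuous_on S (\<lambda>x. f x powr p)"
  using assms by (intro continuous_on_powr') auto

lemma integrable_circle_powr:
  fixes f :: "complex \<Rightarrow> real"
  assumes "continuous_on (sphere 0 1) f" "\<And>t. 0 \<le> f t" "0 < p"
  shows "integrable circle (\<lambda>t. f t powr p)"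
  using assms by (intro integrable_circle_continuous continuous_on_powr_const) auto

lemma riesz_poly_bound_le_2:
  fixes p :: real
  assumes p: "1 < p" "p \<le> 2"
  shows "\<exists>C. riesz_poly_bound p C"
proof -
  obtain A where A: "0 \<le> A" "\<And>q. Im (poly q 0) = 0 \<Longrightarrow> (\<And>z. norm z = 1 \<Longrightarrow> 0 < Re (poly q z)) \<Longrightarrow>
    (LINT t|circle. norm (poly q t) powr p) \<le> A * (LINT t|circle. Re (poly q t) powr p)"
    using riesz_poly_positive[OF p] by blast
  \<comment> \<open>The outer factor \<open>2 powr p\<close> and the 2 come from splitting q into
    two polynomials with positive real part, A from the bound for each of them, and the last factor
    from expanding (|f| + 3e) powr p.\<close>
  define C where "C = 2 powr p * 2 * A * 2 powr p"
  have C: "0 \<le> C" using A by (simp add: C_def)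
  have "(LINT t|circle. norm (poly q t) powr p) \<le> C * (LINT t|circle. \<bar>Re (poly q t)\<bar> powr p)"
    if im: "Im (poly q 0) = 0" for q
  proof (rule field_le_epsilon)
    fix d :: real assume d: "0 < d"
    define f where "f t = Re (poly q t)" for t
    have cf: "continuous_on S f" for S unfolding f_def by (intro continuous_intros)
    \<comment> \<open>Chosen such that the approximation error \<open>C * (3 * e) powr p\<close>
      equals C d / (C + 1), which is at most d; the added 1 covers C = 0.\<close>
    define e where "e = (d / (C + 1)) powr (1/p) / 3"
    have e: "0 < e" using d C by (simp add: e_def)
    have e3: "(3 * e) powr p = d / (C + 1)" using d C p by (simp add: e_def powr_powr)
    \<comment> \<open>The shift by 2e leaves room for an approximation error e: the real parts of g
      and of g - q both remain above e.\<close>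
    have "continuous_on (sphere 0 1) (\<lambda>t. max (f t) 0 + 2 * e)" by (intro continuous_intros cf)
    then obtain g where g: "Im (poly g 0) = 0"
      "\<And>z. norm z = 1 \<Longrightarrow> \<bar>(max (f z) 0 + 2 * e) - Re (poly g z)\<bar> < e"
      using Re_poly_dense e by blast
    \<comment> \<open>\<open>q = g - h\<close>, where \<open>Re g\<close> and \<open>Re h\<close> are close to the positive and negative part of \<open>Re q\<close> and positive.\<close>
    define h where "h = g - q"
    have Reh: "Re (poly h t) = Re (poly g t) - f t" for t by (simp add: h_def f_def)
    have gb: "0 < Re (poly g z)" "Re (poly g z) \<le> \<bar>f z\<bar> + 3 * e"
      and hb: "0 < Re (poly h z)" "Re (poly h z) \<le> \<bar>f z\<bar> + 3 * e" if "norm z = 1" for z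
      using g(2)[OF that] e unfolding Reh by linarith+
    have imh: "Im (poly h 0) = 0" using im g by (simp add: h_def)
    have i1: "integrable circle (\<lambda>t. norm (poly r t) powr p)" for r
      by (rule integrable_circle_powr) (use p in \<open>auto intro!: continuous_intros\<close>)
    have i2: "integrable circle (\<lambda>t. Re (poly r t) powr p)" if "\<And>z. norm z = 1 \<Longrightarrow> 0 < Re (poly r z)" for r
      by (intro integrable_circle_continuous continuous_intros) (use that in force)
    have i3: "integrable circle (\<lambda>t. \<bar>f t\<bar> powr p)"
      by (rule integrable_circle_powr) (use p in \<open>auto intro!: continuous_intros cf\<close>)
    have part: "(LINT t|circle. norm (poly r t) powr p) \<le> A * 2 powr p * ((LINT t|circle. \<bar>f t\<bar> powr p) + (3 * e) powr p)"
      if r: "Im (poly r 0) = 0" "\<And>z. norm z = 1 \<Longrightarrow> 0 < Re (poly r z)" "\<And>z. norm z = 1 \<Longrightarrow> Re (poly r z) \<le> \<bar>f z\<bar> + 3 * e" for r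
    proof -
      have "(LINT t|circle. Re (poly r t) powr p) \<le> (LINT t|circle. 2 powr p * (\<bar>f t\<bar> powr p + (3 * e) powr p))"
      proof (rule integral_mono)
        fix t assume "t \<in> space circle"
        then have t: "norm t = 1" by (simp add: in_space_circle_iff)
        have "Re (poly r t) powr p \<le> (\<bar>f t\<bar> + 3 * e) powr p"
          using r(2,3)[OF t] p by (intro powr_mono2) auto
        also have "\<dots> \<le> 2 powr p * (\<bar>f t\<bar> powr p + (3 * e) powr p)"
          using e p by (intro powr_add_le) auto
        finally show "Re (poly r t) powr p \<le> 2 powr p * (\<bar>f t\<bar> powr p + (3 * e) powr p)" .
      qed (use i2[OF r(2)] i3 in auto)
      also have "\<dots> = 2 powr p * ((LINT t|circle. \<bar>f t\<bar> powr p) + (3 * e) powr p)"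
        using i3 by simp
      finally show ?thesis
        using A(2)[OF r(1,2)] A(1) by (smt (verit) mult.assoc mult_left_mono)
    qed
    have "(LINT t|circle. norm (poly q t) powr p) \<le>
        (LINT t|circle. 2 powr p * (norm (poly g t) powr p + norm (poly h t) powr p))"
    proof (rule integral_mono)
      fix t
      have "norm (poly q t) powr p \<le> (norm (poly g t) + norm (poly h t)) powr p"
        using p norm_triangle_ineq4[of "poly g t" "poly h t"] by (intro powr_mono2) (auto simp: h_def)
      also have "\<dots> \<le> 2 powr p * (norm (poly g t) powr p + norm (poly h t) powr p)"
        using p by (intro powr_add_le) auto
      finally show "norm (poly q t) powr p \<le> 2 powr p * (norm (poly g t) powr p + norm (poly h t) powr p)" .
    qed (use i1 in auto)
    also have "\<dots> = 2 powr p * ((LINT t|circle. norm (poly g t) powr p) + (LINT t|circle. norm (poly h t) powr p))"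
      using i1 by simp
    also have "\<dots> \<le> 2 powr p * (2 * (A * 2 powr p * ((LINT t|circle. \<bar>f t\<bar> powr p) + (3 * e) powr p)))"
      using part[OF g(1) gb] part[OF imh hb] by (intro mult_left_mono) auto
    also have "\<dots> = C * (LINT t|circle. \<bar>f t\<bar> powr p) + C * (3 * e) powr p"
      by (simp add: C_def algebra_simps)
    also have "C * (3 * e) powr p \<le> d"
      using C d unfolding e3 by (simp add: field_simps)
    finally show "(LINT t|circle. norm (poly q t) powr p) \<le> C * (LINT t|circle. \<bar>Re (poly q t)\<bar> powr p) + d"
      by (simp add: f_def)
  qed
  then show ?thesis by (auto simp: riesz_poly_bound_def)
qed

lemma riesz_poly_bound_double:
  fixes p :: real
  assumes p: "1 < p" and ex: "\<exists>C. riesz_poly_bound p C"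
  shows "\<exists>C. riesz_poly_bound (2 * p) C"
proof -
  obtain C0 where C0: "riesz_poly_bound p C0" using ex by blast
  define C where "C = max C0 0"
  have C: "0 \<le> C" by (simp add: C_def)
  have b: "(LINT t|circle. norm (poly q t) powr p) \<le> C * (LINT t|circle. \<bar>Re (poly q t)\<bar> powr p)"
    if "Im (poly q 0) = 0" for q
  proof -
    have "(LINT t|circle. norm (poly q t) powr p) \<le> C0 * (LINT t|circle. \<bar>Re (poly q t)\<bar> powr p)"
      using C0 that by (auto simp: riesz_poly_bound_def)
    also have "\<dots> \<le> C * (LINT t|circle. \<bar>Re (poly q t)\<bar> powr p)"
      by (intro mult_right_mono) (auto simp: C_def)
    finally show ?thesis .
  qed
  define K where "K = 2 powr p * 2 powr p * C"
  have K: "0 \<le> K" using C by (simp add: K_def)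
  \<comment> \<open>K is the factor with which d times the integral of
    \<open>norm (poly q t) powr (2*p)\<close> reappears on the right; this d makes the total factor
    at most 1/2, so that the term can be absorbed.\<close>
  define d where "d = 1 / (2 * (K + 1))"
  have d: "0 < d" using K by (simp add: d_def)
  have Kd: "K * d \<le> 1/2" using K by (simp add: d_def field_simps)
  \<comment> \<open>Twice the factor of the integral of
    \<open>\<bar>Re (poly q t)\<bar> powr (2*p)\<close> that is left before half of the left-hand
    side is absorbed.\<close>
  define D where "D = 2 * (K / d + 2 powr p * 2 powr (2*p))"
  have "(LINT t|circle. norm (poly q t) powr (2*p)) \<le> D * (LINT t|circle. \<bar>Re (poly q t)\<bar> powr (2*p))"
    if im: "Im (poly q 0) = 0" for q
  proof -
    define f where "f t = Re (poly q t)" for t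
    define c where "c = Re (poly q 0)"
    have q0: "poly q 0 = of_real c" using im by (simp add: c_def complex_eq_iff)
    \<comment> \<open>\<open>Re r = 2 Re q Im q\<close>, and its \<open>p\<close>-th power is split by Young's inequality; the part with \<open>Im q\<close>
      is absorbed into the left-hand side.\<close>
    define r where "r = smult (-\<i>) (q * q - [:of_real (c * c):])"
    \<comment> \<open>Without the subtracted constant, r would take the value - \<i> c^2 at 0 and
      violate the normalization that the bound for p requires.\<close>
    have r0: "poly r 0 = 0" by (simp add: r_def q0)
    have Rer: "Re (poly r t) = 2 * f t * Im (poly q t)" for t
      by (simp add: r_def f_def algebra_simps)
    have i1: "integrable circle (\<lambda>t. norm (poly s t) powr P)" if "0 < P" for s P
      by (rule integrable_circle_powr) (use that in \<open>auto intro!: continuous_intros\<close>)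
    have i2: "integrable circle (\<lambda>t. \<bar>Re (poly s t)\<bar> powr P)" if "0 < P" for s P
      by (rule integrable_circle_powr) (use that in \<open>auto intro!: continuous_intros\<close>)
    have sq: "x powr (2 * p) = (x * x) powr p" "x powr (2 * p) = (x powr p) * (x powr p)" if "0 \<le> x" for x :: real
      using that by (simp_all add: powr_mult flip: powr_add)
    have "(LINT t|circle. norm (poly r t) powr p) \<le> C * (LINT t|circle. \<bar>Re (poly r t)\<bar> powr p)"
      by (rule b) (simp add: r0)
    also have "(LINT t|circle. \<bar>Re (poly r t)\<bar> powr p) \<le>
        (LINT t|circle. 2 powr p * (d * norm (poly q t) powr (2*p) + \<bar>f t\<bar> powr (2*p) / d))"
    proof (rule integral_mono)
      fix t
      define X Y where "X = \<bar>f t\<bar> powr p" and "Y = norm (poly q t) powr p"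
      have XY: "0 \<le> X" "0 \<le> Y" by (simp_all add: X_def Y_def)
      have "\<bar>Re (poly r t)\<bar> powr p \<le> (2 * (\<bar>f t\<bar> * norm (poly q t))) powr p"
        using p abs_Im_le_cmod[of "poly q t"]
        by (intro powr_mono2) (auto simp: Rer abs_mult intro!: mult_left_mono)
      also have "\<dots> = 2 powr p * (X * Y)" by (simp add: powr_mult X_def Y_def)
      also have "X * Y \<le> d * (Y * Y) + X * X / d"
      proof -
        have "0 \<le> (d * Y - X)\<^sup>2 / d" using d by simp
        also have "\<dots> = d * (Y * Y) + X * X / d - 2 * (X * Y)"
          using d by (simp add: power2_eq_square field_simps)
        finally show ?thesis using XY mult_nonneg_nonneg[of X Y] by linarith
      qed
      finally show "\<bar>Re (poly r t)\<bar> powr p \<le> 2 powr p * (d * norm (poly q t) powr (2*p) + \<bar>f t\<bar> powr (2*p) / d)"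
        by (simp add: sq(2) X_def Y_def)
    qed (use p i1[of "2*p" q] i2[of "2*p" q] i2[of p r] in \<open>auto simp: f_def\<close>)
    also have "\<dots> = 2 powr p * (d * (LINT t|circle. norm (poly q t) powr (2*p)) + (LINT t|circle. \<bar>f t\<bar> powr (2*p)) / d)"
      using p i1[of "2*p" q] i2[of "2*p" q] by (simp add: f_def)
    finally have rb: "(LINT t|circle. norm (poly r t) powr p) \<le>
        C * (2 powr p * (d * (LINT t|circle. norm (poly q t) powr (2*p)) + (LINT t|circle. \<bar>f t\<bar> powr (2*p)) / d))"
      using C by (simp add: mult_left_mono)
    \<comment> \<open>The constant c removed from q^2 is controlled by the real part as well, being
      the mean of f.\<close>
    have "(LINT t|circle. of_real (f t) :: complex) = of_real c"
    proof -
      have "(LINT t|circle. poly q t) = poly q 0"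
        by (rule integral_circle_holomorphic) (auto intro!: continuous_intros holomorphic_intros)
      moreover have "integrable circle (poly q)"
        by (rule integrable_circle_continuous) (intro continuous_intros)
      ultimately have "(LINT t|circle. f t) = c"
        by (simp add: f_def c_def)
      then show ?thesis by (simp add: integral_complex_of_real)
    qed
    moreover have fLp: "(\<lambda>t. complex_of_real (f t)) \<in> Lp (2*p)"
      using p by (intro Lp_continuous) (auto simp: f_def intro!: continuous_intros)
    ultimately have cb: "\<bar>c\<bar> powr (2*p) \<le> 2 powr (2*p) * (LINT t|circle. \<bar>f t\<bar> powr (2*p))"
      using norm_integral_powr_le[OF fLp] p by (simp add: pmass_eq_integral[OF fLp])
    have "(LINT t|circle. norm (poly q t) powr (2*p)) \<le>
        (LINT t|circle. 2 powr p * (norm (poly r t) powr p + \<bar>c\<bar> powr (2*p)))"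
    proof (rule integral_mono)
      fix t
      have "norm (poly q t) * norm (poly q t) = norm (\<i> * poly r t + of_real (c * c))"
        by (simp add: r_def norm_mult[symmetric])
      also have "\<dots> \<le> norm (poly r t) + \<bar>c\<bar> * \<bar>c\<bar>"
        using norm_triangle_ineq[of "\<i> * poly r t" "of_real (c * c)"] by (simp add: norm_mult abs_mult)
      finally have "(norm (poly q t) * norm (poly q t)) powr p \<le> (norm (poly r t) + \<bar>c\<bar> * \<bar>c\<bar>) powr p"
        using p by (intro powr_mono2) auto
      also have "\<dots> \<le> 2 powr p * (norm (poly r t) powr p + (\<bar>c\<bar> * \<bar>c\<bar>) powr p)"
        using p by (intro powr_add_le) auto
      finally show "norm (poly q t) powr (2*p) \<le> 2 powr p * (norm (poly r t) powr p + \<bar>c\<bar> powr (2*p))"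
        by (simp add: sq(1))
    qed (use p i1[of "2*p" q] i1[of p r] in auto)
    also have "\<dots> = 2 powr p * ((LINT t|circle. norm (poly r t) powr p) + \<bar>c\<bar> powr (2*p))"
      using p i1[of p r] by simp
    also have "\<dots> \<le> 2 powr p * (C * (2 powr p * (d * (LINT t|circle. norm (poly q t) powr (2*p)) + (LINT t|circle. \<bar>f t\<bar> powr (2*p)) / d))
        + 2 powr (2*p) * (LINT t|circle. \<bar>f t\<bar> powr (2*p)))"
      by (intro mult_left_mono add_mono rb cb) auto
    also have "\<dots> = (K * d) * (LINT t|circle. norm (poly q t) powr (2*p)) + D / 2 * (LINT t|circle. \<bar>f t\<bar> powr (2*p))"
      by (simp add: K_def D_def algebra_simps)
    also have "\<dots> \<le> 1/2 * (LINT t|circle. norm (poly q t) powr (2*p)) + D / 2 * (LINT t|circle. \<bar>f t\<bar> powr (2*p))"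
      by (intro add_mono mult_right_mono Kd) auto
    finally show ?thesis by (simp add: f_def)
  qed
  then show ?thesis by (auto simp: riesz_poly_bound_def)
qed

text \<open>Half of an exponent above 2 is still above 1, so repeated halving ends in the range
  covered by \<open>riesz_poly_bound_le_2\<close>.\<close>

lemma riesz_poly_bound_exists:
  fixes p :: real
  assumes p: "1 < p"
  shows "\<exists>C. riesz_poly_bound p C"
proof -
  have "\<forall>p. 1 < p \<and> p \<le> 2 ^ Suc n \<longrightarrow> (\<exists>C. riesz_poly_bound p C)" for n
  proof (induction n)
    case 0
    then show ?case using riesz_poly_bound_le_2 by auto
  next
    case (Suc n)
    show ?case
    proof (intro allI impI)
      fix p :: real assume p: "1 < p \<and> p \<le> 2 ^ Suc (Suc n)"
      show "\<exists>C. riesz_poly_bound p C"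
      proof (cases "p \<le> 2")
        case False
        then have "\<exists>C. riesz_poly_bound (2 * (p/2)) C"
          using p Suc.IH by (intro riesz_poly_bound_double) auto
        then show ?thesis by simp
      qed (use p riesz_poly_bound_le_2 in auto)
    qed
  qed
  moreover obtain n where "p < 2 ^ n" using real_arch_pow[of 2 p] by auto
  then have "p \<le> 2 ^ Suc n" using p by simp
  ultimately show ?thesis using p by blast
qed

section \<open>Fourier coefficients and the Riesz projection\<close>

lemma integrable_mult_powi:
  assumes "integrable circle f"
  shows "integrable circle (\<lambda>t. f t * t powi n)"
proof (rule Bochner_Integration.integrable_bound[OF assms])
  show "(\<lambda>t. f t * t powi n) \<in> borel_measurable circle"
    using assms by measurable
  show "AE t in circle. norm (f t * t powi n) \<le> norm (f t)"
    by (intro AE_I2) (simp add: in_space_circle_iff norm_mult norm_power_int)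
qed

lemma fourier_coeff_cong_AE:
  assumes "AE t in circle. f t = g t" "f \<in> borel_measurable circle" "g \<in> borel_measurable circle"
  shows "fourier_coeff f n = fourier_coeff g n"
  unfolding fourier_coeff_def
  by (rule integral_cong_AE) (use assms in \<open>auto elim: eventually_mono\<close>)

lemma fourier_coeff_cong:
  assumes "\<And>t. norm t = 1 \<Longrightarrow> f t = g t"
  shows "fourier_coeff f n = fourier_coeff g n"
  unfolding fourier_coeff_def
  by (rule Bochner_Integration.integral_cong) (use assms in \<open>auto simp: in_space_circle_iff\<close>)

lemma fourier_coeff_add:
  assumes "integrable circle f" "integrable circle g"
  shows "fourier_coeff (\<lambda>t. f t + g t) n = fourier_coeff f n + fourier_coeff g n"
  using integrable_mult_powi[OF assms(1)] integrable_mult_powi[OF assms(2)]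
  by (simp add: fourier_coeff_def distrib_right)

lemma fourier_coeff_diff:
  assumes "integrable circle f" "integrable circle g"
  shows "fourier_coeff (\<lambda>t. f t - g t) n = fourier_coeff f n - fourier_coeff g n"
  using integrable_mult_powi[OF assms(1)] integrable_mult_powi[OF assms(2)]
  by (simp add: fourier_coeff_def left_diff_distrib)

lemma fourier_coeff_cmult: "fourier_coeff (\<lambda>t. c * f t) n = c * fourier_coeff f n"
  by (simp add: fourier_coeff_def mult.assoc)

lemma fourier_coeff_mult_powi: "fourier_coeff (\<lambda>t. t powi k * f t) n = fourier_coeff f (n - k)"
  unfolding fourier_coeff_def
proof (rule Bochner_Integration.integral_cong[OF refl])
  fix t assume "t \<in> space circle"
  then have "t \<noteq> 0" by (auto simp: in_space_circle_iff)
  then have "t powi (- (n - k)) = t powi k * t powi (- n)"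
    by (simp flip: power_int_add)
  then show "t powi k * f t * t powi - n = f t * t powi - (n - k)" by simp
qed

lemma fourier_coeff_cnj: "fourier_coeff (\<lambda>t. cnj (f t)) n = cnj (fourier_coeff f (- n))"
proof -
  have "fourier_coeff (\<lambda>t. cnj (f t)) n = (LINT t|circle. cnj (f t * t powi n))"
    unfolding fourier_coeff_def
  proof (rule Bochner_Integration.integral_cong[OF refl])
    fix t assume "t \<in> space circle"
    then have "cnj t = inverse t" by (intro cnj_eq_inverse) (simp add: in_space_circle_iff)
    then show "cnj (f t) * t powi - n = cnj (f t * t powi n)"
      by (simp add: power_int_minus power_int_inverse)
  qed
  also have "\<dots> = cnj (LINT t|circle. f t * t powi n)" by (rule Bochner_Integration.integral_cnj)
  finally show ?thesis by (simp add: fourier_coeff_def)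
qed

lemma integral_powi: "(LINT t|circle. t powi m) = (if m = 0 then 1 else 0)"
proof -
  have pos: "(LINT t|circle. t ^ k) = (if k = 0 then 1 else 0)" for k
    by (subst integral_circle_holomorphic) (auto intro!: continuous_intros holomorphic_intros)
  show ?thesis
  proof (cases "0 \<le> m")
    case True
    then show ?thesis using pos[of "nat m"] by (simp add: power_int_def)
  next
    case False
    have "(LINT t|circle. t powi m) = fourier_coeff (\<lambda>t. cnj 1) (- m)"
      by (simp add: fourier_coeff_def)
    also have "\<dots> = cnj (fourier_coeff (\<lambda>t. 1) m)"
      by (subst fourier_coeff_cnj) simp
    also have "fourier_coeff (\<lambda>t. 1) m = (LINT t|circle. t ^ nat (- m))"
      using False by (simp add: fourier_coeff_def power_int_def)
    finally show ?thesis using False pos[of "nat (-m)"] by simp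
  qed
qed

lemma fourier_coeff_monom: "fourier_coeff (\<lambda>t. t powi k) n = (if n = k then 1 else 0)"
  using fourier_coeff_mult_powi[of k "\<lambda>_. 1" n] integral_powi[of "k - n"]
  by (simp add: fourier_coeff_def)

lemma integrable_powi: "integrable circle (\<lambda>t. t powi k)"
  using integrable_mult_powi[of "\<lambda>_. 1" k] by simp

lemma integrable_poly: "integrable circle (poly q)"
  by (rule integrable_circle_continuous) (intro continuous_intros)

lemma fourier_coeff_poly: "fourier_coeff (poly q) n = (if 0 \<le> n then coeff q (nat n) else 0)"
proof (induction q arbitrary: n)
  case (pCons a q)
  have i: "integrable circle (\<lambda>t. t powi 1 * poly q t)"
    using integrable_mult_powi[OF integrable_poly, of q 1] by (simp add: mult.commute)
  have "fourier_coeff (poly (pCons a q)) n = fourier_coeff (\<lambda>t. a * t powi 0 + t powi 1 * poly q t) n"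
    by (rule fourier_coeff_cong) simp
  also have "\<dots> = a * fourier_coeff (\<lambda>t. t powi 0) n + fourier_coeff (poly q) (n - 1)"
    using i integrable_powi[of 0] by (subst fourier_coeff_add) (simp_all only: fourier_coeff_cmult fourier_coeff_mult_powi integrable_mult_right)
  also have "\<dots> = (if 0 \<le> n then coeff (pCons a q) (nat n) else 0)"
    unfolding fourier_coeff_monom pCons.IH
    by (auto simp: coeff_pCons nat_diff_distrib split: nat.splits)
  finally show ?case .
qed (simp add: fourier_coeff_def)

lemma fourier_coeff_Re_poly:
  "fourier_coeff (\<lambda>t. complex_of_real (Re (poly q t))) n =
    (fourier_coeff (poly q) n + cnj (fourier_coeff (poly q) (- n))) / 2"
proof -
  have ic: "integrable circle (\<lambda>t. cnj (poly q t))" using integrable_poly[of q] by simp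
  have "fourier_coeff (\<lambda>t. complex_of_real (Re (poly q t))) n =
      fourier_coeff (\<lambda>t. (1/2) * (poly q t + cnj (poly q t))) n"
    by (rule fourier_coeff_cong) (simp add: complex_add_cnj)
  then show ?thesis
    unfolding fourier_coeff_cmult fourier_coeff_add[OF integrable_poly ic] fourier_coeff_cnj by simp
qed

lemma powi_Linf: "(\<lambda>t. t powi n) \<in> Linf"
  by (rule Linf_continuous) (auto intro!: continuous_intros)

lemma fourier_coeff_tendsto:
  assumes "\<And>n. f n \<in> Lp p" "g \<in> Lp p" "1 \<le> p" "(\<lambda>n. pmass p (\<lambda>t. f n t - g t)) \<longlonglongrightarrow> 0"
  shows "(\<lambda>n. fourier_coeff (f n) m) \<longlonglongrightarrow> fourier_coeff g m"
  using integral_tendsto_pmass[OF assms powi_Linf[of "- m"]] by (simp add: fourier_coeff_def mult.commute)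

text \<open>Polynomials q k whose real parts tend to u form a Cauchy sequence by the inequality of
  M. Riesz, and the coefficients of their limit g determine the projection of u. The approximating
  polynomials \<open>r\<close> are part of the conclusion because they later give the density of
  polynomials in \<open>Hp\<close>.\<close>

lemma riesz_real:
  fixes u :: "complex \<Rightarrow> real"
  assumes p: "1 < p" and u: "(\<lambda>t. complex_of_real (u t)) \<in> Lp p"
  obtains g r where "g \<in> Lp p" "(\<lambda>k. pmass p (\<lambda>t. poly (r k) t - g t)) \<longlonglongrightarrow> 0"
    "\<And>n. fourier_coeff g n = (if 0 \<le> n then fourier_coeff (\<lambda>t. complex_of_real (u t)) n else 0)"
proof -
  have p0: "0 < p" "0 \<le> p" "1 \<le> p" using p by auto
  have "(\<lambda>t. Re (complex_of_real (u t))) \<in> borel_measurable circle"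
    using u by measurable
  then have um [measurable]: "u \<in> borel_measurable circle" by simp
  have real_pmass: "pmass p (\<lambda>t. complex_of_real (v t)) = pmass p v" for v by (simp add: pmass_def)
  have "Re_approx p u"
    using u real_pmass[of u] by (intro Re_approx_if_pmass_finite p0 um) (simp add: Lp_iff_pmass)
  then have "\<exists>q. Im (poly q 0) = 0 \<and> pmass p (\<lambda>t. u t - Re (poly q t)) < ennreal (1 / Suc k)" for k :: nat
    by (auto simp: Re_approx_def)
  then obtain q where q: "\<And>k. Im (poly (q k) 0) = 0"
    "\<And>k. pmass p (\<lambda>t. u t - Re (poly (q k) t)) < ennreal (1 / Suc k)" by metis
  obtain C0 where C0: "riesz_poly_bound p C0" using riesz_poly_bound_exists[OF p] by blast
  define C where "C = max C0 1"
  have C: "0 < C" by (simp add: C_def)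
  have "pmass p (poly s) \<le> ennreal C * pmass p (\<lambda>t. Re (poly s t))" if "Im (poly s 0) = 0" for s
  proof -
    have Rs: "(\<lambda>t. complex_of_real (Re (poly s t))) \<in> Lp p"
      by (rule Lp_continuous[OF _ p0(2)]) (intro continuous_intros)
    have "(LINT t|circle. norm (poly s t) powr p) \<le> C0 * (LINT t|circle. \<bar>Re (poly s t)\<bar> powr p)"
      using C0 that by (auto simp: riesz_poly_bound_def)
    also have "\<dots> \<le> C * (LINT t|circle. \<bar>Re (poly s t)\<bar> powr p)"
      by (intro mult_right_mono) (auto simp: C_def)
    finally have "ennreal (LINT t|circle. norm (poly s t) powr p) \<le> ennreal C * ennreal (LINT t|circle. \<bar>Re (poly s t)\<bar> powr p)"
      using C by (subst ennreal_mult[symmetric]) (auto intro: ennreal_leI)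
    then show ?thesis
      using pmass_eq_integral[OF Lp_poly[OF p0(2), of s]] pmass_eq_integral[OF Rs] real_pmass[of "\<lambda>t. Re (poly s t)"]
      by simp
  qed
  note bound = this
  have conv: "\<exists>N. \<forall>m\<ge>N. \<forall>n\<ge>N. pmass p (\<lambda>t. poly (q m) t - poly (q n) t) \<le> ennreal e" if e: "0 < e" for e
  proof -
    obtain N where N: "C * 2 powr p * 2 / e < real N" using reals_Archimedean2 by blast
    show ?thesis
    proof (intro exI[of _ N] allI impI)
      fix m n assume mn: "N \<le> m" "N \<le> n"
      have "pmass p (\<lambda>t. poly (q m) t - poly (q n) t) = pmass p (poly (q m - q n))"
        by (rule pmass_cong) simp
      also have "\<dots> \<le> ennreal C * pmass p (\<lambda>t. Re (poly (q m - q n) t))"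
        by (rule bound) (simp add: q)
      also have "pmass p (\<lambda>t. Re (poly (q m - q n) t)) = pmass p (\<lambda>t. Re (poly (q m) t) - Re (poly (q n) t))"
        by simp
      also have "\<dots> \<le> ennreal (2 powr p) * (pmass p (\<lambda>t. Re (poly (q m) t) - u t) + pmass p (\<lambda>t. u t - Re (poly (q n) t)))"
        using p0 by (intro pmass_diff_triangle) auto
      also have "\<dots> \<le> ennreal (2 powr p) * (ennreal (1 / Suc m) + ennreal (1 / Suc n))"
        using q(2)[of m] q(2)[of n] pmass_minus_commute[of p u "\<lambda>t. Re (poly (q m) t)"]
        by (intro mult_left_mono add_mono) auto
      also have "ennreal C * \<dots> = ennreal (C * (2 powr p * (1 / Suc m + 1 / Suc n)))"
        using C by (subst ennreal_plus[symmetric]) (simp_all add: ennreal_mult del: of_nat_Suc ennreal_plus)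
      also have "\<dots> \<le> ennreal e"
      proof (rule ennreal_leI)
        have N0: "0 < real N" using N e C by (smt (verit) divide_pos_pos mult_pos_pos powr_gt_zero)
        have "1 / real (Suc m) \<le> 1 / real N" "1 / real (Suc n) \<le> 1 / real N"
          using mn N0 by (auto intro!: divide_left_mono)
        then have "C * (2 powr p * (1 / Suc m + 1 / Suc n)) \<le> C * (2 powr p * (1 / real N + 1 / real N))"
          using C by (intro mult_left_mono) auto
        also have "\<dots> \<le> e" using N N0 e by (simp add: field_simps)
        finally show "C * (2 powr p * (1 / Suc m + 1 / Suc n)) \<le> e" .
      qed
      finally show "pmass p (\<lambda>t. poly (q m) t - poly (q n) t) \<le> ennreal e"
        using C by (simp add: mult_left_mono)
    qed
  qed
  obtain g where g: "g \<in> Lp p" "(\<lambda>k. pmass p (\<lambda>t. poly (q k) t - g t)) \<longlonglongrightarrow> 0"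
    using Lp_complete[of "\<lambda>k. poly (q k)", OF Lp_poly[OF p0(2)] p0(1) conv] by blast
  have lim1: "(\<lambda>k. fourier_coeff (poly (q k)) n) \<longlonglongrightarrow> fourier_coeff g n" for n
    by (rule fourier_coeff_tendsto[OF Lp_poly[OF p0(2)] g(1) p0(3) g(2)])
  have Rq: "(\<lambda>t. complex_of_real (Re (poly (q k) t))) \<in> Lp p" for k
    by (rule Lp_continuous[OF _ p0(2)]) (intro continuous_intros)
  have lim0: "(\<lambda>k. pmass p (\<lambda>t. complex_of_real (Re (poly (q k) t)) - complex_of_real (u t))) \<longlonglongrightarrow> 0"
  proof (rule tendsto_sandwich[where f = "\<lambda>_. 0" and h = "\<lambda>k. ennreal (1 / Suc k)"])
    show "\<forall>\<^sub>F k in sequentially. pmass p (\<lambda>t. complex_of_real (Re (poly (q k) t)) - complex_of_real (u t)) \<le> ennreal (1 / Suc k)"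
      using q(2) real_pmass[of "\<lambda>t. Re (poly (q k) t) - u t" for k]
      by (auto simp: pmass_minus_commute[of p u] intro!: always_eventually less_imp_le)
    have "(\<lambda>k. 1 / real (Suc k)) \<longlonglongrightarrow> 0" by (rule LIMSEQ_Suc[OF lim_1_over_n])
    then show "(\<lambda>k. ennreal (1 / real (Suc k))) \<longlonglongrightarrow> 0" using tendsto_ennrealI by fastforce
  qed auto
  have lim2: "(\<lambda>k. fourier_coeff (\<lambda>t. complex_of_real (Re (poly (q k) t))) n) \<longlonglongrightarrow> fourier_coeff (\<lambda>t. complex_of_real (u t)) n" for n
    by (rule fourier_coeff_tendsto[OF Rq u p0(3) lim0])
  define c where "c = fourier_coeff (\<lambda>t. complex_of_real (u t)) 0"
  have neg: "fourier_coeff g n = 0" if "n < 0" for n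
    using lim1[of n] that by (simp add: fourier_coeff_poly LIMSEQ_const_iff)
  \<comment> \<open>The real part of a polynomial carries half of each coefficient of positive
    index; at index 0 the normalization makes the coefficient itself appear.\<close>
  have pos: "fourier_coeff g n = 2 * fourier_coeff (\<lambda>t. complex_of_real (u t)) n" if "0 < n" for n
  proof (rule LIMSEQ_unique[OF lim1])
    have "fourier_coeff (poly (q k)) n = 2 * fourier_coeff (\<lambda>t. complex_of_real (Re (poly (q k) t))) n" for k
      unfolding fourier_coeff_Re_poly using that by (simp add: fourier_coeff_poly)
    then show "(\<lambda>k. fourier_coeff (poly (q k)) n) \<longlonglongrightarrow> 2 * fourier_coeff (\<lambda>t. complex_of_real (u t)) n"
      using tendsto_mult_left[OF lim2, of 2 n] by simp
  qed
  have zero: "fourier_coeff g 0 = c"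
    unfolding c_def
  proof (rule LIMSEQ_unique[OF lim1])
    have "fourier_coeff (poly (q k)) 0 = fourier_coeff (\<lambda>t. complex_of_real (Re (poly (q k) t))) 0" for k
      unfolding fourier_coeff_Re_poly using q(1)[of k] by (simp add: fourier_coeff_poly complex_eq_iff poly_0_coeff_0)
    then show "(\<lambda>k. fourier_coeff (poly (q k)) 0) \<longlonglongrightarrow> fourier_coeff (\<lambda>t. complex_of_real (u t)) 0"
      using lim2[of 0] by simp
  qed
  show ?thesis
  \<comment> \<open>g has coefficients c at 0 and twice those of u at positive indices; adding c and
    halving corrects both.\<close>
  proof (rule that[of "\<lambda>t. (1/2) * (g t + c)" "\<lambda>k. smult (1/2) (q k + [:c:])"])
    have cL: "(\<lambda>t. c) \<in> Lp p" by (rule Lp_continuous[OF _ p0(2)]) simp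
    show "(\<lambda>t. (1/2) * (g t + c)) \<in> Lp p" by (intro Lp_cmult Lp_add g(1) cL p0)
    have [measurable]: "g \<in> borel_measurable circle" by (rule Lp_measurable[OF g(1)])
    have "pmass p (\<lambda>t. poly (smult (1/2) (q k + [:c:])) t - (1/2) * (g t + c)) = ennreal (norm (1/2::complex) powr p) * pmass p (\<lambda>t. poly (q k) t - g t)" for k
    proof -
      have "pmass p (\<lambda>t. poly (smult (1/2) (q k + [:c:])) t - (1/2) * (g t + c)) = pmass p (\<lambda>t. (1/2) * (poly (q k) t - g t))"
        by (intro pmass_cong) (simp add: field_simps)
      also have "\<dots> = ennreal (norm (1/2::complex) powr p) * pmass p (\<lambda>t. poly (q k) t - g t)"
        by (rule pmass_cmult) measurable
      finally show ?thesis .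
    qed
    moreover have "(\<lambda>k. ennreal (norm (1/2::complex) powr p) * pmass p (\<lambda>t. poly (q k) t - g t)) \<longlonglongrightarrow> ennreal (norm (1/2::complex) powr p) * 0"
      by (intro ennreal_tendsto_cmult g(2)) simp
    ultimately show "(\<lambda>k. pmass p (\<lambda>t. poly (smult (1/2) (q k + [:c:])) t - (1/2) * (g t + c))) \<longlonglongrightarrow> 0"
      by simp
    fix n
    have fc: "fourier_coeff (\<lambda>t. c) n = (if n = 0 then c else 0)"
      using fourier_coeff_cmult[of c "\<lambda>t. t powi 0" n] fourier_coeff_monom[of 0 n] by simp
    have eq: "fourier_coeff (\<lambda>t. (1/2) * (g t + c)) n = (fourier_coeff g n + (if n = 0 then c else 0)) / 2"
      unfolding fourier_coeff_cmult fourier_coeff_add[OF Lp_imp_integrable[OF g(1) p0(3)] Lp_imp_integrable[OF cL p0(3)]] fc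
      by simp
    show "fourier_coeff (\<lambda>t. (1/2) * (g t + c)) n = (if 0 \<le> n then fourier_coeff (\<lambda>t. complex_of_real (u t)) n else 0)"
      unfolding eq using neg[of n] pos[of n] zero c_def
      by (cases n "0::int" rule: linorder_cases) simp_all
  qed
qed

lemma riesz_exists:
  assumes p: "1 < p" and f: "f \<in> Lp p"
  obtains g r where "g \<in> Lp p" "(\<lambda>k. pmass p (\<lambda>t. poly (r k) t - g t)) \<longlonglongrightarrow> 0"
    "\<And>n. fourier_coeff g n = (if 0 \<le> n then fourier_coeff f n else 0)"
proof -
  have p0: "0 < p" "0 \<le> p" "1 \<le> p" using p by auto
  have [measurable]: "f \<in> borel_measurable circle" by (rule Lp_measurable[OF f])
  have R: "(\<lambda>t. complex_of_real (Re (f t))) \<in> Lp p" and I: "(\<lambda>t. complex_of_real (Im (f t))) \<in> Lp p"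
    by (rule Lp_dominated[OF f p0(2), where C = 1]; simp add: abs_Re_le_cmod abs_Im_le_cmod)+
  obtain g r where g: "g \<in> Lp p" "(\<lambda>k. pmass p (\<lambda>t. poly (r k) t - g t)) \<longlonglongrightarrow> 0"
    "\<And>n. fourier_coeff g n = (if 0 \<le> n then fourier_coeff (\<lambda>t. complex_of_real (Re (f t))) n else 0)"
    using riesz_real[OF p R] by blast
  obtain h s where h: "h \<in> Lp p" "(\<lambda>k. pmass p (\<lambda>t. poly (s k) t - h t)) \<longlonglongrightarrow> 0"
    "\<And>n. fourier_coeff h n = (if 0 \<le> n then fourier_coeff (\<lambda>t. complex_of_real (Im (f t))) n else 0)"
    using riesz_real[OF p I] by blast
  note [measurable] = Lp_measurable[OF g(1)] Lp_measurable[OF h(1)]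
  note int = Lp_imp_integrable[OF _ p0(3)]
  have ih: "(\<lambda>t. \<i> * h t) \<in> Lp p" "(\<lambda>t. \<i> * complex_of_real (Im (f t))) \<in> Lp p"
    by (intro Lp_cmult h(1) I p0)+
  show ?thesis
  proof (rule that[of "\<lambda>t. g t + \<i> * h t" "\<lambda>k. r k + smult \<i> (s k)"])
    show "(\<lambda>t. g t + \<i> * h t) \<in> Lp p" by (intro Lp_add g(1) ih p0)
    fix n
    have "fourier_coeff f n = fourier_coeff (\<lambda>t. complex_of_real (Re (f t)) + \<i> * complex_of_real (Im (f t))) n"
      by (simp flip: complex_eq)
    also have "\<dots> = fourier_coeff (\<lambda>t. complex_of_real (Re (f t))) n + \<i> * fourier_coeff (\<lambda>t. complex_of_real (Im (f t))) n"
      by (simp only: fourier_coeff_add[OF int[OF R] int[OF ih(2)]] fourier_coeff_cmult)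
    finally show "fourier_coeff (\<lambda>t. g t + \<i> * h t) n = (if 0 \<le> n then fourier_coeff f n else 0)"
      using g(3)[of n] h(3)[of n] by (simp add: fourier_coeff_add[OF int[OF g(1)] int[OF ih(1)]] fourier_coeff_cmult)
  next
    have le: "pmass p (\<lambda>t. poly (r k + smult \<i> (s k)) t - (g t + \<i> * h t)) \<le>
        ennreal (2 powr p) * (pmass p (\<lambda>t. poly (r k) t - g t) + pmass p (\<lambda>t. poly (s k) t - h t))" for k
    proof -
      have "pmass p (\<lambda>t. poly (r k + smult \<i> (s k)) t - (g t + \<i> * h t)) =
          pmass p (\<lambda>t. (poly (r k) t - g t) + \<i> * (poly (s k) t - h t))"
        by (simp add: algebra_simps)
      also have "\<dots> \<le> ennreal (2 powr p) * (pmass p (\<lambda>t. poly (r k) t - g t) + pmass p (\<lambda>t. \<i> * (poly (s k) t - h t)))"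
        using p0 by (intro pmass_add) auto
      also have "pmass p (\<lambda>t. \<i> * (poly (s k) t - h t)) = pmass p (\<lambda>t. poly (s k) t - h t)"
        by (subst pmass_cmult) auto
      finally show ?thesis .
    qed
    have "(\<lambda>k. ennreal (2 powr p) * (pmass p (\<lambda>t. poly (r k) t - g t) + pmass p (\<lambda>t. poly (s k) t - h t))) \<longlonglongrightarrow> ennreal (2 powr p) * (0 + 0)"
      by (intro ennreal_tendsto_cmult tendsto_add g(2) h(2)) simp
    then show "(\<lambda>k. pmass p (\<lambda>t. poly (r k + smult \<i> (s k)) t - (g t + \<i> * h t))) \<longlonglongrightarrow> 0"
      using le by (intro tendsto_sandwich[where f = "\<lambda>_. 0"
          and g = "\<lambda>k. pmass p (\<lambda>t. poly (r k + smult \<i> (s k)) t - (g t + \<i> * h t))"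
          and h = "\<lambda>k. ennreal (2 powr p) * (pmass p (\<lambda>t. poly (r k) t - g t) + pmass p (\<lambda>t. poly (s k) t - h t))"]) auto
  qed
qed

text \<open>Everything that follows uses only these two properties of the chosen
  representative.\<close>

lemma riesz_P:
  assumes p: "1 < p" and f: "f \<in> Lp p"
  shows riesz_P_Lp: "riesz_P p f \<in> Lp p"
    and fourier_coeff_riesz_P: "fourier_coeff (riesz_P p f) n = (if 0 \<le> n then fourier_coeff f n else 0)"
proof -
  have "\<exists>g. g \<in> Lp p \<and> (\<forall>n. fourier_coeff g n = (if n \<ge> 0 then fourier_coeff f n else 0))"
    using riesz_exists[OF p f] by metis
  from someI_ex[OF this]
  show "riesz_P p f \<in> Lp p" "fourier_coeff (riesz_P p f) n = (if 0 \<le> n then fourier_coeff f n else 0)"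
    unfolding riesz_P_def by auto
qed

lemma Lp_AE_eq_if_fourier_coeff_eq:
  assumes "f \<in> Lp p" "g \<in> Lp p" "1 \<le> p" "\<And>n. fourier_coeff f n = fourier_coeff g n"
  shows "AE t in circle. f t = g t"
proof -
  note i = Lp_imp_integrable[OF assms(1,3)] Lp_imp_integrable[OF assms(2,3)]
  have "AE t in circle. f t - g t = 0"
    by (rule fourier_coeff_eq_0_imp_AE) (use i in \<open>simp_all add: fourier_coeff_diff assms(4)\<close>)
  then show ?thesis by simp
qed

text \<open>The polynomials constructed together with the projection of f approximate f itself,
  since f in \<open>Hp\<close> agrees almost everywhere with its projection.\<close>

lemma Hp_poly_dense:
  assumes p: "1 < p" and f: "f \<in> Hp p"
  obtains r where "(\<lambda>k. pmass p (\<lambda>t. poly (r k) t - f t)) \<longlonglongrightarrow> 0"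
proof -
  have fL: "f \<in> Lp p" using f by (simp add: Hp_def)
  obtain g r where g: "g \<in> Lp p" "(\<lambda>k. pmass p (\<lambda>t. poly (r k) t - g t)) \<longlonglongrightarrow> 0"
    "\<And>n. fourier_coeff g n = (if 0 \<le> n then fourier_coeff f n else 0)"
    using riesz_exists[OF p fL] by blast
  have "AE t in circle. g t = f t"
    by (rule Lp_AE_eq_if_fourier_coeff_eq[OF g(1) fL]) (use p f g(3) in \<open>auto simp: Hp_def\<close>)
  then have "pmass p (\<lambda>t. poly (r k) t - g t) = pmass p (\<lambda>t. poly (r k) t - f t)" for k
    by (intro pmass_cong_AE) (auto elim: eventually_mono)
  then show ?thesis using g(2) by (intro that[of r]) simp
qed

section \<open>The Carleman shift\<close>

lemma integrable_mult_Linf: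
  assumes f: "integrable circle f" and m: "m \<in> Linf"
  shows "integrable circle (\<lambda>t. f t * m t)"
proof -
  obtain C where C: "AE t in circle. norm (m t) \<le> C" using m by (auto simp: Linf_def)
  show ?thesis
  proof (rule Bochner_Integration.integrable_bound)
    show "integrable circle (\<lambda>t. of_real C * f t)" using f by simp
    show "(\<lambda>t. f t * m t) \<in> borel_measurable circle"
      using f m by (auto simp: Linf_def intro: borel_measurable_times)
    show "AE t in circle. norm (f t * m t) \<le> norm (of_real C * f t)"
      using C by eventually_elim
        (simp add: norm_mult, metis abs_ge_self mult.commute mult_left_mono norm_ge_zero order_trans)
  qed
qed

lemma norm_fourier_coeff_le: "norm (fourier_coeff f n) \<le> (LINT t|circle. norm (f t))"
proof -
  have "norm (fourier_coeff f n) \<le> (LINT t|circle. norm (f t * t powi - n))"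
    unfolding fourier_coeff_def by (rule integral_norm_bound)
  also have "\<dots> = (LINT t|circle. norm (f t))"
    by (rule Bochner_Integration.integral_cong) (simp_all add: in_space_circle_iff norm_mult norm_power_int)
  finally show ?thesis .
qed

lemma eq_0_if_geometric_bounded:
  fixes b x :: complex
  assumes b: "1 < norm b" and bd: "\<And>k::nat. norm (b ^ k * x) \<le> C"
  shows "x = 0"
proof (rule ccontr)
  assume "x \<noteq> 0"
  then have x: "0 < norm x" by simp
  obtain k where "C / norm x < norm b ^ k" using real_arch_pow[OF b] by blast
  then have "C < norm (b ^ k * x)" using x by (simp add: norm_mult norm_power field_simps)
  then show False using bd[of k] by simp
qed

text \<open>Up to a power of t this is the Hardy space of exponent 1, and
  \<open>coeffs_vanish_from\<close> is its coanalytic counterpart. Integrability alone is required,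
  so rational factors can be treated without reference to p, and the integer threshold records their
  degrees.\<close>

definition coeffs_vanish_below :: "int \<Rightarrow> (complex \<Rightarrow> complex) \<Rightarrow> bool" where
  "coeffs_vanish_below N f \<longleftrightarrow> integrable circle f \<and> (\<forall>n<N. fourier_coeff f n = 0)"

definition coeffs_vanish_from :: "int \<Rightarrow> (complex \<Rightarrow> complex) \<Rightarrow> bool" where
  "coeffs_vanish_from N f \<longleftrightarrow> integrable circle f \<and> (\<forall>n\<ge>N. fourier_coeff f n = 0)"

lemma integrable_cong_circle:
  assumes "\<And>t. norm t = 1 \<Longrightarrow> f t = g t"
  shows "integrable circle f \<longleftrightarrow> integrable circle g"
  by (rule Bochner_Integration.integrable_cong) (use assms in \<open>auto simp: in_space_circle_iff\<close>)

lemma coeffs_vanish_from_cong: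
  assumes "\<And>t. norm t = 1 \<Longrightarrow> f t = g t"
  shows "coeffs_vanish_from N f \<longleftrightarrow> coeffs_vanish_from N g"
  unfolding coeffs_vanish_from_def using integrable_cong_circle[OF assms] fourier_coeff_cong[OF assms] by simp

lemma fourier_coeff_mult_linear:
  assumes f: "integrable circle f"
  shows "fourier_coeff (\<lambda>t. f t * (c * t - d)) n = c * fourier_coeff f (n - 1) - d * fourier_coeff f n"
proof -
  have i: "integrable circle (\<lambda>t. t powi 1 * f t)"
    using integrable_mult_powi[OF f, of 1] by (simp add: mult.commute)
  have "fourier_coeff (\<lambda>t. f t * (c * t - d)) n = fourier_coeff (\<lambda>t. c * (t powi 1 * f t) - d * f t) n"
    by (rule fourier_coeff_cong) (simp add: algebra_simps)
  also have "\<dots> = c * fourier_coeff f (n - 1) - d * fourier_coeff f n"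
    using i f by (subst fourier_coeff_diff) (simp_all only: fourier_coeff_cmult fourier_coeff_mult_powi integrable_mult_right)
  finally show ?thesis .
qed

lemma linear_Linf: "(\<lambda>t. c * t - d) \<in> Linf"
  by (rule Linf_continuous) (intro continuous_intros)

lemma coeffs_vanish_below_powi: "coeffs_vanish_below n (\<lambda>t. t powi n)"
  by (simp add: coeffs_vanish_below_def integrable_powi fourier_coeff_monom)

lemma coeffs_vanish_from_powi: "coeffs_vanish_from (n + 1) (\<lambda>t. t powi n)"
  by (simp add: coeffs_vanish_from_def integrable_powi fourier_coeff_monom)

lemma coeffs_vanish_below_mult:
  assumes "coeffs_vanish_below N f"
  shows "coeffs_vanish_below N (\<lambda>t. f t * (c * t - d))"
  using assms integrable_mult_Linf[OF _ linear_Linf]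
  by (auto simp: coeffs_vanish_below_def fourier_coeff_mult_linear)

lemma coeffs_vanish_from_mult:
  assumes "coeffs_vanish_from N f"
  shows "coeffs_vanish_from (N + 1) (\<lambda>t. f t * (c * t - d))"
  using assms integrable_mult_Linf[OF _ linear_Linf]
  by (auto simp: coeffs_vanish_from_def fourier_coeff_mult_linear)

text \<open>The modulus of the derivative of \<alpha> on the circle; equally, the Poisson kernel at
  the point 1 / cnj \<beta> of the disc.\<close>

definition shift_weight :: "complex \<Rightarrow> complex \<Rightarrow> real" where
  "shift_weight \<beta> t = ((norm \<beta>)\<^sup>2 - 1) / (norm (cnj \<beta> * t - 1))\<^sup>2"

definition weighted_shift :: "complex \<Rightarrow> nat \<Rightarrow> (complex \<Rightarrow> complex) \<Rightarrow> complex \<Rightarrow> complex" where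
  "weighted_shift \<beta> e f t = inverse (chi \<beta> t) ^ e * f (shift \<beta> t)"

context
  fixes \<beta> :: complex
  assumes beta: "1 < norm \<beta>"
begin

lemma t_minus_beta_nz: "norm t = 1 \<Longrightarrow> t - \<beta> \<noteq> 0"
  using beta by auto

lemma cnj_beta_t_nz: "norm t = 1 \<Longrightarrow> cnj \<beta> * t - 1 \<noteq> 0"
proof
  assume "norm t = 1" "cnj \<beta> * t - 1 = 0"
  then have "norm (cnj \<beta> * t) = 1" by simp
  then show False using \<open>norm t = 1\<close> beta by (simp add: norm_mult)
qed

lemma div_Linf:
  "(\<lambda>t. inverse (t - \<beta>)) \<in> Linf" "(\<lambda>t. inverse (cnj \<beta> * t - 1)) \<in> Linf"
  by (rule Linf_continuous; intro continuous_intros; use t_minus_beta_nz cnj_beta_t_nz in force)+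

text \<open>The coefficients of \<open>f / (t - \<beta>)\<close> with index below \<open>N\<close> grow geometrically unless they are zero, but are
  bounded.\<close>

lemma coeffs_vanish_below_divide:
  assumes f: "coeffs_vanish_below N f"
  shows "coeffs_vanish_below N (\<lambda>t. f t * inverse (t - \<beta>))"
proof -
  define g where "g t = f t * inverse (t - \<beta>)" for t
  have fi: "integrable circle f" using f by (simp add: coeffs_vanish_below_def)
  have gi: "integrable circle g" unfolding g_def by (rule integrable_mult_Linf[OF fi div_Linf(1)])
  have "fourier_coeff f n = fourier_coeff (\<lambda>t. g t * (1 * t - \<beta>)) n" for n
    using t_minus_beta_nz by (intro fourier_coeff_cong) (simp add: g_def)
  then have rec: "fourier_coeff f n = fourier_coeff g (n - 1) - \<beta> * fourier_coeff g n" for n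
    unfolding fourier_coeff_mult_linear[OF gi] by simp
  have "fourier_coeff g n = 0" if n: "n < N" for n
  proof (rule eq_0_if_geometric_bounded[OF beta])
    fix k :: nat
    have "fourier_coeff g (n - int k) = \<beta> ^ k * fourier_coeff g n"
    proof (induction k)
      case (Suc k)
      have "fourier_coeff f (n - int k) = 0" using f n by (auto simp: coeffs_vanish_below_def)
      then show ?case using rec[of "n - int k"] Suc.IH by (simp add: algebra_simps)
    qed simp
    then show "norm (\<beta> ^ k * fourier_coeff g n) \<le> (LINT t|circle. norm (g t))"
      using norm_fourier_coeff_le by metis
  qed
  then show ?thesis using gi by (simp add: coeffs_vanish_below_def g_def[abs_def])
qed

text \<open>The mirror image at infinity: the pole 1 / cnj \<beta> lies inside the disc, so the
  quotient 1 / (cnj \<beta> * t - 1) has only negative powers, starting with index -1, and the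
  threshold drops by one. The geometric growth now runs towards increasing indices.\<close>

lemma coeffs_vanish_from_divide:
  assumes f: "coeffs_vanish_from N f"
  shows "coeffs_vanish_from (N - 1) (\<lambda>t. f t * inverse (cnj \<beta> * t - 1))"
proof -
  define g where "g t = f t * inverse (cnj \<beta> * t - 1)" for t
  have fi: "integrable circle f" using f by (simp add: coeffs_vanish_from_def)
  have gi: "integrable circle g" unfolding g_def by (rule integrable_mult_Linf[OF fi div_Linf(2)])
  have "fourier_coeff f n = fourier_coeff (\<lambda>t. g t * (cnj \<beta> * t - 1)) n" for n
    using cnj_beta_t_nz by (intro fourier_coeff_cong) (simp add: g_def)
  then have rec: "fourier_coeff f n = cnj \<beta> * fourier_coeff g (n - 1) - fourier_coeff g n" for n
    unfolding fourier_coeff_mult_linear[OF gi] by simp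
  have "fourier_coeff g n = 0" if n: "n \<ge> N - 1" for n
  proof (rule eq_0_if_geometric_bounded)
    show "1 < norm (cnj \<beta>)" using beta by simp
    fix k :: nat
    have "fourier_coeff g (n + int k) = cnj \<beta> ^ k * fourier_coeff g n"
    proof (induction k)
      case (Suc k)
      have "fourier_coeff f (n + int k + 1) = 0" using f n by (auto simp: coeffs_vanish_from_def)
      then show ?case using rec[of "n + int k + 1"] Suc.IH by (simp add: algebra_simps)
    qed simp
    then show "norm (cnj \<beta> ^ k * fourier_coeff g n) \<le> (LINT t|circle. norm (g t))"
      using norm_fourier_coeff_le by metis
  qed
  then show ?thesis using gi by (simp add: coeffs_vanish_from_def g_def[abs_def])
qed

lemma coeffs_vanish_below_rational:
  assumes f: "coeffs_vanish_below N f" and b: "0 \<le> b"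
  shows "coeffs_vanish_below N (\<lambda>t. f t * (t - \<beta>) powi a * (cnj \<beta> * t - 1) powi b)"
proof -
  have 1: "coeffs_vanish_below N (\<lambda>t. f t * (t - \<beta>) ^ k)" for k
  proof (induction k)
    case (Suc k)
    then show ?case using coeffs_vanish_below_mult[OF Suc, of 1 \<beta>] by (simp add: ac_simps)
  qed (use f in simp)
  have 2: "coeffs_vanish_below N (\<lambda>t. f t * inverse (t - \<beta>) ^ k)" for k
  proof (induction k)
    case (Suc k)
    then show ?case using coeffs_vanish_below_divide[OF Suc] by (simp add: ac_simps)
  qed (use f in simp)
  have 3: "coeffs_vanish_below N (\<lambda>t. f t * (t - \<beta>) powi a)"
    using 1[of "nat a"] 2[of "nat (- a)"] by (cases "a \<ge> 0") (simp_all add: power_int_def)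
  have "coeffs_vanish_below N (\<lambda>t. f t * (t - \<beta>) powi a * (cnj \<beta> * t - 1) ^ k)" for k
  proof (induction k)
    case (Suc k)
    then show ?case using coeffs_vanish_below_mult[OF Suc, of "cnj \<beta>" 1] by (simp add: ac_simps)
  qed (use 3 in simp)
  from this[of "nat b"] show ?thesis using b by (simp add: power_int_def)
qed

text \<open>Outside the disc the roles of the two factors are exchanged, and the threshold moves by
  the order a + b of the product at infinity.\<close>

lemma coeffs_vanish_from_rational:
  assumes f: "coeffs_vanish_from N f" and a: "0 \<le> a"
  shows "coeffs_vanish_from (N + a + b) (\<lambda>t. f t * (t - \<beta>) powi a * (cnj \<beta> * t - 1) powi b)"
proof -
  have 1: "coeffs_vanish_from (N + int k) (\<lambda>t. f t * (cnj \<beta> * t - 1) ^ k)" for k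
  proof (induction k)
    case (Suc k)
    then show ?case using coeffs_vanish_from_mult[OF Suc, of "cnj \<beta>" 1] by (simp add: ac_simps)
  qed (use f in simp)
  have 2: "coeffs_vanish_from (N - int k) (\<lambda>t. f t * inverse (cnj \<beta> * t - 1) ^ k)" for k
  proof (induction k)
    case (Suc k)
    then show ?case using coeffs_vanish_from_divide[OF Suc] by (simp add: ac_simps algebra_simps)
  qed (use f in simp)
  have 3: "coeffs_vanish_from (N + b) (\<lambda>t. f t * (cnj \<beta> * t - 1) powi b)"
    using 1[of "nat b"] 2[of "nat (- b)"] by (cases "b \<ge> 0") (simp_all add: power_int_def)
  have "coeffs_vanish_from (N + b + int k) (\<lambda>t. f t * (cnj \<beta> * t - 1) powi b * (t - \<beta>) ^ k)" for k
  proof (induction k)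
    case (Suc k)
    then show ?case using coeffs_vanish_from_mult[OF Suc, of 1 \<beta>] by (simp add: ac_simps)
  qed (use 3 in simp)
  from this[of "nat a"] show ?thesis using a by (simp add: power_int_def ac_simps)
qed

section \<open>The involution \<alpha> of the circle and its change of variables\<close>

lemma norm_beta_squared: "1 < (norm \<beta>)\<^sup>2"
  using beta by (intro one_less_power) auto

lemma lam_squared: "lam \<beta> ^ 2 = 1 - \<beta> * cnj \<beta>"
proof -
  have "lam \<beta> ^ 2 = - complex_of_real ((norm \<beta>)\<^sup>2 - 1)"
    using norm_beta_squared by (simp add: lam_def power_mult_distrib flip: of_real_power)
  then show ?thesis using complex_norm_square[of \<beta>] by simp
qed

lemma lam_nz: "lam \<beta> \<noteq> 0"
  using norm_beta_squared by (simp add: lam_def)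

lemma t_minus_beta: "norm t = 1 \<Longrightarrow> t - \<beta> = - t * cnj (cnj \<beta> * t - 1)"
  using complex_norm_square[of t] by (simp add: algebra_simps)

lemma norm_shift: "norm t = 1 \<Longrightarrow> norm (shift \<beta> t) = 1"
proof -
  assume t: "norm t = 1"
  have "norm (t - \<beta>) = norm (cnj \<beta> * t - 1)"
    unfolding t_minus_beta[OF t] norm_mult complex_mod_cnj using t by simp
  then show ?thesis using cnj_beta_t_nz[OF t] by (simp add: shift_def norm_divide)
qed

lemma chi_nz: "norm t = 1 \<Longrightarrow> chi \<beta> t \<noteq> 0"
  using cnj_beta_t_nz lam_nz by (simp add: chi_def)

lemma beta_cnj_nz: "1 - \<beta> * cnj \<beta> \<noteq> 0"
  using lam_squared lam_nz by (metis zero_eq_power2)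

lemma cnj_beta_shift: "norm t = 1 \<Longrightarrow> cnj \<beta> * shift \<beta> t - 1 = (1 - \<beta> * cnj \<beta>) / (cnj \<beta> * t - 1)"
  using cnj_beta_t_nz[of t] by (simp add: shift_def field_simps)

text \<open>This is what the constant \<open>lam \<beta>\<close> is made for: its square equals 1 -
  \<beta> * cnj \<beta>, so the product of chi and chi composed with \<alpha> is 1, and the weighted
  shifts become involutions.\<close>

lemma chi_shift: "norm t = 1 \<Longrightarrow> chi \<beta> (shift \<beta> t) = inverse (chi \<beta> t)"
  using lam_nz by (simp add: chi_def cnj_beta_shift power2_eq_square flip: lam_squared)

lemma shift_shift: "norm t = 1 \<Longrightarrow> shift \<beta> (shift \<beta> t) = t"
proof -
  assume t: "norm t = 1"
  have "shift \<beta> (shift \<beta> t) = (shift \<beta> t - \<beta>) * (cnj \<beta> * t - 1) / (1 - \<beta> * cnj \<beta>)"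
    unfolding shift_def[of \<beta> "shift \<beta> t"] cnj_beta_shift[OF t] by simp
  also have "(shift \<beta> t - \<beta>) * (cnj \<beta> * t - 1) = t * (1 - \<beta> * cnj \<beta>)"
    using cnj_beta_t_nz[OF t] by (simp add: shift_def field_simps)
  finally show ?thesis using beta_cnj_nz by simp
qed

lemma continuous_on_shift: "continuous_on (sphere 0 1) (shift \<beta>)"
  unfolding shift_def by (intro continuous_intros) (use cnj_beta_t_nz in force)

lemma shift_measurable [measurable]: "shift \<beta> \<in> measurable circle circle"
proof -
  have "shift \<beta> \<in> borel_measurable circle"
    by (rule borel_measurable_circle_continuous[OF continuous_on_shift])
  then have "shift \<beta> \<in> measurable circle (restrict_space borel (sphere 0 1))"
    by (rule measurable_restrict_space2[rotated]) (auto simp: space_circle norm_shift)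
  then show ?thesis by (simp cong: measurable_cong_sets add: sets_circle)
qed

lemma shift_weight_nonneg: "0 \<le> shift_weight \<beta> t"
  using norm_beta_squared by (simp add: shift_weight_def)

text \<open>On the circle the conjugate of cnj \<beta> * t - 1 is - (t - \<beta>) / t, which turns
  the squared modulus into a rational function that merges with the other linear factors.\<close>

lemma shift_weight_eq:
  assumes t: "norm t = 1"
  shows "complex_of_real (shift_weight \<beta> t) = lam \<beta> ^ 2 * (t * ((t - \<beta>) powi (-1) * (cnj \<beta> * t - 1) powi (-1)))"
proof -
  have "complex_of_real (shift_weight \<beta> t) = (\<beta> * cnj \<beta> - 1) / ((cnj \<beta> * t - 1) * cnj (cnj \<beta> * t - 1))"
    by (simp add: shift_weight_def complex_norm_square flip: of_real_power)
  also have "\<dots> = lam \<beta> ^ 2 * (t * inverse ((t - \<beta>) * (cnj \<beta> * t - 1)))"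
  proof -
    have "t \<noteq> 0" using t by auto
    then show ?thesis
      unfolding t_minus_beta[OF t] lam_squared using cnj_beta_t_nz[OF t]
      by (simp add: divide_simps del: complex_cnj_diff complex_cnj_mult)
  qed
  finally show ?thesis by (simp add: power_int_minus)
qed

lemma shift_weight_measurable [measurable]: "shift_weight \<beta> \<in> borel_measurable circle"
  unfolding shift_weight_def
  by (intro borel_measurable_circle_continuous continuous_intros) (use cnj_beta_t_nz in force)

lemma integrable_shift_weight: "integrable circle (\<lambda>t. complex_of_real (shift_weight \<beta> t))"
  unfolding shift_weight_def
  by (intro integrable_circle_continuous continuous_intros) (use cnj_beta_t_nz in force)

text \<open>The coefficients of a Poisson kernel are powers of its base point. Partial fractions
  give index 0; clearing the inner pole gives the recursion.\<close>

lemma fourier_coeff_weight_nonpos: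
  "fourier_coeff (\<lambda>t. complex_of_real (shift_weight \<beta> t)) (- int n) = inverse (cnj \<beta>) ^ n"
proof (induction n)
  case 0
  define g where "g t = inverse (t - \<beta>)" for t
  define h where "h t = inverse (cnj \<beta> * t - 1)" for t
  have gi: "integrable circle g" and hi: "integrable circle h"
    using integrable_mult_Linf[OF integrable_powi[of 0] div_Linf(1)] integrable_mult_Linf[OF integrable_powi[of 0] div_Linf(2)]
    by (simp_all add: g_def[abs_def] h_def[abs_def])
  have "coeffs_vanish_below 0 g"
    using coeffs_vanish_below_divide[OF coeffs_vanish_below_powi[of 0]] by (simp add: g_def[abs_def])
  then have g1: "fourier_coeff g (-1) = 0" by (simp add: coeffs_vanish_below_def)
  have "fourier_coeff (\<lambda>t. t powi 0) 0 = fourier_coeff (\<lambda>t. g t * (1 * t - \<beta>)) 0"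
    using t_minus_beta_nz by (intro fourier_coeff_cong) (simp add: g_def)
  then have g0: "1 = - \<beta> * fourier_coeff g 0"
    unfolding fourier_coeff_mult_linear[OF gi] fourier_coeff_monom using g1 by simp
  have "coeffs_vanish_from 0 h"
    using coeffs_vanish_from_divide[OF coeffs_vanish_from_powi[of 0]] by (simp add: h_def[abs_def])
  then have h0: "fourier_coeff h 0 = 0" by (simp add: coeffs_vanish_from_def)
  \<comment> \<open>Partial fractions: the weight is - \<beta> / (t - \<beta>) + 1 / (cnj \<beta> *
    t - 1) on the circle. At index 0 the first quotient contributes 1 and the second 0.\<close>
  have "fourier_coeff (\<lambda>t. complex_of_real (shift_weight \<beta> t)) 0 = fourier_coeff (\<lambda>t. (- \<beta>) * g t + h t) 0"
  proof (rule fourier_coeff_cong)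
    fix t :: complex assume t: "norm t = 1"
    have "(- \<beta>) * g t + h t = (- \<beta> * (cnj \<beta> * t - 1) + (t - \<beta>)) * (inverse (t - \<beta>) * inverse (cnj \<beta> * t - 1))"
      using t_minus_beta_nz[OF t] cnj_beta_t_nz[OF t] by (simp add: g_def h_def field_simps)
    also have "- \<beta> * (cnj \<beta> * t - 1) + (t - \<beta>) = lam \<beta> ^ 2 * t"
      by (simp add: lam_squared algebra_simps)
    finally show "complex_of_real (shift_weight \<beta> t) = (- \<beta>) * g t + h t"
      by (simp add: shift_weight_eq[OF t] power_int_minus)
  qed
  also have "\<dots> = - \<beta> * fourier_coeff g 0 + fourier_coeff h 0"
    using gi hi by (subst fourier_coeff_add) (simp_all only: fourier_coeff_cmult integrable_mult_right)
  also have "\<dots> = 1" using g0 h0 by simp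
  finally show ?case by simp
next
  case (Suc n)
  define w where "w t = complex_of_real (shift_weight \<beta> t)" for t
  have wi: "integrable circle w" unfolding w_def by (rule integrable_shift_weight)
  have g: "coeffs_vanish_below 0 (\<lambda>t. t powi 0 * inverse (t - \<beta>))"
    by (rule coeffs_vanish_below_divide[OF coeffs_vanish_below_powi])
  \<comment> \<open>After multiplication only a constant times t / (t - \<beta>) remains, which has
    no coefficients of index \<le> 0.\<close>
  have "fourier_coeff (\<lambda>t. w t * (cnj \<beta> * t - 1)) (- int n) =
      fourier_coeff (\<lambda>t. lam \<beta> ^ 2 * (t powi 1 * (t powi 0 * inverse (t - \<beta>)))) (- int n)"
  proof (rule fourier_coeff_cong)
    fix t :: complex assume t: "norm t = 1"
    show "w t * (cnj \<beta> * t - 1) = lam \<beta> ^ 2 * (t powi 1 * (t powi 0 * inverse (t - \<beta>)))"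
      using cnj_beta_t_nz[OF t] by (simp add: w_def shift_weight_eq[OF t] power_int_minus)
  qed
  also have "\<dots> = 0"
    unfolding fourier_coeff_cmult fourier_coeff_mult_powi using g by (simp add: coeffs_vanish_below_def)
  finally have "cnj \<beta> * fourier_coeff w (- 1 - int n) = fourier_coeff w (- int n)"
    unfolding fourier_coeff_mult_linear[OF wi] minus_diff_commute[of "int n" 1] by simp
  moreover have "cnj \<beta> \<noteq> 0" using beta by auto
  ultimately have "fourier_coeff w (- int (Suc n)) = inverse (cnj \<beta>) * fourier_coeff w (- int n)"
    by (simp add: field_simps)
  then show ?case using Suc by (simp add: w_def[abs_def])
qed

lemma fourier_coeff_weight_cnj:
  "fourier_coeff (\<lambda>t. complex_of_real (shift_weight \<beta> t)) (- n) =
    cnj (fourier_coeff (\<lambda>t. complex_of_real (shift_weight \<beta> t)) n)"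
  using fourier_coeff_cnj[of "\<lambda>t. complex_of_real (shift_weight \<beta> t)" "- n"] by simp

text \<open>Negative powers of \<alpha> are analytic in the disc and \<alpha> takes the value
  \<beta> at 0. The induction compares consecutive powers: they are g times (t - \<beta>) and g
  times (cnj \<beta> * t - 1) for the same analytic g, so their means are - \<beta> and - 1 times
  the coefficient of g at 0.\<close>

lemma integral_shift_power_nonpos: "(LINT t|circle. shift \<beta> t powi (- int n)) = inverse \<beta> ^ n"
proof (induction n)
  case (Suc n)
  define f where "f t = t powi 0 * (t - \<beta>) powi (- int n) * (cnj \<beta> * t - 1) powi (int n)" for t
  have f: "coeffs_vanish_below 0 f"
    unfolding f_def by (rule coeffs_vanish_below_rational[OF coeffs_vanish_below_powi]) simp
  define g where "g t = f t * inverse (t - \<beta>)" for t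
  have g: "coeffs_vanish_below 0 g" unfolding g_def by (rule coeffs_vanish_below_divide[OF f])
  have gi: "integrable circle g" using g by (simp add: coeffs_vanish_below_def)
  have sf: "shift \<beta> t powi (- int n) = f t" if "norm t = 1" for t
    using t_minus_beta_nz[OF that] cnj_beta_t_nz[OF that]
    by (simp add: f_def shift_def power_int_minus power_divide inverse_eq_divide)
  have sg: "shift \<beta> t powi (- int (Suc n)) = g t * (cnj \<beta> * t - 1)" if "norm t = 1" for t
  proof -
    have "shift \<beta> t powi (- int (Suc n)) = inverse (shift \<beta> t) * inverse (shift \<beta> t) ^ n"
      by (simp only: power_int_minus power_int_of_nat power_inverse power_Suc inverse_mult_distrib)
    also have "inverse (shift \<beta> t) ^ n = f t"
      using sf[OF that] by (simp add: power_int_minus power_inverse)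
    finally show ?thesis by (simp add: g_def shift_def divide_inverse)
  qed
  have "(LINT t|circle. shift \<beta> t powi (- int n)) = fourier_coeff (\<lambda>t. g t * (1 * t - \<beta>)) 0"
    unfolding fourier_coeff_def
    by (rule Bochner_Integration.integral_cong) (use t_minus_beta_nz in \<open>auto simp: sf g_def in_space_circle_iff\<close>)
  also have "\<dots> = - \<beta> * fourier_coeff g 0"
    unfolding fourier_coeff_mult_linear[OF gi] using g by (simp add: coeffs_vanish_below_def)
  finally have 1: "(LINT t|circle. shift \<beta> t powi (- int n)) = - \<beta> * fourier_coeff g 0" .
  have "(LINT t|circle. shift \<beta> t powi (- int (Suc n))) = fourier_coeff (\<lambda>t. g t * (cnj \<beta> * t - 1)) 0"
    unfolding fourier_coeff_def
    by (rule Bochner_Integration.integral_cong) (auto simp only: sg in_space_circle_iff power_int_0_right minus_zero mult_1_right)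
  also have "\<dots> = - fourier_coeff g 0"
    unfolding fourier_coeff_mult_linear[OF gi] using g by (simp add: coeffs_vanish_below_def)
  finally have 2: "(LINT t|circle. shift \<beta> t powi (- int (Suc n))) = - fourier_coeff g 0" .
  have "\<beta> \<noteq> 0" using beta by auto
  then have "- fourier_coeff g 0 = inverse \<beta> * inverse \<beta> ^ n"
    using 1 Suc.IH by (simp add: field_simps)
  with 2 show ?case by simp
qed simp

text \<open>The substitution rule for \<alpha>, obtained by comparing moments of two finite
  measures. The moments of one sign have been computed above, and those of the other sign are their
  conjugates.\<close>

lemma distr_shift: "distr circle circle (shift \<beta>) = density circle (\<lambda>t. ennreal (shift_weight \<beta> t))"
proof (rule measure_eq_of_moments)
  have "finite_measure (distr circle circle (shift \<beta>))"
    by (rule circle.finite_measure_distr) measurable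
  then show "finite_measure (distr circle circle (shift \<beta>))" .
  have "emeasure (density circle (\<lambda>t. ennreal (shift_weight \<beta> t))) (space circle) = (\<integral>\<^sup>+t. ennreal (shift_weight \<beta> t) \<partial>circle)"
    by (subst emeasure_density) (auto intro!: nn_integral_cong)
  also have "\<dots> < \<infinity>"
  proof -
    have "integrable circle (shift_weight \<beta>)"
      unfolding shift_weight_def
      by (intro integrable_circle_continuous continuous_intros) (use cnj_beta_t_nz in force)
    then show ?thesis using shift_weight_nonneg by (simp add: nn_integral_eq_integral)
  qed
  finally show "finite_measure (density circle (\<lambda>t. ennreal (shift_weight \<beta> t)))"
    by (intro finite_measureI) simp
next
  fix n :: int
  have D: "(LINT t|distr circle circle (shift \<beta>). t powi n) = (LINT t|circle. shift \<beta> t powi n)"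
    by (rule integral_distr) measurable
  have W: "(LINT t|density circle (\<lambda>t. ennreal (shift_weight \<beta> t)). t powi n) = fourier_coeff (\<lambda>t. complex_of_real (shift_weight \<beta> t)) (- n)"
    using shift_weight_nonneg
    by (subst integral_density) (auto simp: fourier_coeff_def scaleR_conv_of_real)
  have cnjD: "(LINT t|circle. shift \<beta> t powi n) = cnj (LINT t|circle. shift \<beta> t powi (- n))"
  proof -
    have "(LINT t|circle. shift \<beta> t powi n) = (LINT t|circle. cnj (shift \<beta> t powi (- n)))"
    proof (rule Bochner_Integration.integral_cong[OF refl])
      fix t assume "t \<in> space circle"
      then have "cnj (shift \<beta> t) = inverse (shift \<beta> t)"
        by (intro cnj_eq_inverse norm_shift) (simp add: in_space_circle_iff)
      then show "shift \<beta> t powi n = cnj (shift \<beta> t powi (- n))"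
        by (simp add: power_int_minus power_int_inverse)
    qed
    then show ?thesis by (simp only: Bochner_Integration.integral_cnj)
  qed
  show "(LINT t|distr circle circle (shift \<beta>). t powi n) = (LINT t|density circle (\<lambda>t. ennreal (shift_weight \<beta> t)). t powi n)"
  proof (cases "n \<ge> 0")
    case True
    then obtain k where n: "n = int k" using zero_le_imp_eq_int by blast
    show ?thesis
      unfolding D W unfolding cnjD
      using n integral_shift_power_nonpos[of k] fourier_coeff_weight_nonpos[of k] by simp
  next
    case False
    then have "n = - int (nat (- n))" by simp
    then obtain k where n: "n = - int k" by blast
    show ?thesis
      unfolding D W unfolding n integral_shift_power_nonpos
      using fourier_coeff_weight_cnj[of "- int k"] fourier_coeff_weight_nonpos[of k] by simp
  qed
qed auto

lemma AE_shift:
  assumes "AE t in circle. P t"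
  shows "AE t in circle. P (shift \<beta> t)"
proof (rule AE_distrD[OF shift_measurable])
  show "AE t in distr circle circle (shift \<beta>). P t"
    unfolding distr_shift using assms by (subst AE_density) (auto elim: eventually_mono)
qed

lemma integral_shift:
  assumes [measurable]: "F \<in> borel_measurable circle"
  shows "(LINT t|circle. F (shift \<beta> t)) = (LINT t|circle. complex_of_real (shift_weight \<beta> t) * F t)"
proof -
  have "(LINT t|circle. F (shift \<beta> t)) = (LINT t|distr circle circle (shift \<beta>). F t)"
    by (rule integral_distr[symmetric]) measurable
  also have "\<dots> = (LINT t|circle. complex_of_real (shift_weight \<beta> t) * F t)"
    unfolding distr_shift using shift_weight_nonneg
    by (subst integral_density) (auto simp: scaleR_conv_of_real)
  finally show ?thesis .
qed

lemma Lp_shift: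
  assumes f: "f \<in> Lp p" and p: "0 \<le> p"
  shows "(\<lambda>t. f (shift \<beta> t)) \<in> Lp p"
proof -
  have [measurable]: "f \<in> borel_measurable circle" by (rule Lp_measurable[OF f])
  have w: "shift_weight \<beta> t \<le> ((norm \<beta>)\<^sup>2 - 1) / (norm \<beta> - 1)\<^sup>2" if "norm t = 1" for t
  proof -
    have "norm \<beta> - 1 \<le> norm (cnj \<beta> * t - 1)"
      using norm_triangle_ineq2[of "cnj \<beta> * t" 1] that by (simp add: norm_mult)
    then have "(norm \<beta> - 1)\<^sup>2 \<le> (norm (cnj \<beta> * t - 1))\<^sup>2" using beta by (intro power_mono) auto
    moreover have "0 < (norm \<beta> - 1)\<^sup>2" "0 \<le> (norm \<beta>)\<^sup>2 - 1"
      using beta norm_beta_squared by auto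
    ultimately show ?thesis
      unfolding shift_weight_def using cnj_beta_t_nz[OF that]
      by (intro divide_left_mono mult_pos_pos) auto
  qed
  define C where "C = ((norm \<beta>)\<^sup>2 - 1) / (norm \<beta> - 1)\<^sup>2"
  have "pmass p (\<lambda>t. f (shift \<beta> t)) = (\<integral>\<^sup>+t. ennreal (norm (f t) powr p) \<partial>distr circle circle (shift \<beta>))"
    unfolding pmass_def by (subst nn_integral_distr) auto
  also have "\<dots> = (\<integral>\<^sup>+t. ennreal (shift_weight \<beta> t) * ennreal (norm (f t) powr p) \<partial>circle)"
    unfolding distr_shift by (subst nn_integral_density) auto
  also have "\<dots> \<le> (\<integral>\<^sup>+t. ennreal C * ennreal (norm (f t) powr p) \<partial>circle)"
    using w by (intro nn_integral_mono mult_right_mono ennreal_leI) (auto simp: C_def in_space_circle_iff)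
  also have "\<dots> = ennreal C * pmass p f"
    unfolding pmass_def by (subst nn_integral_cmult) auto
  also have "\<dots> < \<infinity>" using f by (simp add: Lp_iff_pmass ennreal_mult_less_top)
  finally show ?thesis by (simp add: Lp_iff_pmass)
qed

section \<open>Fourier supports under the weighted shift\<close>

lemma inverse_chi_Linf: "(\<lambda>t. inverse (chi \<beta> t)) \<in> Linf"
  unfolding chi_def by (rule Linf_continuous) (intro continuous_intros; use cnj_beta_t_nz lam_nz in force)

lemma inverse_chi_power_Linf: "(\<lambda>t. inverse (chi \<beta> t) ^ e) \<in> Linf"
proof (induction e)
  case 0
  show ?case by (simp add: Linf_continuous)
next
  case (Suc e)
  show ?case using Linf_mult[OF inverse_chi_Linf Suc] by simp
qed

lemma weighted_shift_Lp:
  assumes "f \<in> Lp p" "0 \<le> p"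
  shows "weighted_shift \<beta> e f \<in> Lp p"
  unfolding weighted_shift_def
  by (intro Linf_mult_Lp Lp_shift inverse_chi_power_Linf assms)

lemma weighted_shift_weighted_shift:
  "norm t = 1 \<Longrightarrow> weighted_shift \<beta> e (weighted_shift \<beta> e f) t = f t"
  using chi_nz[of t] by (simp add: weighted_shift_def chi_shift shift_shift flip: mult.assoc power_mult_distrib)

text \<open>Substituting \<alpha> t for t moves the composition from f to the kernel. The exponents
  collect three sources: - n and n from the power of \<alpha>, e from chi, and -1 twice from the
  weight, whose remaining factor t accounts for the index -1.\<close>

lemma fourier_coeff_weighted_shift:
  assumes [measurable]: "f \<in> borel_measurable circle"
  shows "fourier_coeff (weighted_shift \<beta> e f) n = lam \<beta> powi (2 - int e) *
    fourier_coeff (\<lambda>t. f t * (t - \<beta>) powi (- 1 - n) * (cnj \<beta> * t - 1) powi (int e - 1 + n)) (- 1)"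
proof -
  have cm [measurable]: "(\<lambda>t. chi \<beta> t) \<in> borel_measurable circle"
    unfolding chi_def by measurable
  have [measurable]: "shift \<beta> \<in> borel_measurable circle"
    by (rule borel_measurable_circle_continuous[OF continuous_on_shift])
  \<comment> \<open>The integrand is rewritten as a function of \<alpha> t by means of
    \<open>shift_shift\<close> and \<open>chi_shift\<close>.\<close>
  have "fourier_coeff (weighted_shift \<beta> e f) n =
      (LINT t|circle. (\<lambda>s. chi \<beta> s ^ e * f s * shift \<beta> s powi (- n)) (shift \<beta> t))"
    unfolding fourier_coeff_def
    by (rule Bochner_Integration.integral_cong)
       (auto simp: weighted_shift_def in_space_circle_iff chi_shift shift_shift)
  also have "\<dots> = (LINT t|circle. complex_of_real (shift_weight \<beta> t) * (chi \<beta> t ^ e * f t * shift \<beta> t powi (- n)))"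
    by (rule integral_shift) measurable
  also have "\<dots> = (LINT t|circle. lam \<beta> powi (2 - int e) * ((f t * (t - \<beta>) powi (- 1 - n) * (cnj \<beta> * t - 1) powi (int e - 1 + n)) * t powi - (- 1)))"
  proof (rule Bochner_Integration.integral_cong[OF refl])
    fix t assume "t \<in> space circle"
    then have t: "norm t = 1" by (simp add: in_space_circle_iff)
    define u v where "u = t - \<beta>" and "v = cnj \<beta> * t - 1"
    have nz: "u \<noteq> 0" "v \<noteq> 0" "lam \<beta> \<noteq> 0"
      using t_minus_beta_nz[OF t] cnj_beta_t_nz[OF t] lam_nz by (auto simp: u_def v_def)
    have l: "lam \<beta> powi (2 - int e) = lam \<beta> ^ 2 / lam \<beta> ^ e"
      using nz by (simp add: power_int_diff)
    have u: "u powi (- 1 - n) = u powi (- 1) * u powi (- n)"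
      using power_int_add[of u "- 1" "- n"] nz by simp
    have v: "v powi (int e - 1 + n) = v ^ e * v powi (- 1) * v powi n"
      using power_int_add[of v "int e - 1" n] power_int_diff[of v "int e" 1] nz
      by (simp add: power_int_minus divide_inverse)
    have s: "shift \<beta> t powi (- n) = u powi (- n) * v powi n"
      using nz
      by (simp add: shift_def power_int_divide_distrib power_int_minus flip: u_def v_def)
         (simp add: divide_inverse mult.commute)
    have c: "chi \<beta> t ^ e = v ^ e / lam \<beta> ^ e" by (simp add: chi_def power_divide v_def)
    show "complex_of_real (shift_weight \<beta> t) * (chi \<beta> t ^ e * f t * shift \<beta> t powi (- n)) =
      lam \<beta> powi (2 - int e) * ((f t * (t - \<beta>) powi (- 1 - n) * (cnj \<beta> * t - 1) powi (int e - 1 + n)) * t powi - (- 1))"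
      unfolding shift_weight_eq[OF t] s c l u_def[symmetric] v_def[symmetric] u v by simp
  qed
  finally show ?thesis by (simp add: fourier_coeff_def)
qed

lemma weighted_shift_integrable:
  assumes "f \<in> Lp p" "1 \<le> p"
  shows "integrable circle (weighted_shift \<beta> e f)"
  using Lp_imp_integrable[OF weighted_shift_Lp] assms by simp

text \<open>The condition n \<ge> 1 - e says exactly that the exponent e - 1 + n of the factor
  vanishing inside the disc is nonnegative; the product is then analytic and has no coefficient at
  -1.\<close>

lemma coeffs_vanish_from_weighted_shift:
  assumes f: "f \<in> Lp p" "1 \<le> p" "coeffs_vanish_below 0 f"
  shows "coeffs_vanish_from (1 - int e) (weighted_shift \<beta> e f)"
  unfolding coeffs_vanish_from_def
proof (intro conjI allI impI weighted_shift_integrable[OF f(1,2)])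
  fix n assume "1 - int e \<le> n"
  then have "coeffs_vanish_below 0 (\<lambda>t. f t * (t - \<beta>) powi (- 1 - n) * (cnj \<beta> * t - 1) powi (int e - 1 + n))"
    by (intro coeffs_vanish_below_rational f) simp
  then show "fourier_coeff (weighted_shift \<beta> e f) n = 0"
    unfolding fourier_coeff_weighted_shift[OF Lp_measurable[OF f(1)]] by (simp add: coeffs_vanish_below_def)
qed

text \<open>Here n < 0 makes the exponent - 1 - n of t - \<beta> nonnegative, and the three
  contributions to the threshold add up to exactly -1, the index that is read off.\<close>

lemma coeffs_vanish_below_weighted_shift:
  assumes f: "f \<in> Lp p" "1 \<le> p" "coeffs_vanish_from (1 - int e) f"
  shows "coeffs_vanish_below 0 (weighted_shift \<beta> e f)"
  unfolding coeffs_vanish_below_def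
proof (intro conjI allI impI weighted_shift_integrable[OF f(1,2)])
  fix n :: int assume "n < 0"
  then have "coeffs_vanish_from (1 - int e + (- 1 - n) + (int e - 1 + n)) (\<lambda>t. f t * (t - \<beta>) powi (- 1 - n) * (cnj \<beta> * t - 1) powi (int e - 1 + n))"
    by (intro coeffs_vanish_from_rational f) simp
  then show "fourier_coeff (weighted_shift \<beta> e f) n = 0"
    unfolding fourier_coeff_weighted_shift[OF Lp_measurable[OF f(1)]] by (simp add: coeffs_vanish_from_def)
qed

end

section \<open>Functionals on \<open>Hp\<close> and the main argument\<close>

lemma null_funs_iff:
  assumes p: "1 \<le> p"
  shows "f \<in> null_funs \<longleftrightarrow> f \<in> Lp p \<and> (\<forall>n. fourier_coeff f n = 0)"
proof safe
  assume f: "f \<in> null_funs"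
  then have z: "f \<in> borel_measurable circle" "AE t in circle. f t = 0" by (auto simp: null_funs_def)
  show "f \<in> Lp p"
    by (rule Lp_bounded[of _ 0]) (use p z in \<open>auto elim: eventually_mono\<close>)
  fix n
  have "fourier_coeff f n = fourier_coeff (\<lambda>_. 0) n"
    by (rule fourier_coeff_cong_AE) (use z in auto)
  then show "fourier_coeff f n = 0" by (simp add: fourier_coeff_def)
next
  assume "f \<in> Lp p" "\<forall>n. fourier_coeff f n = 0"
  then show "f \<in> null_funs"
    using fourier_coeff_eq_0_imp_AE[OF Lp_imp_integrable[OF _ p]] by (auto simp: null_funs_def Lp_measurable)
qed

lemma Hp_Lp: "f \<in> Hp p \<Longrightarrow> f \<in> Lp p"
  by (simp add: Hp_def)

lemma Hp_iff_coeffs_vanish_below: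
  "1 \<le> p \<Longrightarrow> f \<in> Hp p \<longleftrightarrow> f \<in> Lp p \<and> coeffs_vanish_below 0 f"
  by (auto simp: Hp_def coeffs_vanish_below_def Lp_imp_integrable)

lemma Hp_add_cmult:
  assumes "f \<in> Hp p" "g \<in> Hp p" "1 \<le> p"
  shows "(\<lambda>t. f t + c * g t) \<in> Hp p"
proof -
  have L: "f \<in> Lp p" "(\<lambda>t. c * g t) \<in> Lp p" using assms by (auto simp: Hp_def intro!: Lp_cmult)
  then have "(\<lambda>t. f t + c * g t) \<in> Lp p" using assms(3) by (intro Lp_add) auto
  then show ?thesis
    using assms by (auto simp: Hp_def fourier_coeff_add[OF L[THEN Lp_imp_integrable]] fourier_coeff_cmult)
qed

lemma fourier_coeff_add_cmult:
  assumes "f \<in> Lp p" "g \<in> Lp p" "1 \<le> p"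
  shows "fourier_coeff (\<lambda>t. f t + c * g t) n = fourier_coeff f n + c * fourier_coeff g n"
proof -
  have "(\<lambda>t. c * g t) \<in> Lp p" using assms by (intro Lp_cmult) auto
  then show ?thesis using assms by (simp add: fourier_coeff_add Lp_imp_integrable fourier_coeff_cmult)
qed

lemma Hp_zero: "1 \<le> p \<Longrightarrow> (\<lambda>_. 0) \<in> Hp p"
  using Lp_continuous[of "\<lambda>_. 0" p] by (simp add: Hp_def fourier_coeff_def)

lemma Hp_poly: "1 \<le> p \<Longrightarrow> poly q \<in> Hp p"
  using Lp_poly[of p q] by (simp add: Hp_def fourier_coeff_poly)

lemma riesz_P_Hp: "1 < p \<Longrightarrow> f \<in> Lp p \<Longrightarrow> riesz_P p f \<in> Hp p"
  by (simp add: Hp_def riesz_P_Lp fourier_coeff_riesz_P)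

lemma Lp_norm_eq_pmass: "f \<in> Lp p \<Longrightarrow> Lp_norm p f = enn2real (pmass p f) powr (1 / p)"
  by (simp add: Lp_norm_def pmass_eq_integral)

section \<open>Bounded functionals and their composition with the projection\<close>

context
  fixes p :: real and l :: "(complex \<Rightarrow> complex) \<Rightarrow> complex"
  assumes p: "1 < p" and l: "l \<in> Hp_dual p"
begin

lemma dual_add_cmult: "f \<in> Hp p \<Longrightarrow> g \<in> Hp p \<Longrightarrow> l (\<lambda>t. f t + c * g t) = l f + c * l g"
  using l Hp_add_cmult[OF Hp_zero, of p g c] p by (simp add: Hp_dual_def)

lemma dual_tendsto:
  assumes r: "\<And>k::nat. r k \<in> Hp p" and f: "f \<in> Hp p"
    and lim: "(\<lambda>k. pmass p (\<lambda>t. r k t - f t)) \<longlonglongrightarrow> 0"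
  shows "(\<lambda>k. l (r k)) \<longlonglongrightarrow> l f"
proof -
  obtain C where C: "\<And>f. f \<in> Hp p \<Longrightarrow> norm (l f) \<le> C * Lp_norm p f"
    using l unfolding Hp_dual_def by blast
  have d: "(\<lambda>t. r k t - f t) \<in> Hp p" for k
    using Hp_add_cmult[OF r[of k] f, of "-1"] p by simp
  have eq: "l (r k) - l f = l (\<lambda>t. r k t - f t)" for k
    using dual_add_cmult[OF r[of k] f, of "-1"] by simp
  have "(\<lambda>k. enn2real (pmass p (\<lambda>t. r k t - f t))) \<longlonglongrightarrow> 0"
    using tendsto_enn2real[where l = 0] lim by simp
  then have "(\<lambda>k. enn2real (pmass p (\<lambda>t. r k t - f t)) powr (1 / p)) \<longlonglongrightarrow> 0 powr (1 / p)"
    using p by (intro tendsto_powr2) auto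
  then have "(\<lambda>k. C * Lp_norm p (\<lambda>t. r k t - f t)) \<longlonglongrightarrow> C * 0"
    using p by (intro tendsto_mult_left) (simp add: Lp_norm_eq_pmass[OF Hp_Lp[OF d]])
  then have lim0: "(\<lambda>k. C * Lp_norm p (\<lambda>t. r k t - f t)) \<longlonglongrightarrow> 0" by simp
  have "(\<lambda>k. l (r k) - l f) \<longlonglongrightarrow> 0"
    by (rule Lim_null_comparison[OF always_eventually lim0]) (simp only: eq C[OF d] simp_thms)
  then show ?thesis by (simp add: LIM_zero_iff)
qed

text \<open>Boundedness forces \<open>l\<close> to ignore null sets: if f - g has mass 0, the
  constant sequence f converges to g. The coefficients of negative index agree automatically on
  \<open>Hp\<close>.\<close>

lemma dual_cong:
  assumes f: "f \<in> Hp p" and g: "g \<in> Hp p" and eq: "\<And>n. 0 \<le> n \<Longrightarrow> fourier_coeff f n = fourier_coeff g n"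
  shows "l f = l g"
proof -
  have "fourier_coeff f n = fourier_coeff g n" for n
    using eq[of n] f g by (cases "0 \<le> n") (auto simp: Hp_def)
  then have "AE t in circle. f t = g t"
    using p by (intro Lp_AE_eq_if_fourier_coeff_eq[OF Hp_Lp[OF f] Hp_Lp[OF g]]) auto
  then have "AE t in circle. f t - g t = 0" by simp
  from pmass_cong_AE[OF this, of p] have "pmass p (\<lambda>t. f t - g t) = 0" by (simp add: pmass_const)
  then have "(\<lambda>k::nat. l f) \<longlonglongrightarrow> l g" by (intro dual_tendsto f g) simp
  then show ?thesis by (simp add: LIMSEQ_const_iff)
qed

lemma dual_eq_0_if_monomials:
  assumes m: "\<And>k. l (poly (monom 1 k)) = 0" and f: "f \<in> Hp p"
  shows "l f = 0"
proof -
  have p1: "1 \<le> p" using p by simp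
  have "l (poly q) = 0" for q
  proof -
    have "l (\<lambda>t. \<Sum>i<n. coeff q i * poly (monom 1 i) t) = 0 \<and> (\<lambda>t. \<Sum>i<n. coeff q i * poly (monom 1 i) t) \<in> Hp p" for n
    proof (induction n)
      case 0
      show ?case
        using dual_add_cmult[OF Hp_zero Hp_zero, of "- 1"] Hp_zero[OF p1] p1 by simp
    next
      case (Suc n)
      then show ?case
        using dual_add_cmult[OF _ Hp_poly[OF p1, of "monom 1 n"]] Hp_add_cmult[OF _ Hp_poly[OF p1, of "monom 1 n"] p1] m
        by simp
    qed
    moreover have "poly q = (\<lambda>t. \<Sum>i<Suc (degree q). coeff q i * poly (monom 1 i) t)"
      unfolding fun_eq_iff poly_monom by (simp add: poly_altdef lessThan_Suc_atMost)
    ultimately show ?thesis by metis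
  qed
  moreover obtain r where "(\<lambda>k. pmass p (\<lambda>t. poly (r k) t - f t)) \<longlonglongrightarrow> 0"
    using Hp_poly_dense[OF p f] by blast
  then have "(\<lambda>k. l (poly (r k))) \<longlonglongrightarrow> l f"
    by (intro dual_tendsto Hp_poly[OF p1] f)
  ultimately show ?thesis by (simp add: LIMSEQ_const_iff)
qed

lemma dual_riesz_P_cong:
  assumes "f \<in> Lp p" "g \<in> Lp p" "\<And>n. 0 \<le> n \<Longrightarrow> fourier_coeff f n = fourier_coeff g n"
  shows "l (riesz_P p f) = l (riesz_P p g)"
  using assms p by (intro dual_cong riesz_P_Hp) (auto simp: fourier_coeff_riesz_P)

lemma dual_riesz_P_add_cmult:
  assumes f: "f \<in> Lp p" and g: "g \<in> Lp p"
  shows "l (riesz_P p (\<lambda>t. f t + c * g t)) = l (riesz_P p f) + c * l (riesz_P p g)"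
proof -
  have p1: "1 \<le> p" "0 \<le> p" using p by auto
  have fg: "(\<lambda>t. f t + c * g t) \<in> Lp p" by (intro Lp_add Lp_cmult f g p1)
  note P = riesz_P_Hp[OF p]
  have "l (riesz_P p (\<lambda>t. f t + c * g t)) = l (\<lambda>t. riesz_P p f t + c * riesz_P p g t)"
    by (intro dual_cong P fg Hp_add_cmult f g p1)
       (simp add: fourier_coeff_add_cmult[OF riesz_P_Lp[OF p f] riesz_P_Lp[OF p g] p1(1)]
          fourier_coeff_riesz_P[OF p] fg f g fourier_coeff_add_cmult[OF f g p1(1)])
  also have "\<dots> = l (riesz_P p f) + c * l (riesz_P p g)" by (rule dual_add_cmult[OF P[OF f] P[OF g]])
  finally show ?thesis .
qed

text \<open>The functions f and f - f have the same coefficients of index \<ge> 0, so l (P f) equals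
  l (P f) - l (P f).\<close>

lemma dual_riesz_P_eq_0:
  assumes "f \<in> Lp p" "\<And>n. 0 \<le> n \<Longrightarrow> fourier_coeff f n = 0"
  shows "l (riesz_P p f) = 0"
  using dual_riesz_P_cong[OF assms(1,1)] dual_riesz_P_add_cmult[OF assms(1,1), of "-1"]
    dual_riesz_P_cong[OF assms(1), of "\<lambda>t. f t + (-1) * f t"] assms p
    Lp_continuous[of "\<lambda>_. 0" p] by (simp add: fourier_coeff_def)

end

section \<open>The alternative for a general admissible pair (e, s)\<close>

lemma coeffs_vanish_from_mono: "coeffs_vanish_from M f \<Longrightarrow> M \<le> N \<Longrightarrow> coeffs_vanish_from N f"
  by (auto simp: coeffs_vanish_from_def)

context
  fixes p :: real and \<beta> :: complex and e :: nat and s :: complex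
  assumes p: "1 < p" and beta: "1 < norm \<beta>"
    and es: "e = 0 \<and> s = 1 \<or> e = 1 \<and> (s = 1 \<or> s = - 1) \<or> e = 2 \<and> s = - 1"
begin

private abbreviation "K \<equiv> weighted_shift \<beta> e"

lemma s_squared: "s * s = 1"
  using es by auto

lemma p_ge: "1 \<le> p" "0 \<le> p"
  using p by auto

lemma K_Lp: "f \<in> Lp p \<Longrightarrow> K f \<in> Lp p"
  by (rule weighted_shift_Lp[OF beta _ p_ge(2)])

lemma K_K: "norm t = 1 \<Longrightarrow> K (K f) t = f t"
  by (rule weighted_shift_weighted_shift[OF beta])

lemma K_cmult: "K (\<lambda>t. c * f t) t = c * K f t"
  by (simp add: weighted_shift_def)

text \<open>If f = - s K f, then f has coefficients only at indices 0 \<le> n < 1 - e. There are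
  none for e \<ge> 1; for e = 0 only a constant c survives, and s = 1 turns the equation into c + c
  = 0.\<close>

lemma plus_K_injective:
  assumes f: "f \<in> Hp p" and z: "AE t in circle. f t + s * K f t = 0"
  shows "f \<in> null_funs"
proof -
  have fL: "f \<in> Lp p" and fb: "coeffs_vanish_below 0 f"
    using f Hp_iff_coeffs_vanish_below[OF p_ge(1)] by auto
  note [measurable] = Lp_measurable[OF fL] Lp_measurable[OF K_Lp[OF fL]]
  have Kf: "coeffs_vanish_from (1 - int e) (K f)"
    by (rule coeffs_vanish_from_weighted_shift[OF beta fL p_ge(1) fb])
  have "AE t in circle. f t = (- s) * K f t"
    using z by eventually_elim (simp add: eq_neg_iff_add_eq_0)
  then have "fourier_coeff f n = - s * fourier_coeff (K f) n" for n
    unfolding fourier_coeff_cmult[symmetric] by (intro fourier_coeff_cong_AE) auto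
  then have from1: "fourier_coeff f n = 0" if "1 - int e \<le> n" for n
    using Kf that by (simp add: coeffs_vanish_from_def)
  have neg: "fourier_coeff f n = 0" if "n < 0" for n
    using f that by (simp add: Hp_def)
  show ?thesis
  proof (cases "e = 0")
    case False
    then have "fourier_coeff f n = 0" for n
      using from1[of n] neg[of n] by (cases "n < 0") auto
    then show ?thesis using fL by (simp add: null_funs_iff[OF p_ge(1)])
  next
    case True
    then have e: "e = 0" "s = 1" using es by auto
    define c where "c = fourier_coeff f 0"
    have cL: "(\<lambda>_. c) \<in> Lp p" by (rule Lp_continuous[OF _ p_ge(2)]) simp
    have fc: "fourier_coeff (\<lambda>t. d) n = (if n = 0 then d else 0)" for d n
      using fourier_coeff_cmult[of d "\<lambda>t. t powi 0" n] fourier_coeff_monom[of 0 n] by simp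
    have fc_AE: "AE t in circle. f t = c"
    proof (rule Lp_AE_eq_if_fourier_coeff_eq[OF fL cL p_ge(1)])
      show "fourier_coeff f n = fourier_coeff (\<lambda>_. c) n" for n
        unfolding fc using from1[of n] neg[of n] e by (cases n "0::int" rule: linorder_cases) (auto simp: c_def)
    qed
    then have "AE t in circle. f t = c \<and> f (shift \<beta> t) = c"
      using AE_shift[OF beta fc_AE] by eventually_elim simp
    then have "AE t in circle. c + c = 0"
      using z by eventually_elim (auto simp: e weighted_shift_def)
    then have "fourier_coeff (\<lambda>t. c + c) 0 = fourier_coeff (\<lambda>t. 0) 0"
      by (intro fourier_coeff_cong_AE) auto
    then have "c = 0" unfolding fc by simp
    then have "fourier_coeff f n = 0" for n
      using from1[of n] neg[of n] e by (cases n "0::int" rule: linorder_cases) (auto simp: c_def)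
    then show ?thesis using fL by (simp add: null_funs_iff[OF p_ge(1)])
  qed
qed

text \<open>A functional that is invariant under \<open>s K\<close> and vanishes on \<open>Hp\<close> vanishes on \<open>Lp = Hp + K Hp\<close>;
  for \<open>e = 2\<close> the sum misses one dimension, which is spanned by \<open>1 / chi\<close>, an eigenvector
  of \<open>s K\<close> for the eigenvalue \<open>-1\<close>.\<close>

lemma invariant_functional_eq_0:
  fixes \<Omega> :: "(complex \<Rightarrow> complex) \<Rightarrow> complex"
  assumes lin: "\<And>f g c. f \<in> Lp p \<Longrightarrow> g \<in> Lp p \<Longrightarrow> \<Omega> (\<lambda>t. f t + c * g t) = \<Omega> f + c * \<Omega> g"
    and cong: "\<And>f g. f \<in> Lp p \<Longrightarrow> (\<And>t. norm t = 1 \<Longrightarrow> f t = g t) \<Longrightarrow> \<Omega> f = \<Omega> g"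
    and Hp0: "\<And>f. f \<in> Hp p \<Longrightarrow> \<Omega> f = 0"
    and inv: "\<And>f. f \<in> Lp p \<Longrightarrow> \<Omega> (\<lambda>t. s * K f t) = \<Omega> f"
    and f: "f \<in> Lp p"
  shows "\<Omega> f = 0"
proof -
  have zero: "(\<lambda>_. 0) \<in> Lp p" by (rule Lp_continuous[OF _ p_ge(2)]) simp
  have "\<Omega> (\<lambda>t. 0) = 0" using lin[OF zero zero, of "1"] by simp
  then have cm: "\<Omega> (\<lambda>t. c * f t) = c * \<Omega> f" if "f \<in> Lp p" for c f
    using lin[OF zero that, of c] by simp
  \<comment> \<open>K carries such a k into \<open>Hp\<close>, so invariance expresses
    \<open>\<Omega> k\<close> by a value that is already 0.\<close>
  have from1: "\<Omega> k = 0" if k: "k \<in> Lp p" "coeffs_vanish_from (1 - int e) k" for k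
  proof -
    have "coeffs_vanish_below 0 (K k)"
      by (rule coeffs_vanish_below_weighted_shift[OF beta k(1) p_ge(1) k(2)])
    then have "K k \<in> Hp p" using K_Lp[OF k(1)] by (simp add: Hp_iff_coeffs_vanish_below[OF p_ge(1)])
    then show ?thesis using inv[OF k(1)] cm[OF K_Lp[OF k(1)]] Hp0 by simp
  qed
  have from0: "\<Omega> k = 0" if k: "k \<in> Lp p" "coeffs_vanish_from 0 k" for k
  proof (cases "e = 2")
    case False
    then show ?thesis using es by (intro from1 k(1) coeffs_vanish_from_mono[OF k(2)]) auto
  next
    case True
    then have e: "e = 2" "s = - 1" using es by auto
    define x where "x t = inverse (chi \<beta> t)" for t
    have xL: "x \<in> Lp p"
      using Linf_mult_Lp[of "\<lambda>_. 1" p x] inverse_chi_Linf[OF beta] Lp_continuous[of "\<lambda>_. 1" p] p_ge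
      by (simp add: x_def[abs_def])
    have xi: "integrable circle x" by (rule Lp_imp_integrable[OF xL p_ge(1)])
    have one: "coeffs_vanish_from 1 (\<lambda>t. t powi 0)"
      using coeffs_vanish_from_powi[of 0] by simp
    have x_eq: "x t = lam \<beta> * inverse (cnj \<beta> * t - 1)" for t
      by (simp add: x_def chi_def divide_inverse)
    have "coeffs_vanish_from 0 (\<lambda>t. inverse (cnj \<beta> * t - 1))"
      using coeffs_vanish_from_divide[OF beta one] by simp
    then have x0: "coeffs_vanish_from 0 x"
      using xi by (simp add: coeffs_vanish_from_def x_eq[abs_def] fourier_coeff_cmult)
    have "fourier_coeff (\<lambda>t. x t * (cnj \<beta> * t - 1)) 0 = fourier_coeff (\<lambda>t. lam \<beta> * t powi 0) 0"
      using cnj_beta_t_nz[OF beta] by (intro fourier_coeff_cong) (simp add: x_eq)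
    then have "cnj \<beta> * fourier_coeff x (- 1) = lam \<beta>"
      unfolding fourier_coeff_mult_linear[OF xi] fourier_coeff_cmult fourier_coeff_monom
      using x0 by (simp add: coeffs_vanish_from_def)
    then have d: "fourier_coeff x (- 1) \<noteq> 0" using lam_nz[OF beta] by auto
    have "\<Omega> x = \<Omega> (\<lambda>t. s * K x t)" by (rule inv[OF xL, symmetric])
    also have "\<dots> = \<Omega> (\<lambda>t. (- 1) * x t)"
      using chi_nz[OF beta] by (intro cong Lp_cmult K_Lp xL p_ge)
        (simp add: e weighted_shift_def x_def chi_shift[OF beta] power2_eq_square)
    also have "\<dots> = - \<Omega> x" using cm[OF xL, of "- 1"] by simp
    finally have "\<Omega> x + \<Omega> x = 0" by simp
    then have \<Omega>x: "\<Omega> x = 0" by (simp flip: mult_2)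
    \<comment> \<open>For e = 2 the threshold of \<open>from1\<close> is -1, so the coefficient at
      -1 has to be removed first; 1 / chi can do this because its own coefficient there is
      nonzero.\<close>
    define c where "c = - fourier_coeff k (- 1) / fourier_coeff x (- 1)"
    have kxL: "(\<lambda>t. k t + c * x t) \<in> Lp p" by (intro Lp_add Lp_cmult k(1) xL p_ge)
    have "fourier_coeff (\<lambda>t. k t + c * x t) n = 0" if "- 1 \<le> n" for n
    proof (cases "n = - 1")
      case True
      then show ?thesis
        unfolding fourier_coeff_add_cmult[OF k(1) xL p_ge(1)] using d by (simp add: c_def)
    next
      case False
      then show ?thesis
        using that k(2) x0 by (simp add: fourier_coeff_add_cmult[OF k(1) xL p_ge(1)] coeffs_vanish_from_def)
    qed
    then have "\<Omega> (\<lambda>t. k t + c * x t) = 0"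
      using kxL by (intro from1) (auto simp: coeffs_vanish_from_def e Lp_imp_integrable p_ge)
    then show ?thesis using lin[OF k(1) xL, of c] \<Omega>x by simp
  qed
  define h where "h = riesz_P p f"
  have h: "h \<in> Hp p" unfolding h_def by (rule riesz_P_Hp[OF p f])
  have k: "(\<lambda>t. f t + (- 1) * h t) \<in> Lp p" by (intro Lp_add Lp_cmult f Hp_Lp[OF h] p_ge)
  have "coeffs_vanish_from 0 (\<lambda>t. f t + (- 1) * h t)"
    unfolding coeffs_vanish_from_def fourier_coeff_add_cmult[OF f Hp_Lp[OF h] p_ge(1)]
    using Lp_imp_integrable[OF k p_ge(1)] by (simp add: h_def fourier_coeff_riesz_P[OF p f])
  then have "\<Omega> (\<lambda>t. f t + (- 1) * h t) = 0" by (rule from0[OF k])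
  then show ?thesis using lin[OF f Hp_Lp[OF h], of "- 1"] Hp0[OF h] by simp
qed

text \<open>A enters only through its Fourier coefficients, since \<open>riesz_P\<close> fixes the
  values of A merely up to null functions.\<close>

lemma kernel_or_cokernel_trivial:
  assumes a: "invertible_Linf a"
    and A_Lp: "\<And>\<phi>. \<phi> \<in> Hp p \<Longrightarrow> A \<phi> \<in> Lp p"
    and A_coeff: "\<And>\<phi> n. \<phi> \<in> Hp p \<Longrightarrow>
      fourier_coeff (A \<phi>) n = (if 0 \<le> n then fourier_coeff (\<lambda>t. a t * (\<phi> t + s * K \<phi> t)) n else 0)"
  shows "ker_op p A = null_funs \<or> coker_op p A = {\<lambda>_. 0}"
proof -
  have aL: "a \<in> Linf" using a by (simp add: invertible_Linf_def)
  have A_Hp: "A \<phi> \<in> Hp p" if "\<phi> \<in> Hp p" for \<phi>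
    using A_Lp[OF that] A_coeff[OF that] by (simp add: Hp_def)
  note zero_Hp = Hp_zero[OF p_ge(1)]
  have null_Hp: "f \<in> Hp p" if "f \<in> null_funs" for f
    using that by (simp add: null_funs_iff[OF p_ge(1)] Hp_def)
  have pK_Lp: "(\<lambda>t. f t + s * K f t) \<in> Lp p" if "f \<in> Lp p" for f
    by (intro Lp_add Lp_cmult K_Lp that p_ge)
  have aK_Lp: "(\<lambda>t. a t * (f t + s * K f t)) \<in> Lp p" if "f \<in> Lp p" for f
    by (intro Linf_mult_Lp aL pK_Lp that p_ge)
  have null_ker: "null_funs \<subseteq> ker_op p A"
  proof
    fix f assume f: "f \<in> null_funs"
    note fH = null_Hp[OF f]
    have m: "f \<in> borel_measurable circle" "AE t in circle. f t = 0" using f by (auto simp: null_funs_def)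
    have "AE t in circle. a t * (f t + s * K f t) = 0"
      using m(2) AE_shift[OF beta m(2)] by eventually_elim (simp add: weighted_shift_def)
    then have "fourier_coeff (\<lambda>t. a t * (f t + s * K f t)) n = fourier_coeff (\<lambda>_. 0) n" for n
      using Lp_measurable[OF aK_Lp[OF Hp_Lp[OF fH]]] by (intro fourier_coeff_cong_AE) auto
    then have "A f \<in> null_funs"
      using A_Lp[OF fH] A_coeff[OF fH] by (simp add: null_funs_iff[OF p_ge(1)] fourier_coeff_def)
    then show "f \<in> ker_op p A" using fH by (simp add: ker_op_def)
  qed
  have zero_coker: "(\<lambda>_. 0) \<in> coker_op p A"
    by (auto simp: coker_op_def Hp_dual_def adjoint_op_def intro!: exI[of _ 0])
  show ?thesis
  proof (rule ccontr)
    assume "\<not> ?thesis"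
    then obtain \<phi> l where \<phi>: "\<phi> \<in> ker_op p A" "\<phi> \<notin> null_funs" and l: "l \<in> coker_op p A" "l \<noteq> (\<lambda>_. 0)"
      using null_ker zero_coker by blast
    have \<phi>H: "\<phi> \<in> Hp p" and A\<phi>: "A \<phi> \<in> null_funs" using \<phi> by (auto simp: ker_op_def)
    have ld: "l \<in> Hp_dual p" and la: "adjoint_op p A l = (\<lambda>_. 0)" using l by (auto simp: coker_op_def)
    have lA: "l (A f) = 0" if "f \<in> Hp p" for f
      using fun_cong[OF la, of f] that by (simp add: adjoint_op_def)
    define \<psi> where "\<psi> t = \<phi> t + s * K \<phi> t" for t
    define \<eta> where "\<eta> t = a t * \<psi> t" for t
    have \<psi>L: "\<psi> \<in> Lp p" unfolding \<psi>_def[abs_def] by (rule pK_Lp[OF Hp_Lp[OF \<phi>H]])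
    have \<eta>L: "\<eta> \<in> Lp p" unfolding \<eta>_def[abs_def] by (intro Linf_mult_Lp \<psi>L aL p_ge)
    have \<eta>0: "fourier_coeff \<eta> n = 0" if "0 \<le> n" for n
      using A\<phi> A_coeff[OF \<phi>H, of n] that
      by (simp add: null_funs_iff[OF p_ge(1)] \<eta>_def[abs_def] \<psi>_def[abs_def])
    then have \<eta>from: "coeffs_vanish_from 0 \<eta>"
      using \<eta>L by (simp add: coeffs_vanish_from_def Lp_imp_integrable p_ge)
    have K\<psi>: "s * K \<psi> t = \<psi> t" if t: "norm t = 1" for t
    proof -
      have "K \<psi> t = K \<phi> t + s * K (K \<phi>) t"
        by (simp add: \<psi>_def weighted_shift_def algebra_simps)
      then have "s * K \<psi> t = s * K \<phi> t + (s * s) * \<phi> t"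
        using K_K[OF t, of \<phi>] by (simp add: algebra_simps)
      then show ?thesis by (simp add: s_squared \<psi>_def)
    qed
    \<comment> \<open>On \<open>Hp\<close> this is l composed with A, hence 0; unlike A, the formula
      makes sense on all of \<open>Lp\<close>.\<close>
    define \<Omega> where "\<Omega> f = l (riesz_P p (\<lambda>t. a t * (f t + s * K f t)))" for f
    have \<Omega>_cong: "\<Omega> f = l (riesz_P p g)"
      if "f \<in> Lp p" "\<And>t. norm t = 1 \<Longrightarrow> a t * (f t + s * K f t) = g t" "g \<in> Lp p" for f g
      unfolding \<Omega>_def
      by (rule dual_riesz_P_cong[OF p ld aK_Lp[OF that(1)] that(3)]) (rule fourier_coeff_cong[OF that(2)])
    have \<Omega>0: "\<Omega> f = 0" if "f \<in> Lp p" for f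
    proof (rule invariant_functional_eq_0[OF _ _ _ _ that])
      fix f g c assume fg: "f \<in> Lp p" "g \<in> Lp p"
      have "\<Omega> (\<lambda>t. f t + c * g t) = l (riesz_P p (\<lambda>t. a t * (f t + s * K f t) + c * (a t * (g t + s * K g t))))"
        by (intro \<Omega>_cong Lp_add Lp_cmult fg aK_Lp p_ge) (simp add: weighted_shift_def algebra_simps)
      then show "\<Omega> (\<lambda>t. f t + c * g t) = \<Omega> f + c * \<Omega> g"
        unfolding \<Omega>_def dual_riesz_P_add_cmult[OF p ld aK_Lp[OF fg(1)] aK_Lp[OF fg(2)]] .
    next
      fix f g :: "complex \<Rightarrow> complex" assume f: "f \<in> Lp p" and eq: "\<And>t. norm t = 1 \<Longrightarrow> f t = g t"
      have "AE t in circle. g t = f t" using eq by (intro AE_I2) (simp add: in_space_circle_iff)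
      moreover have "g \<in> borel_measurable circle"
        using Lp_measurable[OF f] eq by (subst measurable_cong[of circle g f]) (auto simp: in_space_circle_iff)
      ultimately have g: "g \<in> Lp p"
        using f by (intro Lp_dominated[OF f p_ge(2), where C = 1]) (auto elim: eventually_mono)
      show "\<Omega> f = \<Omega> g"
        unfolding \<Omega>_def[of g] using eq norm_shift[OF beta]
        by (intro \<Omega>_cong f aK_Lp g) (simp add: weighted_shift_def)
    next
      fix f assume f: "f \<in> Hp p"
      have "l (riesz_P p (\<lambda>t. a t * (f t + s * K f t))) = l (A f)"
        by (rule dual_cong[OF p ld riesz_P_Hp[OF p aK_Lp[OF Hp_Lp[OF f]]] A_Hp[OF f]])
           (simp add: fourier_coeff_riesz_P[OF p aK_Lp[OF Hp_Lp[OF f]]] A_coeff[OF f])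
      then show "\<Omega> f = 0" by (simp add: \<Omega>_def lA[OF f])
    next
      fix f assume f: "f \<in> Lp p"
      show "\<Omega> (\<lambda>t. s * K f t) = \<Omega> f"
        unfolding \<Omega>_def[of f]
      proof (rule \<Omega>_cong)
        fix t :: complex assume t: "norm t = 1"
        have "s * K (\<lambda>t. s * K f t) t = (s * s) * f t" using K_K[OF t, of f] by (simp add: K_cmult)
        then show "a t * (s * K f t + s * K (\<lambda>t. s * K f t) t) = a t * (f t + s * K f t)"
          by (simp add: s_squared)
      qed (intro Lp_cmult K_Lp f aK_Lp p_ge)+
    qed
    have conv: "(\<Sum>i<k. l (poly (monom 1 i)) * fourier_coeff \<eta> (int i - int k)) = 0" for k :: nat
    proof -
      have tk: "(\<lambda>t. t ^ k) \<in> Linf" by (rule Linf_continuous) (intro continuous_intros)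
      have sk: "(\<lambda>t. shift \<beta> t ^ k) \<in> Linf"
        by (rule Linf_continuous) (intro continuous_intros continuous_on_shift[OF beta])
      define f1 where "f1 t = t ^ k * \<eta> t" for t
      define f2 where "f2 t = shift \<beta> t ^ k * \<eta> t" for t
      have f1L: "f1 \<in> Lp p" unfolding f1_def[abs_def] by (intro Linf_mult_Lp \<eta>L tk p_ge)
      have f2L: "f2 \<in> Lp p" unfolding f2_def[abs_def] by (intro Linf_mult_Lp \<eta>L sk p_ge)
      have "\<Omega> (\<lambda>t. t ^ k * \<psi> t) = l (riesz_P p (\<lambda>t. f1 t + 1 * f2 t))"
      proof (rule \<Omega>_cong)
        show "(\<lambda>t. t ^ k * \<psi> t) \<in> Lp p" by (intro Linf_mult_Lp \<psi>L tk p_ge)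
        show "(\<lambda>t. f1 t + 1 * f2 t) \<in> Lp p" by (intro Lp_add Lp_cmult f1L f2L p_ge)
        fix t :: complex assume t: "norm t = 1"
        \<comment> \<open>Multiplication by t^k passes through K as multiplication by the k-th power
          of \<alpha>, and \<psi> itself is fixed by s K.\<close>
        have "s * K (\<lambda>t. t ^ k * \<psi> t) t = shift \<beta> t ^ k * (s * K \<psi> t)"
          by (simp add: weighted_shift_def)
        then show "a t * (t ^ k * \<psi> t + s * K (\<lambda>t. t ^ k * \<psi> t) t) = f1 t + 1 * f2 t"
          by (simp add: K\<psi>[OF t] f1_def f2_def \<eta>_def algebra_simps)
      qed
      then have "l (riesz_P p f1) + 1 * l (riesz_P p f2) = 0"
        using \<Omega>0[of "\<lambda>t. t ^ k * \<psi> t"] Linf_mult_Lp[OF \<psi>L tk p_ge(2)]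
          dual_riesz_P_add_cmult[OF p ld f1L f2L, of 1] by simp
      moreover have "l (riesz_P p f2) = 0"
      proof (rule dual_riesz_P_eq_0[OF p ld f2L])
        \<comment> \<open>The k-th power of \<alpha> has order 0 at infinity, so the threshold 0 is
          preserved.\<close>
        have v: "coeffs_vanish_from (0 + int k + (- int k)) (\<lambda>t. \<eta> t * (t - \<beta>) powi int k * (cnj \<beta> * t - 1) powi (- int k))"
          by (rule coeffs_vanish_from_rational[OF beta \<eta>from]) simp
        have e: "\<eta> t * (t - \<beta>) powi int k * (cnj \<beta> * t - 1) powi (- int k) = f2 t" if "norm t = 1" for t
          by (simp only: f2_def shift_def divide_inverse power_mult_distrib power_int_minus power_int_of_nat power_inverse ac_simps)
        have "coeffs_vanish_from 0 f2 \<longleftrightarrow>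
            coeffs_vanish_from 0 (\<lambda>t. \<eta> t * (t - \<beta>) powi int k * (cnj \<beta> * t - 1) powi (- int k))"
          by (rule coeffs_vanish_from_cong) (rule e[symmetric])
        then have "coeffs_vanish_from 0 f2" using v by simp
        then show "fourier_coeff f2 n = 0" if "0 \<le> n" for n
          using that by (simp add: coeffs_vanish_from_def)
      qed
      ultimately have f1z: "l (riesz_P p f1) = 0" by simp
      have f1c: "fourier_coeff f1 n = fourier_coeff \<eta> (n - int k)" for n
        using fourier_coeff_mult_powi[of "int k" \<eta> n] by (simp add: f1_def[abs_def])
      \<comment> \<open>Since \<eta> lives on negative indices, the projection of \<open>f1\<close>
        is represented by a polynomial with terms i < k only; its value under l is computed by
        induction on the number m of terms.\<close>
      have sum: "(\<lambda>t. \<Sum>i<m. fourier_coeff \<eta> (int i - int k) * poly (monom 1 i) t) \<in> Hp p \<and>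
          l (\<lambda>t. \<Sum>i<m. fourier_coeff \<eta> (int i - int k) * poly (monom 1 i) t) =
            (\<Sum>i<m. fourier_coeff \<eta> (int i - int k) * l (poly (monom 1 i))) \<and>
          (\<forall>n\<ge>0. fourier_coeff (\<lambda>t. \<Sum>i<m. fourier_coeff \<eta> (int i - int k) * poly (monom 1 i) t) n =
            (if n < int m then fourier_coeff \<eta> (n - int k) else 0))" for m
      proof (induction m)
        case 0
        show ?case
          using zero_Hp dual_add_cmult[OF p ld zero_Hp zero_Hp, of "- 1"] by (simp add: fourier_coeff_def)
      next
        case (Suc m)
        note M = Hp_poly[OF p_ge(1), of "monom 1 m"]
        let ?S = "\<lambda>t. \<Sum>i<m. fourier_coeff \<eta> (int i - int k) * poly (monom 1 i) t"
        have S: "?S \<in> Hp p" using Suc.IH by blast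
        have "fourier_coeff (\<lambda>t. ?S t + fourier_coeff \<eta> (int m - int k) * poly (monom 1 m) t) n =
            (if n < int (Suc m) then fourier_coeff \<eta> (n - int k) else 0)" if "0 \<le> n" for n
          unfolding fourier_coeff_add_cmult[OF Hp_Lp[OF S] Hp_Lp[OF M] p_ge(1)] fourier_coeff_poly
          using Suc.IH that by auto
        then show ?case
          using Suc.IH dual_add_cmult[OF p ld S M, of "fourier_coeff \<eta> (int m - int k)"]
            Hp_add_cmult[OF S M p_ge(1), of "fourier_coeff \<eta> (int m - int k)"]
          by simp
      qed
      have "l (riesz_P p f1) = l (\<lambda>t. \<Sum>i<k. fourier_coeff \<eta> (int i - int k) * poly (monom 1 i) t)"
      proof (rule dual_cong[OF p ld riesz_P_Hp[OF p f1L]])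
        fix n :: int assume n: "0 \<le> n"
        show "fourier_coeff (riesz_P p f1) n = fourier_coeff (\<lambda>t. \<Sum>i<k. fourier_coeff \<eta> (int i - int k) * poly (monom 1 i) t) n"
          using n sum[of k] \<eta>0[of "n - int k"] by (auto simp: fourier_coeff_riesz_P[OF p f1L] f1c)
      qed (use sum[of k] in blast)
      then show ?thesis using f1z sum[of k] by (simp add: mult.commute)
    qed
    \<comment> \<open>The index - 1 - j makes the first possibly nonzero coefficient of \<eta> the
      constant term of the series, so that the n-th coefficient of the product is the relation
      \<open>conv\<close> for k = n + 1.\<close>
    define E where "E = Abs_fps (\<lambda>j. fourier_coeff \<eta> (- 1 - int j))"
    define M where "M = Abs_fps (\<lambda>i. l (poly (monom 1 i)))"
    have "M * E = 0"
    proof (rule fps_ext)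
      fix n
      have "fps_nth (M * E) n = (\<Sum>i<Suc n. l (poly (monom 1 i)) * fourier_coeff \<eta> (int i - int (Suc n)))"
        unfolding fps_mult_nth lessThan_Suc_atMost atMost_atLeast0
        by (rule sum.cong) (auto simp: M_def E_def of_nat_diff algebra_simps)
      then show "fps_nth (M * E) n = fps_nth 0 n" using conv[of "Suc n"] by simp
    qed
    then consider "M = 0" | "E = 0" by (auto simp: mult_eq_0_iff)
    then show False
    proof cases
      case 1
      then have "l (poly (monom 1 k)) = 0" for k
        using fps_nth_Abs_fps[of "\<lambda>i. l (poly (monom 1 i))" k] by (simp add: M_def[symmetric])
      then have "l f = 0" if "f \<in> Hp p" for f
        by (rule dual_eq_0_if_monomials[OF p ld _ that])
      moreover have "l f = 0" if "f \<notin> Hp p" for f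
        using ld that by (simp add: Hp_dual_def)
      ultimately have "l = (\<lambda>_. 0)" by blast
      then show False using l(2) by simp
    next
      case 2
      have "fourier_coeff \<eta> n = 0" for n
      proof (cases "0 \<le> n")
        case False
        have "fps_nth E (nat (- 1 - n)) = fourier_coeff \<eta> n" using False by (simp add: E_def)
        then show ?thesis using 2 by simp
      qed (rule \<eta>0)
      then have "AE t in circle. \<eta> t = 0"
        by (rule fourier_coeff_eq_0_imp_AE[OF Lp_imp_integrable[OF \<eta>L p_ge(1)]])
      moreover obtain b where "AE t in circle. a t * b t = 1" using a by (auto simp: invertible_Linf_def)
      \<comment> \<open>Invertibility of a removes the symbol from a \<psi> = 0.\<close>
      ultimately have "AE t in circle. \<phi> t + s * K \<phi> t = 0"
        by eventually_elim (auto simp: \<eta>_def \<psi>_def)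
      then have "\<phi> \<in> null_funs" by (rule plus_K_injective[OF \<phi>H])
      then show False using \<phi>(2) by simp
    qed
  qed
qed

end

text \<open>J maps \<open>Hp\<close> into functions without coefficients of index \<ge> 0, so
  \<open>riesz_Q\<close> acts on them as the identity up to a null function and may be omitted under
  the outer projection. The symbol b is given by a pointwise equation to fit the different forms in
  which it occurs.\<close>

lemma toeplitz_plus_hankel_coeff:
  fixes s :: complex
  assumes p: "1 < p" and beta: "1 < norm \<beta>" and a: "a \<in> Linf" and c: "c \<in> Linf" and \<phi>: "\<phi> \<in> Hp p"
    and b: "\<And>t. b t = a t * c t"
  defines "B \<equiv> (\<lambda>t. toeplitz p a \<phi> t + s * hankel p \<beta> b \<phi> t)"
  shows "B \<in> Lp p"
    and "fourier_coeff B n = (if 0 \<le> n then fourier_coeff (\<lambda>t. a t * (\<phi> t + s * (c t * J_shift \<beta> \<phi> t))) n else 0)"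
proof -
  have p1: "1 \<le> p" "0 \<le> p" using p by auto
  have J: "J_shift \<beta> \<phi> = weighted_shift \<beta> 1 \<phi>"
    by (simp add: J_shift_def weighted_shift_def fun_eq_iff)
  have \<phi>L: "\<phi> \<in> Lp p" and \<phi>b: "coeffs_vanish_below 0 \<phi>"
    using \<phi> Hp_iff_coeffs_vanish_below[OF p1(1)] by auto
  have JL: "J_shift \<beta> \<phi> \<in> Lp p" unfolding J by (rule weighted_shift_Lp[OF beta \<phi>L p1(2)])
  have "coeffs_vanish_from 0 (J_shift \<beta> \<phi>)"
    unfolding J using coeffs_vanish_from_weighted_shift[OF beta \<phi>L p1(1) \<phi>b, of 1] by simp
  then have "riesz_P p (J_shift \<beta> \<phi>) \<in> null_funs"
    by (simp add: null_funs_iff[OF p1(1)] riesz_P_Lp[OF p JL] fourier_coeff_riesz_P[OF p JL] coeffs_vanish_from_def)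
  then have AEQ: "AE t in circle. riesz_Q p (J_shift \<beta> \<phi>) t = J_shift \<beta> \<phi> t"
    by (auto simp: null_funs_def riesz_Q_def elim: eventually_mono)
  have QL: "riesz_Q p (J_shift \<beta> \<phi>) \<in> Lp p"
    unfolding riesz_Q_def by (intro Lp_diff JL riesz_P_Lp[OF p JL] p1)
  have bL: "b \<in> Linf" using Linf_mult[OF a c] b by (metis (no_types, lifting) ext)
  have f1: "(\<lambda>t. a t * \<phi> t) \<in> Lp p" by (intro Linf_mult_Lp a \<phi>L p1)
  have f2: "(\<lambda>t. b t * riesz_Q p (J_shift \<beta> \<phi>) t) \<in> Lp p" by (intro Linf_mult_Lp bL QL p1)
  have f3: "(\<lambda>t. b t * J_shift \<beta> \<phi> t) \<in> Lp p" by (intro Linf_mult_Lp bL JL p1)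
  have T: "toeplitz p a \<phi> \<in> Lp p" unfolding toeplitz_def by (rule riesz_P_Lp[OF p f1])
  have H: "hankel p \<beta> b \<phi> \<in> Lp p" unfolding hankel_def by (rule riesz_P_Lp[OF p f2])
  show "B \<in> Lp p" unfolding B_def by (intro Lp_add Lp_cmult T H p1)
  have q: "fourier_coeff (\<lambda>t. b t * riesz_Q p (J_shift \<beta> \<phi>) t) n = fourier_coeff (\<lambda>t. b t * J_shift \<beta> \<phi> t) n"
    by (rule fourier_coeff_cong_AE[OF _ Lp_measurable[OF f2] Lp_measurable[OF f3]])
       (use AEQ in \<open>auto elim: eventually_mono\<close>)
  have "fourier_coeff B n = (if 0 \<le> n then fourier_coeff (\<lambda>t. a t * \<phi> t) n + s * fourier_coeff (\<lambda>t. b t * J_shift \<beta> \<phi> t) n else 0)"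
    unfolding B_def fourier_coeff_add_cmult[OF T H p1(1)]
    by (simp add: toeplitz_def hankel_def fourier_coeff_riesz_P[OF p f1] fourier_coeff_riesz_P[OF p f2] q)
  also have "fourier_coeff (\<lambda>t. a t * \<phi> t) n + s * fourier_coeff (\<lambda>t. b t * J_shift \<beta> \<phi> t) n =
      fourier_coeff (\<lambda>t. a t * \<phi> t + s * (b t * J_shift \<beta> \<phi> t)) n"
    by (rule fourier_coeff_add_cmult[OF f1 f3 p1(1), symmetric])
  also have "(\<lambda>t. a t * \<phi> t + s * (b t * J_shift \<beta> \<phi> t)) = (\<lambda>t. a t * (\<phi> t + s * (c t * J_shift \<beta> \<phi> t)))"
    by (simp add: b algebra_simps)
  finally show "fourier_coeff B n = (if 0 \<le> n then fourier_coeff (\<lambda>t. a t * (\<phi> t + s * (c t * J_shift \<beta> \<phi> t))) n else 0)" .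
qed

text \<open>The factor c equal to 1 / chi, 1 or chi corresponds to e = 2, 1, 0. The relation between
  c and e is required on the circle only, because chi has a zero inside the disc.\<close>

lemma toeplitz_plus_hankel_kernel_or_cokernel_trivial:
  assumes p: "1 < p" and beta: "1 < norm \<beta>" and a: "invertible_Linf a" and c: "c \<in> Linf"
    and es: "e = 0 \<and> s = 1 \<or> e = 1 \<and> (s = 1 \<or> s = - 1) \<or> e = 2 \<and> s = - 1"
    and ce: "\<And>t. norm t = 1 \<Longrightarrow> c t * inverse (chi \<beta> t) = inverse (chi \<beta> t) ^ e"
    and b: "\<And>t. b t = a t * c t"
    and A: "A = (\<lambda>\<phi> t. toeplitz p a \<phi> t + s * hankel p \<beta> b \<phi> t)"
  shows "ker_op p A = null_funs \<or> coker_op p A = {\<lambda>_. 0}"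
proof (rule kernel_or_cokernel_trivial[OF p beta es a])
  have aL: "a \<in> Linf" using a by (simp add: invertible_Linf_def)
  fix \<phi> n assume \<phi>: "\<phi> \<in> Hp p"
  note T = toeplitz_plus_hankel_coeff[OF p beta aL c \<phi> b, where s = s]
  show "A \<phi> \<in> Lp p" unfolding A by (rule T(1))
  have "fourier_coeff (\<lambda>t. a t * (\<phi> t + s * (c t * J_shift \<beta> \<phi> t))) n =
      fourier_coeff (\<lambda>t. a t * (\<phi> t + s * weighted_shift \<beta> e \<phi> t)) n"
    by (rule fourier_coeff_cong) (simp add: J_shift_def weighted_shift_def mult.assoc flip: ce)
  then show "fourier_coeff (A \<phi>) n = (if 0 \<le> n then fourier_coeff (\<lambda>t. a t * (\<phi> t + s * weighted_shift \<beta> e \<phi> t)) n else 0)"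
    unfolding A T(2) by simp
qed

theorem theorem3p1:
  fixes p :: real and \<beta> :: complex and a :: "complex \<Rightarrow> complex"
    and A :: "(complex \<Rightarrow> complex) \<Rightarrow> complex \<Rightarrow> complex"
  assumes "1 < p"
    and "1 < norm \<beta>"
    and "invertible_Linf a"
    and "A \<in> {
      (\<lambda>\<phi> t. toeplitz p a \<phi> t - hankel p \<beta> (\<lambda>s. a s * inverse (chi \<beta> s)) \<phi> t),
      (\<lambda>\<phi> t. toeplitz p a \<phi> t + hankel p \<beta> (\<lambda>s. a s * chi \<beta> s) \<phi> t),
      (\<lambda>\<phi> t. toeplitz p a \<phi> t + hankel p \<beta> a \<phi> t),
      (\<lambda>\<phi> t. toeplitz p a \<phi> t - hankel p \<beta> a \<phi> t)}"
  shows "ker_op p A = null_funs \<or> coker_op p A = {\<lambda>_. 0}"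
proof -
  note main = toeplitz_plus_hankel_kernel_or_cokernel_trivial[OF assms(1-3)]
  have one: "(\<lambda>_. 1) \<in> Linf" by (rule Linf_continuous) simp
  have chi: "chi \<beta> \<in> Linf"
    unfolding chi_def by (rule Linf_continuous) (intro continuous_intros; use lam_nz[OF assms(2)] in force)
  consider
      "A = (\<lambda>\<phi> t. toeplitz p a \<phi> t - hankel p \<beta> (\<lambda>s. a s * inverse (chi \<beta> s)) \<phi> t)"
    | "A = (\<lambda>\<phi> t. toeplitz p a \<phi> t + hankel p \<beta> (\<lambda>s. a s * chi \<beta> s) \<phi> t)"
    | "A = (\<lambda>\<phi> t. toeplitz p a \<phi> t + hankel p \<beta> a \<phi> t)"
    | "A = (\<lambda>\<phi> t. toeplitz p a \<phi> t - hankel p \<beta> a \<phi> t)"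
    using assms(4) by blast
  then show ?thesis
  proof cases
    case 1
    then show ?thesis
      by (intro main[OF inverse_chi_Linf[OF assms(2)], of 2 "- 1"]) (auto simp: power2_eq_square)
  next
    case 2
    then show ?thesis
      using chi_nz[OF assms(2)] by (intro main[OF chi, of 0 1]) auto
  next
    case 3
    then show ?thesis by (intro main[OF one, of 1 1 a]) auto
  next
    case 4
    then show ?thesis by (intro main[OF one, of 1 "- 1" a]) auto
  qed
qed

end
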